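(* Let $Y$ be the $Y$-graph, with arms of length at least $2$. Let $F(Y,2)$ be the space of ordered pairs of distinct points of $Y$, and let $F_I(Y,2)$ be $F(Y,2)$ with the intrinsic metric. Then $$\mathrm{GC}(F_I(Y,2))=\mathrm{TC}(F(Y,2))=1.$$
   Context: The $Y$-graph $Y$ is the metric graph consisting of three arms (closed segments) glued at one endpoint of each to form a single essential vertex $v$ of order 3; each arm is assumed to have length at least $2$, and $d(x,y)$ denotes distance in the graph. The space $F(Y,2)=\{(a,a')\in Y\times Y: a\ne a'\}$ is given the subspace metric from $Y\times Y$ with $d((a,a'),(b,b'))=\sqrt{d(a,b)^2+d(a',b')^2}$. The intrinsic metric $d_I$ on $F(Y,2)$ is defined by letting $d_I(x,y)$ be the infimum of the $d$-lengths of paths in $F(Y,2)$ from $x$ to $y$ (it induces the same topology as $d$). $F_I(Y,2)$ denotes $F(Y,2)$ with the metric $d_I$, and completion, geodesics, near-geodesics and $\mathrm{GC}$ are taken with respect to $d_I$. Let $I=[0,1]$. For a topological space $Z$, $P(Z)=Z^I$ is the space of continuous maps $I\to Z$ with the compact-open topology, and $P(Z;z_0,z_1)$ is the subspace of paths from $z_0$ to $z_1$. The length of a path in a metric space is the supremum of the sums of distances between successive points on the path. A (minimal) geodesic from $x_0$ to $x_1$ in a metric space $(Z,d)$ is a path $\gamma$ from $x_0$ to $x_1$ with $d(\gamma(t),\gamma(t'))=|t-t'|\,d(x_0,x_1)$ for all $t,t'\in I$. A metric space is geodesic if every pair of its points is joined by a geodesic. Let $X$ be a metric space whose completion $\overline{X}$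 is geodesic. For $x_0,x_1\in X$, a near-geodesic from $x_0$ to $x_1$ is a continuous map $\phi:I\to P(\overline{X};x_0,x_1)$ such that (i) $\phi(0)$ is a geodesic in $\overline{X}$ from $x_0$ to $x_1$; (ii) $\phi((0,1])\subset P(X;x_0,x_1)$; (iii) if $s_n\to 0$, then $\operatorname{length}(\phi(s_n))\to\operatorname{length}(\phi(0))$. For $E\subset X\times X$, a near-geodesic motion planning rule (NGMPR) on $E$ is a continuous map $\Phi:E\to P(\overline{X})^I$ such that, for all $(x_0,x_1)\in E$, $\Phi(x_0,x_1)$ is a near-geodesic from $x_0$ to $x_1$, with the additional proviso that $\Phi(x_0,x_1)(0)$ is a geodesic in $X$ if a geodesic in $X$ from $x_0$ to $x_1$ exists. The geodesic complexity $\mathrm{GC}(X)$ is the smallest $k$ such that $X\times X$ can be partitioned into locally compact sets $E_0,\ldots,E_k$ such that each $E_i$ has an NGMPR. The topological complexity $\mathrm{TC}(X)$ of a topological space $X$ (Farber, reduced version) is the smallest $k$ such that $X\times X$ can be partitioned into locally compact sets $E_0,\ldots,E_k$ on each of which there is a continuous map $s_i:E_i\to P(X)$ with $s_i(x_0,x_1)$ a path from $x_0$ to $x_1$ for all $(x_0,x_1)\in E_i$. *)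

theory Defs
  imports "HOL-Analysis.Analysis" "HOL-Library.Extended_Nat"
begin

section \<open>Path spaces with the compact-open topology\<close>

abbreviation unit_interval :: "real topology" where
  "unit_interval \<equiv> top_of_set {0..1}"

text \<open>Maps out of \<open>X\<close> are represented by functions that are \<open>extensional\<close> on \<open>topspace X\<close>,
  so that each continuous map is a single point of the mapping space.\<close>

definition continuous_maps :: "'a topology \<Rightarrow> 'b topology \<Rightarrow> ('a \<Rightarrow> 'b) set" where
  "continuous_maps X Y = {f \<in> extensional (topspace X). continuous_map X Y f}"

definition compact_open_topology :: "'a topology \<Rightarrow> 'b topology \<Rightarrow> ('a \<Rightarrow> 'b) topology" where
  "compact_open_topology X Y =
     topology_generated_by
       {{f \<in> continuous_maps X Y. f ` K \<subseteq> U} |K U. compactin X K \<and> openin Y U}"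

lemma topspace_compact_open_topology [simp]:
  "topspace (compact_open_topology X Y) = continuous_maps X Y"
proof -
  have "continuous_maps X Y = {f \<in> continuous_maps X Y. f ` {} \<subseteq> {}}"
    by simp
  moreover have "compactin X {}" "openin Y {}"
    by auto
  ultimately show ?thesis
    unfolding compact_open_topology_def topology_generated_by_topspace by blast
qed

definition path_space :: "'a topology \<Rightarrow> (real \<Rightarrow> 'a) topology" where
  "path_space Z = compact_open_topology unit_interval Z"

definition paths_between :: "'a topology \<Rightarrow> 'a \<Rightarrow> 'a \<Rightarrow> (real \<Rightarrow> 'a) set" where
  "paths_between Z z0 z1 = {g \<in> topspace (path_space Z). g 0 = z0 \<and> g 1 = z1}"


section \<open>Length, geodesics and the intrinsic metric\<close>

definition path_length :: "'a metric \<Rightarrow> (real \<Rightarrow> 'a) \<Rightarrow> ennreal" where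
  "path_length m g =
     (SUP (n, t) \<in> {(n, t::nat \<Rightarrow> real). mono_on {..n} t \<and> t ` {..n} \<subseteq> {0..1}}.
        \<Sum>i<n. ennreal (mdist m (g (t i)) (g (t (Suc i)))))"

definition geodesic :: "'a metric \<Rightarrow> 'a \<Rightarrow> 'a \<Rightarrow> (real \<Rightarrow> 'a) \<Rightarrow> bool" where
  "geodesic m x0 x1 g \<longleftrightarrow>
     g \<in> paths_between (mtopology_of m) x0 x1 \<and>
     (\<forall>t\<in>{0..1}. \<forall>t'\<in>{0..1}. mdist m (g t) (g t') = \<bar>t - t'\<bar> * mdist m x0 x1)"

definition geodesic_space :: "'a metric \<Rightarrow> bool" where
  "geodesic_space m \<longleftrightarrow> (\<forall>x0\<in>mspace m. \<forall>x1\<in>mspace m. \<exists>g. geodesic m x0 x1 g)"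

text \<open>This is the intrinsic metric as soon as any two points of \<open>m\<close> are joined by a path of
  finite length.\<close>

definition intrinsic_metric :: "'a metric \<Rightarrow> 'a metric" where
  "intrinsic_metric m =
     metric (mspace m,
       \<lambda>x y. enn2real (INF g \<in> paths_between (mtopology_of m) x y. path_length m g))"


section \<open>Completion\<close>

text \<open>The completion is realised as the closure of the Kuratowski embedding in the space of
  bounded real functions with the supremum metric; the lemmas below characterise it (up to
  isometry) as a complete space containing an isometric dense copy of \<open>m\<close>.\<close>

definition completion_embedding :: "'a metric \<Rightarrow> 'a \<Rightarrow> 'a \<Rightarrow> real" where
  "completion_embedding m x =
     (\<lambda>u \<in> mspace m. mdist m x u - mdist m (SOME a. a \<in> mspace m) u)"

definition metric_completion :: "'a metric \<Rightarrow> ('a \<Rightarrow> real) metric" where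
  "metric_completion m =
     submetric (funspace (mspace m) euclidean_metric)
       (mtopology_of (funspace (mspace m) euclidean_metric)
          closure_of (completion_embedding m ` mspace m))"

lemma completion_embedding_in_funspace:
  assumes "x \<in> mspace m"
  shows "completion_embedding m x \<in> mspace (funspace (mspace m) euclidean_metric)"
proof -
  define a where "a = (SOME a. a \<in> mspace m)"
  have a: "a \<in> mspace m"
    unfolding a_def using assms by (rule someI)
  have "\<bar>mdist m x u - mdist m a u\<bar> \<le> mdist m a x" if "u \<in> mspace m" for u
    using mdist_triangle[of x m a u] mdist_triangle[of a m x u] mdist_commute[of m a x] a assms that
    by linarith
  then have "(\<lambda>u. mdist m x u - mdist m a u) ` mspace m \<subseteq> cball 0 (mdist m a x)"
    by force
  then have "bounded (completion_embedding m x ` mspace m)"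
    unfolding completion_embedding_def a_def[symmetric]
    by (metis bounded_cball bounded_subset image_restrict_eq)
  then show ?thesis
    by (simp add: Met_TC.fspace_def completion_embedding_def)
qed

lemma mdist_completion_embedding:
  assumes x: "x \<in> mspace m" and y: "y \<in> mspace m"
  shows "mdist (metric_completion m) (completion_embedding m x) (completion_embedding m y)
           = mdist m x y"
proof -
  have eq: "dist (completion_embedding m x u) (completion_embedding m y u)
              = \<bar>mdist m x u - mdist m y u\<bar>" if "u \<in> mspace m" for u
    using that by (simp add: completion_embedding_def dist_real_def)
  have le: "\<bar>mdist m x u - mdist m y u\<bar> \<le> mdist m x y" if "u \<in> mspace m" for u
    using mdist_triangle[of x m y u] mdist_triangle[of y m x u] mdist_commute[of m x y] x y that
    by linarith
  have yy: "mdist m y y = 0"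
    using y by simp
  have "(SUP u\<in>mspace m. dist (completion_embedding m x u) (completion_embedding m y u))
          = mdist m x y"
  proof (rule cSup_eq_maximum)
    show "mdist m x y \<in> (\<lambda>u. dist (completion_embedding m x u) (completion_embedding m y u))
            ` mspace m"
      using y by (intro image_eqI[where x = y]) (simp_all add: eq yy)
  qed (use eq le in auto)
  then show ?thesis
    using completion_embedding_in_funspace[OF x] completion_embedding_in_funspace[OF y] x
    by (auto simp: metric_completion_def Met_TC.fdist_def)
qed

lemma completion_embedding_in_completion:
  "completion_embedding m ` mspace m \<subseteq> mspace (metric_completion m)"
  using completion_embedding_in_funspace[of _ m] closure_of_subset
    [of "completion_embedding m ` mspace m"
        "mtopology_of (funspace (mspace m) euclidean_metric)"]
  by (fastforce simp: metric_completion_def)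

lemma completion_embedding_dense:
  "mtopology_of (metric_completion m) closure_of (completion_embedding m ` mspace m)
     = mspace (metric_completion m)"
  using completion_embedding_in_completion[of m]
  by (auto simp: metric_completion_def mtopology_of_submetric closure_of_subtopology Int_absorb1
           dest: closure_of_subset_topspace[THEN subsetD])

lemma mcomplete_of_metric_completion: "mcomplete_of (metric_completion m)"
proof -
  let ?M = "mspace m"
  let ?F = "funspace ?M (euclidean_metric :: real metric)"
  let ?S = "mtopology_of ?F closure_of (completion_embedding m ` ?M)"
  have sub: "?S \<subseteq> Met_TC.fspace ?M"
    using closure_of_subset_topspace[of "mtopology_of ?F"] by fastforce
  interpret S: Submetric "Met_TC.fspace ?M" "Met_TC.fdist ?M" "?S \<inter> Met_TC.fspace ?M"
    by (simp add: Met_TC.Metric_space_funspace Submetric.intro Submetric_axioms_def)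
  have "closedin S.mtopology (?S \<inter> Met_TC.fspace ?M)"
    by (simp add: closedin_Int funspace_def)
  moreover have "S.mcomplete"
    using Metric_space.mcomplete_funspace Met_TC.Metric_space_axioms
    by (fastforce simp: mcomplete_of_def)
  ultimately show ?thesis
    by (simp add: metric_completion_def S.closedin_eq_mcomplete mcomplete_of_def)
qed


section \<open>Geodesic complexity and topological complexity\<close>

text \<open>\<open>X\<close> is regarded as a subspace of its completion via \<open>completion_embedding X\<close>.\<close>

definition near_geodesic :: "'a metric \<Rightarrow> 'a \<Rightarrow> 'a \<Rightarrow> (real \<Rightarrow> real \<Rightarrow> 'a \<Rightarrow> real) \<Rightarrow> bool" where
  "near_geodesic X x0 x1 \<phi> \<longleftrightarrow>
     (let Xc = metric_completion X; e = completion_embedding X in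
        continuous_map unit_interval
          (subtopology (path_space (mtopology_of Xc))
             (paths_between (mtopology_of Xc) (e x0) (e x1))) \<phi> \<and>
        geodesic Xc (e x0) (e x1) (\<phi> 0) \<and>
        (\<forall>s\<in>{0<..1}. \<phi> s ` {0..1} \<subseteq> e ` mspace X) \<and>
        (\<forall>s. range s \<subseteq> {0..1} \<and> s \<longlonglongrightarrow> 0 \<longrightarrow>
             (\<lambda>n. path_length Xc (\<phi> (s n))) \<longlonglongrightarrow> path_length Xc (\<phi> 0)))"

definition NGMPR ::
  "'a metric \<Rightarrow> ('a \<times> 'a) set \<Rightarrow> ('a \<times> 'a \<Rightarrow> real \<Rightarrow> real \<Rightarrow> 'a \<Rightarrow> real) \<Rightarrow> bool" where
  "NGMPR X E \<Phi> \<longleftrightarrow>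
     E \<subseteq> mspace X \<times> mspace X \<and>
     continuous_map
       (subtopology (prod_topology (mtopology_of X) (mtopology_of X)) E)
       (compact_open_topology unit_interval (path_space (mtopology_of (metric_completion X)))) \<Phi> \<and>
     (\<forall>(x0, x1)\<in>E.
        near_geodesic X x0 x1 (\<Phi> (x0, x1)) \<and>
        ((\<exists>g. geodesic X x0 x1 g) \<longrightarrow>
           \<Phi> (x0, x1) 0 ` {0..1} \<subseteq> completion_embedding X ` mspace X))"

definition locally_compact_partition :: "'a topology \<Rightarrow> nat \<Rightarrow> (nat \<Rightarrow> 'a set) \<Rightarrow> bool" where
  "locally_compact_partition T k E \<longleftrightarrow>
     (\<Union>i\<le>k. E i) = topspace T \<and> disjoint_family_on E {..k} \<and>
     (\<forall>i\<le>k. locally_compact_space (subtopology T (E i)))"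

text \<open>Geodesic complexity is only meaningful for spaces with geodesic completion. For all other
  spaces, and when there is no suitable finite partition, the value is \<open>\<infinity>\<close>; so an equation
  \<open>GC X = enat k\<close> includes the assertion that the completion of \<open>X\<close> is geodesic.\<close>

definition GC :: "'a metric \<Rightarrow> enat" where
  "GC X =
     (if geodesic_space (metric_completion X)
      then INF k \<in> {k. \<exists>E. locally_compact_partition
                              (prod_topology (mtopology_of X) (mtopology_of X)) k E \<and>
                          (\<forall>i\<le>k. \<exists>\<Phi>. NGMPR X (E i) \<Phi>)}. enat k
      else \<infinity>)"

definition TC :: "'a topology \<Rightarrow> enat" where
  "TC Z =
     (INF k \<in> {k. \<exists>E. locally_compact_partition (prod_topology Z Z) k E \<and>
                    (\<forall>i\<le>k. \<exists>s. continuous_map (subtopology (prod_topology Z Z) (E i))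
                                  (path_space Z) s \<and>
                                (\<forall>(x0, x1)\<in>E i. s (x0, x1) \<in> paths_between Z x0 x1))}. enat k)"


section \<open>The Y-graph and its ordered configuration space of two points\<close>

text \<open>The three arms, of lengths \<open>L i\<close>, are laid along the coordinate axes of three-space, with
  the essential vertex at the origin. The sum metric restricted to their union is the distance in
  the graph, see \<open>mdist_Y_graph\<close>.\<close>

definition Y_graph :: "(3 \<Rightarrow> real) \<Rightarrow> (real^3) metric" where
  "Y_graph L =
     metric ({axis i t |i t. 0 \<le> t \<and> t \<le> L i}, \<lambda>x y. \<Sum>i\<in>UNIV. \<bar>x $ i - y $ i\<bar>)"

lemma Metric_space_Y_graph:
  "Metric_space {axis i t |i t. 0 \<le> t \<and> t \<le> L i} (\<lambda>x y :: real^3. \<Sum>i\<in>UNIV. \<bar>x $ i - y $ i\<bar>)"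
proof
  fix x y z :: "real^3"
  show "0 \<le> (\<Sum>i\<in>UNIV. \<bar>x $ i - y $ i\<bar>)"
    by (simp add: sum_nonneg)
  show "(\<Sum>i\<in>UNIV. \<bar>x $ i - y $ i\<bar>) = (\<Sum>i\<in>UNIV. \<bar>y $ i - x $ i\<bar>)"
    by (simp add: abs_minus_commute)
  show "(\<Sum>i\<in>UNIV. \<bar>x $ i - y $ i\<bar>) = 0 \<longleftrightarrow> x = y"
    by (simp add: sum_nonneg_eq_0_iff vec_eq_iff)
  show "(\<Sum>i\<in>UNIV. \<bar>x $ i - z $ i\<bar>)
          \<le> (\<Sum>i\<in>UNIV. \<bar>x $ i - y $ i\<bar>) + (\<Sum>i\<in>UNIV. \<bar>y $ i - z $ i\<bar>)"
    unfolding sum.distrib[symmetric] by (rule sum_mono) linarith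
qed

lemma mspace_Y_graph: "mspace (Y_graph L) = {axis i t |i t. 0 \<le> t \<and> t \<le> L i}"
  unfolding Y_graph_def by (rule Metric_space.mspace_metric[OF Metric_space_Y_graph])

lemma mdist_Y_graph:
  assumes "0 \<le> s" "0 \<le> t"
  shows "mdist (Y_graph L) (axis i s) (axis j t) = (if i = j then \<bar>s - t\<bar> else s + t)"
proof -
  have "mdist (Y_graph L) (axis i s) (axis j t) = (\<Sum>k\<in>UNIV. \<bar>axis i s $ k - axis j t $ k\<bar>)"
    unfolding Y_graph_def by (simp add: Metric_space.mdist_metric[OF Metric_space_Y_graph])
  also have "\<dots> = (\<Sum>k\<in>UNIV. if i = j then (if k = i then \<bar>s - t\<bar> else 0)
                              else (if k = i then s else 0) + (if k = j then t else 0))"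
    using assms by (intro sum.cong) (auto simp: axis_def)
  also have "\<dots> = (if i = j then \<bar>s - t\<bar> else s + t)"
    by (simp add: sum.distrib)
  finally show ?thesis .
qed

definition config2 :: "'a metric \<Rightarrow> ('a \<times> 'a) metric" where
  "config2 m = submetric (prod_metric m m) {(a, a'). a \<noteq> a'}"

end

theory Submission
  imports Defs
begin

text \<open>
  Where the two points are on different arms, or on the same arm in a given order, the
  configuration space is a flat rectangle or a flat triangle. The six rectangles and the six
  triangles are glued along the six segments on which one of the points sits at the essential
  vertex. All of them would meet in the configuration \<open>(v, v)\<close>, which is missing.
  Around it the rectangles close up to a cycle with total angle \<open>3 * pi\<close>, and a
  triangle with angle \<open>pi / 4\<close> is attached to each of its six segments. With the
  intrinsic metric, the space is therefore part of the Euclidean cone over a metric graph, the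
  link: a circle of length \<open>3 * pi\<close> with a fin of length \<open>pi / 4\<close> at
  six equidistant vertices. Its completion adds the apex of the cone and the outer edges of the
  triangles, that is, one copy of the diagonal for each order of the points.

  In the cone, two points at angle \<open>A\<close> have the distance of the ends of a planar
  sector of angle \<open>min A pi\<close>; the geodesic is the segment in the sector if \<open>A
  < pi\<close> and passes through the apex otherwise. That this is the intrinsic metric
  (\<open>intrinsic_eq\<close>) follows from \<open>star_isometry\<close>: each of six open sets
  that cover the space is isometric to its image in the cone. The completion is the image of a
  compact region of the cone (\<open>mspace_Xc\<close>); it is geodesic because the segments
  stay in this region (\<open>cone_path_in_region\<close>).

  A geodesic that misses the apex is left as it is. One that meets the apex is pushed off it:
  near the apex the path turns along a geodesic of the link between the two directions
  (\<open>cone_path\<close>). So a motion planning rule needs nothing but a continuous choice of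
  geodesics in the link. Such a choice exists for pairs of configurations whose directions, with
  the fins collapsed, are not antipodal on the circle, and also for those where they are
  antipodal, since one may then always turn in the positive sense. Both sets are locally
  compact, and so the geodesic complexity is at most 1 (\<open>GC_le_1\<close>).

  The path at parameter 1 of a near-geodesic lies in the space itself, so the topological
  complexity does not exceed the geodesic complexity (\<open>TC_le_GC\<close>). It is positive
  (\<open>TC_ge_1\<close>), for a continuous choice of paths between all pairs would contract
  the space and hence its retract, the circle of directions.
\<close>

section \<open>The circle of circumference \<open>3 * pi\<close>\<close>

text \<open>The right angles of six rectangles around the missing configuration add up to \<open>3 *
  pi\<close>. The circle of this length is represented by the complex unit circle, on which an
  arc of length \<open>x\<close> subtends the angle \<open>2 / 3 * x\<close>; signed arc length
  can then be read off from \<open>Arg\<close>.\<close>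

definition turn :: "real \<Rightarrow> complex" where
  "turn x = cis (2 / 3 * x)"

text \<open>The displacement between antipodal points is positive because \<open>Arg (- 1) = pi\<close>. The
  motion planning rule for antipodal directions relies on this.\<close>

definition disp :: "complex \<Rightarrow> complex \<Rightarrow> real" where
  "disp w w' = 3 / 2 * Arg (w' / w)"

abbreviation circ_dist :: "complex \<Rightarrow> complex \<Rightarrow> real" where
  "circ_dist w w' \<equiv> \<bar>disp w w'\<bar>"

lemma turn_0 [simp]: "turn 0 = 1"
  by (simp add: turn_def)

lemma norm_turn [simp]: "norm (turn x) = 1"
  by (simp add: turn_def)

lemma turn_nonzero [simp]: "turn x \<noteq> 0"
  by (metis norm_turn norm_zero zero_neq_one)

lemma turn_add: "turn (x + y) = turn x * turn y"
  by (simp add: turn_def cis_mult distrib_left)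

lemma turn_minus: "turn (- x) = inverse (turn x)"
  by (simp add: turn_def cis_inverse)

lemma continuous_turn [continuous_intros]:
  "continuous_on S f \<Longrightarrow> continuous_on S (\<lambda>x. turn (f x))"
  unfolding turn_def by (intro continuous_intros)

lemma tendsto_turn [tendsto_intros]:
  "(f \<longlongrightarrow> a) F \<Longrightarrow> ((\<lambda>x. turn (f x)) \<longlongrightarrow> turn a) F"
  unfolding turn_def by (intro tendsto_intros)

lemma circ_dist_le: "circ_dist w w' \<le> 3 / 2 * pi"
  using Arg_bounded[of "w' / w"] by (auto simp: disp_def)

lemma turn_disp:
  assumes "norm w = 1" "norm w' = 1"
  shows "w * turn (disp w w') = w'"
proof -
  have "norm (w' / w) = 1" "w' / w \<noteq> 0" "w \<noteq> 0"
    using assms by (auto simp: norm_divide)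
  then have "cis (Arg (w' / w)) = w' / w"
    by (simp add: cis_Arg sgn_div_norm)
  then show ?thesis
    using \<open>w \<noteq> 0\<close> by (simp add: turn_def disp_def)
qed

lemma disp_turn:
  assumes "norm w = 1" "- (3 / 2 * pi) < x" "x \<le> 3 / 2 * pi"
  shows "disp w (w * turn x) = x"
proof -
  have "w \<noteq> 0"
    using assms by auto
  then have "w * turn x / w = cis (2 / 3 * x)"
    by (simp add: turn_def)
  moreover have "Arg (cis (2 / 3 * x)) = 2 / 3 * x"
    using assms by (intro Arg_cis) auto
  ultimately show ?thesis
    by (simp add: disp_def)
qed

lemma circ_dist_turn:
  assumes "norm w = 1" "\<bar>x\<bar> \<le> 3 / 2 * pi"
  shows "circ_dist w (w * turn x) = \<bar>x\<bar>"
proof (cases "x = - (3 / 2 * pi)")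
  case True
  have *: "turn (- (3 / 2 * pi)) = turn (3 / 2 * pi)"
    by (simp add: turn_def complex_eq_iff)
  show ?thesis
    unfolding True * using assms disp_turn[of w "3 / 2 * pi"] by simp
next
  case False
  then show ?thesis
    using assms disp_turn[of w x] by (auto simp: abs_le_iff)
qed

lemma circ_dist_turn_le:
  assumes "norm w = 1"
  shows "circ_dist w (w * turn x) \<le> \<bar>x\<bar>"
  using circ_dist_turn[OF assms, of x] circ_dist_le[of w "w * turn x"] by linarith

lemma circ_dist_0_iff:
  assumes "norm w = 1" "norm w' = 1"
  shows "disp w w' = 0 \<longleftrightarrow> w = w'"
proof
  assume "disp w w' = 0"
  then show "w = w'"
    using turn_disp[OF assms] by simp
qed (use assms in \<open>auto simp: disp_def\<close>)

lemma disp_same [simp]: "disp w w = 0"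
  by (cases "w = 0") (auto simp: disp_def Arg_zero)

lemma circ_dist_commute:
  assumes "norm w = 1" "norm w' = 1"
  shows "circ_dist w w' = circ_dist w' w"
proof -
  have *: "circ_dist v u \<le> circ_dist u v" if "norm u = 1" "norm v = 1" for u v
  proof -
    have "u = v * turn (- disp u v)"
      using turn_disp[OF that] by (auto simp: turn_minus field_simps)
    then show ?thesis
      using circ_dist_turn_le[OF that(2), of "- disp u v"] by simp
  qed
  show ?thesis
    using *[OF assms] *[OF assms(2,1)] by simp
qed

lemma circ_dist_triangle:
  assumes "norm u = 1" "norm v = 1" "norm w = 1"
  shows "circ_dist u w \<le> circ_dist u v + circ_dist v w"
proof -
  have "w = u * turn (disp u v + disp v w)"
    using turn_disp[OF assms(1,2)] turn_disp[OF assms(2,3)] by (simp add: turn_add mult.assoc[symmetric])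
  then show ?thesis
    using circ_dist_turn_le[OF assms(1), of "disp u v + disp v w"] by simp
qed

text \<open>The distance is continuous although the displacement is not: \<open>arccos\<close> is continuous
  on \<open>{-1..1}\<close>, whereas \<open>Arg\<close> jumps along the negative axis.\<close>

lemma circ_dist_arccos:
  assumes "norm w = 1" "norm w' = 1"
  shows "circ_dist w w' = 3 / 2 * arccos (Re (w' / w))"
proof -
  have nz: "w' / w \<noteq> 0" and n1: "norm (w' / w) = 1"
    using assms by (auto simp: norm_divide)
  have "Re (w' / w) = cos \<bar>Arg (w' / w)\<bar>"
    using cos_Arg[OF nz] n1 by simp
  moreover have "arccos (cos \<bar>Arg (w' / w)\<bar>) = \<bar>Arg (w' / w)\<bar>"
    using Arg_bounded[of "w' / w"] by (intro arccos_cos) auto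
  ultimately show ?thesis
    by (simp add: disp_def abs_mult)
qed

lemma tendsto_circ_dist:
  assumes "(f \<longlongrightarrow> a) F" "(g \<longlongrightarrow> b) F" "norm a = 1" "norm b = 1"
    and "\<forall>\<^sub>F x in F. norm (f x) = 1 \<and> norm (g x) = 1"
  shows "((\<lambda>x. circ_dist (f x) (g x)) \<longlongrightarrow> circ_dist a b) F"
proof -
  have "a \<noteq> 0" using assms(3) by auto
  have "\<forall>\<^sub>F x in F. 3 / 2 * arccos (Re (g x / f x)) = circ_dist (f x) (g x)"
    using assms(5) by eventually_elim (simp add: circ_dist_arccos)
  moreover have "((\<lambda>x. 3 / 2 * arccos (Re (g x / f x))) \<longlongrightarrow> 3 / 2 * arccos (Re (b / a))) F"
  proof (intro tendsto_intros)
    have lim: "((\<lambda>x. Re (g x / f x)) \<longlongrightarrow> Re (b / a)) F"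
      using assms \<open>a \<noteq> 0\<close> by (intro tendsto_intros)
    have *: "Re (u / v) \<in> {-1..1}" if "norm v = 1" "norm u = 1" for u v :: complex
      using that abs_Re_le_cmod[of "u / v"] by (simp add: norm_divide abs_le_iff)
    show "((\<lambda>x. arccos (Re (g x / f x))) \<longlongrightarrow> arccos (Re (b / a))) F"
      by (rule continuous_on_tendsto_compose[OF continuous_on_arccos' lim])
        (use * assms in \<open>auto elim!: eventually_mono\<close>)
  qed
  ultimately show ?thesis
    unfolding circ_dist_arccos[OF assms(3,4)] by (rule Lim_transform_eventually[rotated])
qed

text \<open>The six directions in which one of the two points sits at the essential vertex. Consecutive ones
  bound a rectangle and are a right angle apart.\<close>

definition vertex :: "nat \<Rightarrow> complex" where
  "vertex k = turn (real k * pi / 2)"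

lemma norm_vertex [simp]: "norm (vertex k) = 1"
  by (simp add: vertex_def)

lemma vertex_power [simp]: "vertex k ^ 6 = 1"
proof -
  have "vertex k ^ 6 = cis (6 * (2 / 3 * (real k * pi / 2)))"
    unfolding vertex_def turn_def by (subst Complex.DeMoivre) simp
  also have "6 * (2 / 3 * (real k * pi / 2)) = 2 * pi * real k"
    by simp
  also have "cis \<dots> = 1"
    by (metis cis_multiple_2pi Ints_of_nat)
  finally show ?thesis .
qed

lemma vertex_add: "vertex (k + j) = vertex k * turn (real j * pi / 2)"
  by (simp add: vertex_def turn_add[symmetric] add_divide_distrib distrib_right)

lemma vertex_6: "vertex (k + 6) = vertex k"
proof -
  have "turn (real 6 * pi / 2) = 1"
    by (simp add: turn_def complex_eq_iff)
  then show ?thesis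
    by (simp only: vertex_add) simp
qed

lemma vertex_add_multiple: "vertex (k + 6 * n) = vertex k"
proof (induction n)
  case (Suc n)
  have "k + 6 * Suc n = (k + 6 * n) + 6" by simp
  then show ?case using Suc vertex_6[of "k + 6 * n"] by metis
qed simp

lemma vertex_mod: "vertex (k mod 6) = vertex k"
  using vertex_add_multiple[of "k mod 6" "k div 6"] by simp

lemma sixth_root_turn:
  assumes "turn x ^ 6 = 1"
  obtains n :: int where "x = of_int n * pi / 2"
proof -
  have "cis (4 * x) = 1"
    using assms unfolding turn_def by (subst (asm) Complex.DeMoivre) (simp add: algebra_simps)
  then have "cos (4 * x) = 1"
    by (metis cis.sel(1) one_complex.sel(1))
  then obtain n :: int where "4 * x = of_int n * 2 * pi"
    by (auto simp: cos_one_2pi_int)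
  then have "x = of_int n * pi / 2" by linarith
  then show ?thesis by (rule that)
qed

lemma sixth_root_vertex:
  assumes "norm w = 1" "w ^ 6 = 1"
  obtains k where "k < 6" "w = vertex k"
proof -
  have "w \<in> {z. z ^ 6 = 1}" using assms by simp
  moreover have "(\<lambda>k. cis (2 * pi * real k / real 6)) ` {..<6} = {z. z ^ 6 = 1}"
    using Complex.bij_betw_roots_unity[of 6] by (simp add: bij_betw_def)
  ultimately obtain k where "k < 6" "w = cis (2 * pi * real k / real 6)"
    by (metis (no_types, lifting) imageE lessThan_iff)
  then have "w = vertex k"
    by (simp add: vertex_def turn_def field_simps)
  then show ?thesis using \<open>k < 6\<close> that by blast
qed

text \<open>Fins are attached over sixth roots of unity only. Hence within a right angle of the foot of a
  fin there is no other fin.\<close>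

lemma circ_dist_sixth_roots:
  assumes "norm w = 1" "norm w' = 1" "w ^ 6 = 1" "w' ^ 6 = 1" "w \<noteq> w'"
  shows "circ_dist w w' \<ge> pi / 2"
proof -
  have "w \<noteq> 0" using assms by auto
  have "turn (disp w w') = w' / w"
    using turn_disp[OF assms(1,2)] \<open>w \<noteq> 0\<close> by (simp add: field_simps)
  then have "turn (disp w w') ^ 6 = 1"
    using assms by (simp add: power_divide)
  then obtain n :: int where n: "disp w w' = of_int n * pi / 2"
    by (rule sixth_root_turn)
  have "n \<noteq> 0"
    using n circ_dist_0_iff[OF assms(1,2)] assms(5) by auto
  then have "\<bar>of_int n :: real\<bar> \<ge> 1"
    by linarith
  then show ?thesis
    using mult_right_mono[of 1 "\<bar>of_int n :: real\<bar>" "pi / 2"] by (simp add: n abs_mult)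
qed

section \<open>The link of the missing point\<close>

type_synonym link_point = "complex \<times> real"

text \<open>A direction consists of its position \<open>w\<close> on the circle and its height
  \<open>b\<close> in the fin over \<open>w\<close>. The height \<open>pi / 4\<close> is that of
  the diagonal, which belongs to the completion only.\<close>

definition link :: "link_point set" where
  "link = {(w, b). norm w = 1 \<and> 0 \<le> b \<and> b \<le> pi / 4 \<and> (b = 0 \<or> w ^ 6 = 1)}"

definition link_dist :: "link_point \<Rightarrow> link_point \<Rightarrow> real" where
  "link_dist p q = (if fst p = fst q then \<bar>snd p - snd q\<bar>
     else circ_dist (fst p) (fst q) + snd p + snd q)"

abbreviation vertex_dist :: "link_point \<Rightarrow> nat \<Rightarrow> real" where
  "vertex_dist q k \<equiv> link_dist q (vertex k, 0)"

lemma link_D: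
  assumes "p \<in> link"
  shows "norm (fst p) = 1" "0 \<le> snd p" "snd p \<le> pi / 4" "snd p = 0 \<or> fst p ^ 6 = 1"
  using assms by (auto simp: link_def)

lemma link_I:
  assumes "norm w = 1" "0 \<le> b" "b \<le> pi / 4" "b = 0 \<or> w ^ 6 = 1"
  shows "(w, b) \<in> link"
  using assms by (auto simp: link_def)

lemma link_vertex [simp]: "(vertex k, 0) \<in> link"
  by (simp add: link_def)

lemma link_dist_nonneg:
  assumes "p \<in> link" "q \<in> link"
  shows "0 \<le> link_dist p q"
  using link_D[OF assms(1)] link_D[OF assms(2)] by (auto simp: link_dist_def)

lemma link_dist_same [simp]: "link_dist p p = 0"
  by (simp add: link_dist_def)

lemma link_dist_commute:
  assumes "p \<in> link" "q \<in> link"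
  shows "link_dist p q = link_dist q p"
  using link_D[OF assms(1)] link_D[OF assms(2)] circ_dist_commute[of "fst p" "fst q"]
  by (auto simp: link_dist_def)

text \<open>Every path between different fins passes through both of their feet, which reduces the
  inequality to the one on the circle.\<close>

lemma link_dist_triangle:
  assumes "p \<in> link" "q \<in> link" "r \<in> link"
  shows "link_dist p r \<le> link_dist p q + link_dist q r"
proof -
  note D = link_D[OF assms(1)] link_D[OF assms(2)] link_D[OF assms(3)]
  note T = circ_dist_triangle[OF D(1) D(5) D(9)] circ_dist_commute[OF D(1) D(5)]
  show ?thesis
    using D(2,6,10) T
    unfolding link_dist_def by (smt (verit, best) disp_same)
qed

lemma link_dist_vertex:
  assumes "p \<in> link"
  shows "vertex_dist p k = circ_dist (fst p) (vertex k) + snd p"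
  using link_D[OF assms] by (auto simp: link_dist_def)

lemma link_fst_eqI:
  assumes "p \<in> link" "q \<in> link" "snd p > 0" "snd q > 0" "circ_dist (fst p) (fst q) < pi / 2"
  shows "fst p = fst q"
  using link_D[OF assms(1)] link_D[OF assms(2)] assms(3,4,5) circ_dist_sixth_roots[of "fst p" "fst q"]
  by fastforce

lemma abs_snd_le_link_dist:
  assumes "p \<in> link" "q \<in> link"
  shows "\<bar>snd p - snd q\<bar> \<le> link_dist p q"
  using link_D(2)[OF assms(1)] link_D(2)[OF assms(2)] unfolding link_dist_def by auto

text \<open>The hypothesis is convergence in the product topology. It controls the distance because fins are
  isolated: close to a point of positive height, all points of positive height have the same
  foot.\<close>

lemma tendsto_link_dist:
  assumes f: "(f \<longlongrightarrow> p) F" and p: "p \<in> link" and ev: "\<forall>\<^sub>F x in F. f x \<in> link"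
  shows "((\<lambda>x. link_dist (f x) p) \<longlongrightarrow> 0) F"
proof -
  note P = link_D[OF p]
  have f1: "((\<lambda>x. fst (f x)) \<longlongrightarrow> fst p) F" and f2: "((\<lambda>x. snd (f x)) \<longlongrightarrow> snd p) F"
    using f by (auto intro: tendsto_intros)
  have c: "((\<lambda>x. circ_dist (fst (f x)) (fst p)) \<longlongrightarrow> circ_dist (fst p) (fst p)) F"
    using ev P by (intro tendsto_circ_dist f1 tendsto_const) (auto elim!: eventually_mono dest: link_D)
  have s: "((\<lambda>x. \<bar>snd (f x) - snd p\<bar>) \<longlongrightarrow> \<bar>snd p - snd p\<bar>) F"
    by (intro tendsto_intros f2)
  show ?thesis
  proof (cases "snd p > 0")
    case True
    have e1: "\<forall>\<^sub>F x in F. snd (f x) > 0"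
      using order_tendstoD(1)[OF f2 True] .
    have e2: "\<forall>\<^sub>F x in F. circ_dist (fst (f x)) (fst p) < pi / 2"
      using order_tendstoD(2)[OF c, of "pi / 2"] by simp
    have "\<forall>\<^sub>F x in F. \<bar>snd (f x) - snd p\<bar> = link_dist (f x) p"
      using ev e1 e2
    proof eventually_elim
      case (elim x)
      then have "fst (f x) = fst p"
        using link_fst_eqI[of "f x" p] p True by auto
      then show ?case by (simp add: link_dist_def)
    qed
    then show ?thesis
      using s by (simp add: tendsto_cong)
  next
    case False
    then have "snd p = 0" using P by auto
    then have "\<forall>\<^sub>F x in F. circ_dist (fst (f x)) (fst p) + \<bar>snd (f x) - snd p\<bar> = link_dist (f x) p"
      using ev by (auto elim!: eventually_mono simp: link_dist_def dest: link_D)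
    moreover have "((\<lambda>x. circ_dist (fst (f x)) (fst p) + \<bar>snd (f x) - snd p\<bar>) \<longlongrightarrow> 0 + 0) F"
      using c s by (intro tendsto_add) auto
    ultimately show ?thesis
      by (simp add: tendsto_cong)
  qed
qed

lemma tendsto_link_dist_both:
  assumes f: "(f \<longlongrightarrow> p) F" and p: "p \<in> link" and ev: "\<forall>\<^sub>F x in F. f x \<in> link"
    and g: "(g \<longlongrightarrow> q) F" and q: "q \<in> link" and ev': "\<forall>\<^sub>F x in F. g x \<in> link"
  shows "((\<lambda>x. link_dist (f x) (g x)) \<longlongrightarrow> link_dist p q) F"
proof -
  have lim: "((\<lambda>x. link_dist (f x) p + link_dist (g x) q) \<longlongrightarrow> 0 + 0) F"
    by (intro tendsto_add tendsto_link_dist assms)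
  have le: "\<forall>\<^sub>F x in F. norm (link_dist (f x) (g x) - link_dist p q) \<le> link_dist (f x) p + link_dist (g x) q"
    using ev ev'
  proof eventually_elim
    case (elim x)
    note T = link_dist_triangle[OF elim(1) p elim(2)] link_dist_triangle[OF p q elim(2)]
      link_dist_triangle[OF p elim(1) q] link_dist_triangle[OF elim(1) elim(2) q]
      link_dist_commute[OF p elim(1)] link_dist_commute[OF q elim(2)]
    show ?case unfolding real_norm_def using T by linarith
  qed
  have "((\<lambda>x. link_dist (f x) (g x) - link_dist p q) \<longlongrightarrow> 0) F"
    using Lim_null_comparison[OF le] lim by simp
  then show ?thesis
    by (rule LIM_zero_cancel)
qed

section \<open>The Euclidean cone over the link\<close>

lemma cmod_diff_cis:
  "(cmod (complex_of_real r - complex_of_real r' * cis u))\<^sup>2 = r\<^sup>2 + r'\<^sup>2 - 2 * r * r' * cos u"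
proof -
  have "(cmod (complex_of_real r - complex_of_real r' * cis u))\<^sup>2 = (r - r' * cos u)\<^sup>2 + (r' * sin u)\<^sup>2"
    by (simp add: cmod_power2)
  also have "\<dots> = r\<^sup>2 + r'\<^sup>2 * ((sin u)\<^sup>2 + (cos u)\<^sup>2) - 2 * r * r' * cos u"
    unfolding power2_eq_square by (simp only: algebra_simps)
  finally show ?thesis by simp
qed

text \<open>Opening a planar angle lengthens the opposite side.\<close>

lemma cmod_diff_cis_mono:
  assumes "0 \<le> r" "0 \<le> r'" "\<bar>u\<bar> \<le> v" "v \<le> pi"
  shows "cmod (complex_of_real r - complex_of_real r' * cis u) \<le> cmod (complex_of_real r - complex_of_real r' * cis v)"
proof (rule power2_le_imp_le)
  have "cos v \<le> cos \<bar>u\<bar>"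
    using assms by (subst cos_mono_le_eq) auto
  then have "r * r' * cos v \<le> r * r' * cos u"
    using assms by (intro mult_left_mono) auto
  then show "(cmod (complex_of_real r - complex_of_real r' * cis u))\<^sup>2
     \<le> (cmod (complex_of_real r - complex_of_real r' * cis v))\<^sup>2"
    unfolding cmod_diff_cis by simp
qed simp

type_synonym cone_point = "real \<times> complex \<times> real"

abbreviation angle :: "cone_point \<Rightarrow> cone_point \<Rightarrow> real" where
  "angle p q \<equiv> link_dist (snd p) (snd q)"

text \<open>The law of cosines, with the angle cut off at \<open>pi\<close>: beyond that the shortest
  connection runs through the apex. Since all triples with radius 0 stand for the apex, this is
  a pseudometric.\<close>

definition cone_dist :: "cone_point \<Rightarrow> cone_point \<Rightarrow> real" where
  "cone_dist p q = cmod (complex_of_real (fst p) - complex_of_real (fst q) * cis (min pi (angle p q)))"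

definition link_cone :: "cone_point set" where
  "link_cone = {(r, l). 0 \<le> r \<and> l \<in> link}"

lemma link_cone_D:
  assumes "p \<in> link_cone" shows "0 \<le> fst p" "snd p \<in> link"
  using assms by (auto simp: link_cone_def)

lemma cone_dist_nonneg [simp]: "0 \<le> cone_dist p q"
  by (simp add: cone_dist_def)

lemma cone_dist_same [simp]: "cone_dist p p = 0"
  by (simp add: cone_dist_def)

lemma cone_dist_squared:
  "(cone_dist p q)\<^sup>2 = (fst p)\<^sup>2 + (fst q)\<^sup>2 - 2 * fst p * fst q * cos (min pi (angle p q))"
  by (simp add: cone_dist_def cmod_diff_cis)

lemma cone_dist_commute:
  assumes "p \<in> link_cone" "q \<in> link_cone"
  shows "cone_dist p q = cone_dist q p"
proof -
  have "(cone_dist p q)\<^sup>2 = (cone_dist q p)\<^sup>2"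
    using link_dist_commute[of "snd p" "snd q"] link_cone_D[OF assms(1)] link_cone_D[OF assms(2)]
    by (simp add: cone_dist_squared)
  then show ?thesis by (simp add: power2_eq_iff_nonneg)
qed

lemma cone_dist_le_develop:
  assumes "p \<in> link_cone" "q \<in> link_cone" "angle p q \<le> \<bar>u\<bar>" "\<bar>u\<bar> \<le> pi"
  shows "cone_dist p q \<le> cmod (complex_of_real (fst p) - complex_of_real (fst q) * cis u)"
proof -
  note P = link_cone_D[OF assms(1)] and Q = link_cone_D[OF assms(2)]
  have "cone_dist p q \<le> cmod (complex_of_real (fst p) - complex_of_real (fst q) * cis \<bar>u\<bar>)"
    unfolding cone_dist_def
    using P Q assms link_dist_nonneg[of "snd p" "snd q"] by (intro cmod_diff_cis_mono) auto
  also have "\<dots> = cmod (complex_of_real (fst p) - complex_of_real (fst q) * cis u)"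
    using cmod_diff_cis[of "fst p" "fst q" u] cmod_diff_cis[of "fst p" "fst q" "\<bar>u\<bar>"]
    by (intro power2_eq_imp_eq[OF _ norm_ge_zero norm_ge_zero]) simp
  finally show ?thesis .
qed

text \<open>Unroll the cone around \<open>p\<close>, placing every point in the plane at its own radius and
  at its truncated angle from \<open>p\<close>. This preserves the distances from
  \<open>p\<close> and increases no other distance, so the inequality is inherited from the
  plane.\<close>

lemma cone_dist_triangle:
  assumes "p \<in> link_cone" "q \<in> link_cone" "r \<in> link_cone"
  shows "cone_dist p r \<le> cone_dist p q + cone_dist q r"
proof -
  note P = link_cone_D[OF assms(1)] and Q = link_cone_D[OF assms(2)] and R = link_cone_D[OF assms(3)]
  define h where "h x = min pi (angle p x)" for x :: "cone_point"
  have "cone_dist p r \<le> cone_dist p q + cmod (fst q * cis (h q) - fst r * cis (h r))"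
    unfolding cone_dist_def h_def[symmetric]
    by (metis (no_types, opaque_lifting) diff_add_cancel add_diff_eq norm_triangle_ineq)
  also have "fst q * cis (h q) - fst r * cis (h r) = cis (h q) * (fst q - fst r * cis (h r - h q))"
    by (simp add: algebra_simps cis_mult)
  also have "cmod \<dots> = cmod (fst q - fst r * cis (h r - h q))"
    by (simp add: norm_mult)
  also have "\<dots> \<le> cone_dist q r"
    unfolding cone_dist_def
  proof (rule cmod_diff_cis_mono)
    have "angle p r \<le> angle p q + angle q r"
      "angle p q \<le> angle p r + angle q r"
      using link_dist_triangle[of "snd p" "snd q" "snd r"] link_dist_triangle[of "snd p" "snd r" "snd q"]
        link_dist_commute[of "snd q" "snd r"] P Q R by auto
    moreover have "0 \<le> angle p r" "0 \<le> angle p q" "0 \<le> angle q r"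
      using P Q R by (auto intro: link_dist_nonneg)
    ultimately show "\<bar>h r - h q\<bar> \<le> min pi (angle q r)"
      unfolding h_def using pi_gt_zero by linarith
  qed (use Q R in auto)
  finally show ?thesis by simp
qed

lemma cone_dist_apex:
  assumes "fst p = 0 \<or> fst q = 0" "0 \<le> fst p" "0 \<le> fst q"
  shows "cone_dist p q = fst p + fst q"
  using assms by (auto simp: cone_dist_def norm_mult)

lemma cone_dist_ge_radius:
  assumes "p \<in> link_cone" "q \<in> link_cone"
  shows "\<bar>fst p - fst q\<bar> \<le> cone_dist p q"
proof -
  have "cmod (fst p - fst q * cis 0) \<le> cone_dist p q"
    unfolding cone_dist_def using link_cone_D[OF assms(1)] link_cone_D[OF assms(2)] link_dist_nonneg
    by (intro cmod_diff_cis_mono) auto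
  then show ?thesis
    by (simp add: of_real_diff[symmetric] del: of_real_diff)
qed

lemma cone_dist_le_sum:
  assumes "p \<in> link_cone" "q \<in> link_cone"
  shows "cone_dist p q \<le> fst p + fst q"
  unfolding cone_dist_def
  using norm_triangle_ineq4[of "complex_of_real (fst p)" "complex_of_real (fst q) * cis (min pi (angle p q))"]
    link_cone_D[OF assms(1)] link_cone_D[OF assms(2)] by (simp add: norm_mult)

lemma norm_cis_minus_1_le: "cmod (1 - cis u) \<le> \<bar>u\<bar>"
proof -
  have "cmod (1 - cis u) = 2 * \<bar>sin (u / 2)\<bar>"
  proof -
    have "(cmod (1 - cis u))\<^sup>2 = 2 - 2 * cos u"
      using cmod_diff_cis[of 1 1 u] by simp
    also have "\<dots> = (2 * \<bar>sin (u / 2)\<bar>)\<^sup>2"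
      using cos_double_sin[of "u / 2"] by (simp add: power_mult_distrib)
    finally show ?thesis by (rule power2_eq_imp_eq) auto
  qed
  also have "\<dots> \<le> \<bar>u\<bar>"
    using abs_sin_x_le_abs_x[of "u / 2"] by simp
  finally show ?thesis .
qed

lemma cone_dist_le_polar_right:
  assumes "p \<in> link_cone" "q \<in> link_cone"
  shows "cone_dist p q \<le> \<bar>fst p - fst q\<bar> + fst q * angle p q"
proof -
  note P = link_cone_D[OF assms(1)] and Q = link_cone_D[OF assms(2)]
  have L: "0 \<le> angle p q" using P Q link_dist_nonneg by auto
  define u where "u = min pi (angle p q)"
  have u: "0 \<le> u" "u \<le> angle p q" using L by (auto simp: u_def)
  have "complex_of_real (fst p) - fst q * cis u = of_real (fst p - fst q) + of_real (fst q) * (1 - cis u)"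
    by (simp add: algebra_simps)
  then have "cone_dist p q \<le> cmod (of_real (fst p - fst q)) + cmod (of_real (fst q) * (1 - cis u))"
    unfolding cone_dist_def u_def[symmetric] by (simp only: norm_triangle_ineq)
  also have "cmod (of_real (fst q) * (1 - cis u)) \<le> fst q * u"
    using norm_cis_minus_1_le[of u] u Q by (simp add: norm_mult mult_left_mono)
  also have "fst q * u \<le> fst q * angle p q"
    using Q u by (intro mult_left_mono) auto
  finally show ?thesis by (simp add: of_real_diff[symmetric] del: of_real_diff)
qed

text \<open>Move radially, and turn at the smaller of the two radii.\<close>

lemma cone_dist_le_polar:
  assumes "p \<in> link_cone" "q \<in> link_cone"
  shows "cone_dist p q \<le> \<bar>fst p - fst q\<bar> + min (fst p) (fst q) * angle p q"
proof (cases "fst q \<le> fst p")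
  case True
  then show ?thesis using cone_dist_le_polar_right[OF assms] by (simp add: min_def)
next
  case False
  then show ?thesis
    using cone_dist_le_polar_right[OF assms(2,1)] cone_dist_commute[OF assms]
      link_dist_commute[of "snd p" "snd q"] link_cone_D[OF assms(1)] link_cone_D[OF assms(2)]
    by (simp add: min_def abs_minus_commute)
qed

lemma tendsto_cone_dist_apex:
  assumes "((\<lambda>x. fst (f x)) \<longlongrightarrow> 0) F" "fst p = 0" "\<forall>\<^sub>F x in F. f x \<in> link_cone"
  shows "((\<lambda>x. cone_dist (f x) p) \<longlongrightarrow> 0) F"
proof -
  have "\<forall>\<^sub>F x in F. fst (f x) = cone_dist (f x) p"
    using assms(3) by eventually_elim (use assms(2) in \<open>auto simp: cone_dist_apex dest: link_cone_D\<close>)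
  then show ?thesis
    using assms(1) by (simp add: tendsto_cong)
qed

lemma tendsto_cone_dist:
  assumes f: "(f \<longlongrightarrow> p) F" and p: "p \<in> link_cone" and ev: "\<forall>\<^sub>F x in F. f x \<in> link_cone"
  shows "((\<lambda>x. cone_dist (f x) p) \<longlongrightarrow> 0) F"
proof -
  have 1: "((\<lambda>x. fst (f x)) \<longlongrightarrow> fst p) F" and 2: "((\<lambda>x. snd (f x)) \<longlongrightarrow> snd p) F"
    using f by (auto intro: tendsto_intros)
  have l: "((\<lambda>x. angle (f x) p) \<longlongrightarrow> 0) F"
    by (rule tendsto_link_dist[OF 2]) (use ev p in \<open>auto elim!: eventually_mono dest: link_cone_D\<close>)
  have le: "\<forall>\<^sub>F x in F. norm (cone_dist (f x) p) \<le> \<bar>fst (f x) - fst p\<bar> + fst p * angle (f x) p"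
    using ev by eventually_elim (use cone_dist_le_polar_right[OF _ p] in auto)
  have "((\<lambda>x. \<bar>fst (f x) - fst p\<bar> + fst p * angle (f x) p) \<longlongrightarrow> \<bar>fst p - fst p\<bar> + fst p * 0) F"
    by (intro tendsto_intros 1 l)
  then show ?thesis
    using Lim_null_comparison[OF le] by simp
qed

text \<open>Away from the apex the law of cosines can be solved for the angle, so that convergence in the
  cone implies convergence of the polar coordinates.\<close>

lemma cone_dist_0_imp_tendsto:
  assumes f: "((\<lambda>x. cone_dist (f x) p) \<longlongrightarrow> 0) F" and p: "p \<in> link_cone" "fst p > 0"
    and ev: "\<forall>\<^sub>F x in F. f x \<in> link_cone"
  shows "(f \<longlongrightarrow> p) F"
proof -
  have le: "\<forall>\<^sub>F x in F. norm (fst (f x) - fst p) \<le> cone_dist (f x) p"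
    using ev by eventually_elim (use cone_dist_ge_radius p in auto)
  have 1: "((\<lambda>x. fst (f x)) \<longlongrightarrow> fst p) F"
    using Lim_null_comparison[OF le f] by (rule LIM_zero_cancel)
  have pos: "\<forall>\<^sub>F x in F. fst (f x) > 0"
    using order_tendstoD(1)[OF 1 p(2)] .
  define q where "q x = ((fst (f x))\<^sup>2 + (fst p)\<^sup>2 - (cone_dist (f x) p)\<^sup>2) / (2 * fst (f x) * fst p)" for x
  have "(q \<longlongrightarrow> ((fst p)\<^sup>2 + (fst p)\<^sup>2 - 0\<^sup>2) / (2 * fst p * fst p)) F"
    unfolding q_def using p by (intro tendsto_intros 1 f) auto
  also have "((fst p)\<^sup>2 + (fst p)\<^sup>2 - 0\<^sup>2) / (2 * fst p * fst p) = 1"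
    using p by (simp add: power2_eq_square)
  finally have q: "(q \<longlongrightarrow> 1) F" .
  have qe: "\<forall>\<^sub>F x in F. q x = cos (min pi (angle (f x) p))"
    using ev pos
  proof eventually_elim
    case (elim x)
    then show ?case
      unfolding q_def cone_dist_squared using p by (simp add: field_simps)
  qed
  have "((\<lambda>x. arccos (q x)) \<longlongrightarrow> arccos 1) F"
    by (rule continuous_on_tendsto_compose[OF continuous_on_arccos' q])
      (use qe in \<open>auto elim!: eventually_mono\<close>)
  then have "((\<lambda>x. arccos (q x)) \<longlongrightarrow> 0) F" by simp
  moreover have "\<forall>\<^sub>F x in F. arccos (q x) = min pi (angle (f x) p)"
    using qe ev by eventually_elim (use p in \<open>auto intro!: arccos_cos link_dist_nonneg dest: link_cone_D simp: min_def\<close>)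
  ultimately have m: "((\<lambda>x. min pi (angle (f x) p)) \<longlongrightarrow> 0) F"
    by (simp add: tendsto_cong)
  have small: "\<forall>\<^sub>F x in F. angle (f x) p < pi"
    using order_tendstoD(2)[OF m pi_gt_zero] by eventually_elim auto
  have l: "((\<lambda>x. angle (f x) p) \<longlongrightarrow> 0) F"
    by (rule Lim_transform_eventually[OF m]) (use small in \<open>auto elim!: eventually_mono\<close>)
  have "\<forall>\<^sub>F x in F. norm (snd (snd (f x)) - snd (snd p)) \<le> angle (f x) p"
    using ev by eventually_elim (use p in \<open>auto intro!: abs_snd_le_link_dist dest: link_cone_D\<close>)
  from Lim_null_comparison[OF this l] have 3: "((\<lambda>x. snd (snd (f x))) \<longlongrightarrow> snd (snd p)) F"
    by (rule LIM_zero_cancel)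
  have "\<forall>\<^sub>F x in F. norm (fst (snd (f x)) - fst (snd p)) \<le> angle (f x) p"
    using ev
  proof eventually_elim
    case (elim x)
    define w w' where "w = fst (snd (f x))" and "w' = fst (snd p)"
    have n: "norm w = 1" "norm w' = 1" and b: "0 \<le> snd (snd (f x))" "0 \<le> snd (snd p)"
      using link_D[OF link_cone_D(2)[OF elim]] link_D[OF link_cone_D(2)[OF p(1)]] by (auto simp: w_def w'_def)
    have "norm (w - w') = norm (w * (1 - turn (disp w w')))"
      using turn_disp[OF n] by (simp add: algebra_simps)
    also have "\<dots> \<le> 2 / 3 * circ_dist w w'"
      using n norm_cis_minus_1_le[of "2 / 3 * disp w w'"] by (simp add: norm_mult turn_def abs_mult)
    also have "\<dots> \<le> circ_dist w w'" by simp
    also have "\<dots> \<le> angle (f x) p"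
      using b by (auto simp: link_dist_def w_def w'_def)
    finally show ?case by (simp add: w_def w'_def)
  qed
  from Lim_null_comparison[OF this l] have 2: "((\<lambda>x. fst (snd (f x))) \<longlongrightarrow> fst (snd p)) F"
    by (rule LIM_zero_cancel)
  have "((\<lambda>x. (fst (f x), fst (snd (f x)), snd (snd (f x)))) \<longlongrightarrow> (fst p, fst (snd p), snd (snd p))) F"
    by (intro tendsto_Pair 1 2 3)
  then show ?thesis by simp
qed

lemma cone_dist_0_imp_eq:
  assumes "cone_dist p q = 0" "p \<in> link_cone" "q \<in> link_cone" "fst q > 0"
  shows "p = q"
proof -
  have "((\<lambda>n::nat. p) \<longlongrightarrow> q) sequentially"
    by (rule cone_dist_0_imp_tendsto) (use assms in auto)
  then show ?thesis
    by (simp add: LIMSEQ_const_iff)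
qed

section \<open>Geodesics in the link\<close>

text \<open>The height up to which the fins of \<open>p\<close> and \<open>q\<close> are shared: the smaller
  height if both are in the same fin, and 0 otherwise. Expressed by distances, as a Gromov
  product, it is visibly continuous.\<close>

definition overlap :: "link_point \<Rightarrow> link_point \<Rightarrow> real" where
  "overlap p q = (circ_dist (fst p) (fst q) + snd p + snd q - link_dist p q) / 2"

definition clamp :: "real \<Rightarrow> real \<Rightarrow> real" where
  "clamp K x = max (- K) (min K x)"

text \<open>The geodesic of the link with unit speed: down the fin of \<open>p\<close> to the shared height,
  along the circle, and up the fin of \<open>q\<close>. A single formula for the three phases,
  and for both senses of rotation, makes the arc continuous in its end points wherever the
  displacement is.\<close>

definition link_arc :: "link_point \<Rightarrow> link_point \<Rightarrow> real \<Rightarrow> link_point" where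
  "link_arc p q \<tau> =
    (fst p * turn (clamp (max 0 (\<tau> - (snd p - overlap p q))) (disp (fst p) (fst q))),
     max (overlap p q) (max (snd p - \<tau>) (snd q - (link_dist p q - \<tau>))))"

lemma overlap_same: "fst p = fst q \<Longrightarrow> overlap p q = min (snd p) (snd q)"
  by (auto simp: overlap_def link_dist_def)

lemma overlap_diff: "fst p \<noteq> fst q \<Longrightarrow> overlap p q = 0"
  by (auto simp: overlap_def link_dist_def)

lemma link_arc_same:
  assumes "fst p = fst q"
  shows "link_arc p q \<tau> = (fst p, max (min (snd p) (snd q)) (max (snd p - \<tau>) (snd q - (\<bar>snd p - snd q\<bar> - \<tau>))))"
  using assms by (auto simp: link_arc_def overlap_same link_dist_def clamp_def)

lemma link_arc_diff:
  assumes "fst p \<noteq> fst q"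
  shows "link_arc p q \<tau> = (fst p * turn (clamp (max 0 (\<tau> - snd p)) (disp (fst p) (fst q))),
    max 0 (max (snd p - \<tau>) (\<tau> - (circ_dist (fst p) (fst q) + snd p))))"
  using assms by (auto simp: link_arc_def overlap_diff link_dist_def)

lemma clamp_big: "\<bar>x\<bar> \<le> K \<Longrightarrow> clamp K x = x"
  by (auto simp: clamp_def)

lemma clamp_0 [simp]: "clamp 0 x = 0"
  by (auto simp: clamp_def)

lemma link_arc_0:
  assumes "p \<in> link" "q \<in> link"
  shows "link_arc p q 0 = p"
proof (cases "fst p = fst q")
  case True
  show ?thesis unfolding link_arc_same[OF True] by (auto simp: prod_eq_iff)
next
  case False
  show ?thesis unfolding link_arc_diff[OF False] using link_D[OF assms(1)]
    by (auto simp: prod_eq_iff)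
qed

lemma link_arc_end:
  assumes "p \<in> link" "q \<in> link"
  shows "link_arc p q (link_dist p q) = q"
proof (cases "fst p = fst q")
  case True
  show ?thesis unfolding link_arc_same[OF True] using True by (auto simp: prod_eq_iff link_dist_def)
next
  case False
  have "link_dist p q = circ_dist (fst p) (fst q) + snd p + snd q"
    using False by (simp add: link_dist_def)
  then show ?thesis unfolding link_arc_diff[OF False]
    using link_D[OF assms(1)] link_D[OF assms(2)] turn_disp[of "fst p" "fst q"]
    by (auto simp: prod_eq_iff clamp_big)
qed

lemma link_arc_in_link:
  assumes "p \<in> link" "q \<in> link" "0 \<le> \<tau>" "\<tau> \<le> link_dist p q"
  shows "link_arc p q \<tau> \<in> link" and "snd (link_arc p q \<tau>) \<le> max (snd p) (snd q)"
proof -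
  note P = link_D[OF assms(1)] and Q = link_D[OF assms(2)]
  have "link_arc p q \<tau> \<in> link \<and> snd (link_arc p q \<tau>) \<le> max (snd p) (snd q)"
  proof (cases "fst p = fst q")
    case True
    have "max (min (snd p) (snd q)) (max (snd p - \<tau>) (snd q - (\<bar>snd p - snd q\<bar> - \<tau>))) \<le> max (snd p) (snd q)"
      using assms True by (auto simp: link_dist_def)
    moreover have "0 \<le> max (min (snd p) (snd q)) (max (snd p - \<tau>) (snd q - (\<bar>snd p - snd q\<bar> - \<tau>)))"
      using P Q by auto
    moreover have "max (snd p) (snd q) = 0 \<or> fst p ^ 6 = 1"
      using P Q True by (auto simp: max_def)
    ultimately show ?thesis
      unfolding link_arc_same[OF True] fst_conv snd_conv using P Q
      by (intro conjI link_I) (linarith | auto)+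
  next
    case False
    let ?d = "circ_dist (fst p) (fst q)"
    have A: "\<tau> \<le> ?d + snd p + snd q"
      using assms False by (simp add: link_dist_def)
    have b: "max 0 (max (snd p - \<tau>) (\<tau> - (?d + snd p))) \<le> max (snd p) (snd q)"
      using P Q assms A by auto
    have c: "max 0 (max (snd p - \<tau>) (\<tau> - (?d + snd p))) = 0 \<or>
      (fst p * turn (clamp (max 0 (\<tau> - snd p)) (disp (fst p) (fst q)))) ^ 6 = 1"
    proof (cases "\<tau> \<le> snd p")
      case True
      then show ?thesis using P assms by (auto simp: max_def)
    next
      case False
      then consider "\<tau> \<le> ?d + snd p" | "?d + snd p < \<tau>" by linarith
      then show ?thesis
      proof cases
        case 1
        then show ?thesis using False by (auto simp: max_def)
      next
        case 2
        then have "fst p * turn (clamp (max 0 (\<tau> - snd p)) (disp (fst p) (fst q))) = fst q"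
          using P Q turn_disp[of "fst p" "fst q"] by (subst clamp_big) auto
        moreover have "snd q \<noteq> 0" using 2 A by auto
        ultimately show ?thesis using Q by simp
      qed
    qed
    have d: "0 \<le> max 0 (max (snd p - \<tau>) (\<tau> - (?d + snd p)))" by simp
    have e: "max (snd p) (snd q) \<le> pi / 4" using P Q by auto
    show ?thesis
      unfolding link_arc_diff[OF False]
      unfolding fst_conv snd_conv
    proof (intro conjI link_I)
      show "norm (fst p * turn (clamp (max 0 (\<tau> - snd p)) (disp (fst p) (fst q)))) = 1"
        using P(1) by (simp add: norm_mult)
    qed (use b c d e order_trans[OF b e] in blast)+
  qed
  then show "link_arc p q \<tau> \<in> link" and "snd (link_arc p q \<tau>) \<le> max (snd p) (snd q)" by auto
qed

text \<open>In each of the phases exactly one of position and height changes, and it does so at unit speed.\<close>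

lemma link_arc_Lipschitz_forward:
  assumes "p \<in> link" "q \<in> link" "0 \<le> \<tau>" "\<tau> \<le> \<tau>'" "\<tau>' \<le> link_dist p q"
  shows "link_dist (link_arc p q \<tau>) (link_arc p q \<tau>') \<le> \<tau>' - \<tau>"
proof (cases "fst p = fst q")
  case True
  have "\<bar>max m (max (a - \<tau>) (c - (d - \<tau>))) - max m (max (a - \<tau>') (c - (d - \<tau>')))\<bar> \<le> \<tau>' - \<tau>"
    for m a c d using assms(4) by linarith
  then show ?thesis unfolding link_arc_same[OF True] link_dist_def fst_conv snd_conv if_P[OF refl] by blast
next
  case False
  note P = link_D[OF assms(1)] and Q = link_D[OF assms(2)]
  define \<delta> where "\<delta> = disp (fst p) (fst q)"
  define k where "k t = clamp (max 0 (t - snd p)) \<delta>" for t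
  define b where "b t = max 0 (max (snd p - t) (t - (\<bar>\<delta>\<bar> + snd p)))" for t
  have arc: "link_arc p q t = (fst p * turn (k t), b t)" for t
    unfolding link_arc_diff[OF False] k_def b_def \<delta>_def ..
  have A: "\<tau>' \<le> \<bar>\<delta>\<bar> + snd p + snd q"
    using assms False by (simp add: link_dist_def \<delta>_def)
  show ?thesis
  proof (cases "k \<tau> = k \<tau>'")
    case True
    then show ?thesis
      unfolding arc link_dist_def b_def using assms(4) by (auto simp: max_def)
  next
    case F2: False
    have t1: "snd p < \<tau>'"
      using F2 assms(4) by (rule_tac ccontr) (auto simp: k_def)
    have t2: "\<tau> < \<bar>\<delta>\<bar> + snd p"
      using F2 assms(4) by (rule_tac ccontr) (auto simp: k_def clamp_def)
    have kd: "\<bar>k \<tau>' - k \<tau>\<bar> = min \<bar>\<delta>\<bar> (\<tau>' - snd p) - max 0 (\<tau> - snd p)"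
      using t1 t2 assms(4) unfolding k_def clamp_def by linarith
    have "fst p * turn (k \<tau>') = (fst p * turn (k \<tau>)) * turn (k \<tau>' - k \<tau>)"
      by (simp add: turn_add[symmetric])
    then have "circ_dist (fst p * turn (k \<tau>)) (fst p * turn (k \<tau>')) \<le> \<bar>k \<tau>' - k \<tau>\<bar>"
      using circ_dist_turn_le[of "fst p * turn (k \<tau>)" "k \<tau>' - k \<tau>"] P(1) by (metis norm_mult norm_turn mult_1)
    moreover have "\<bar>k \<tau>' - k \<tau>\<bar> + b \<tau> + b \<tau>' \<le> \<tau>' - \<tau>"
      unfolding kd b_def using t1 t2 assms(4) by (auto simp: max_def min_def)
    moreover have "\<bar>b \<tau> - b \<tau>'\<bar> \<le> \<tau>' - \<tau>"
      unfolding b_def using assms(4) by (auto simp: max_def)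
    ultimately show ?thesis
      unfolding arc link_dist_def by auto
  qed
qed

lemma link_arc_Lipschitz:
  assumes "p \<in> link" "q \<in> link" "0 \<le> \<tau>" "\<tau> \<le> link_dist p q" "0 \<le> \<tau>'" "\<tau>' \<le> link_dist p q"
  shows "link_dist (link_arc p q \<tau>) (link_arc p q \<tau>') \<le> \<bar>\<tau>' - \<tau>\<bar>"
proof (cases "\<tau> \<le> \<tau>'")
  case True
  then show ?thesis using link_arc_Lipschitz_forward[of p q \<tau> \<tau>'] assms by auto
next
  case False
  then show ?thesis
    using link_arc_Lipschitz_forward[of p q \<tau>' \<tau>] assms
      link_dist_commute[OF link_arc_in_link(1)[of p q \<tau>] link_arc_in_link(1)[of p q \<tau>']] by auto
qed

section \<open>Planar sectors\<close>

lemma norm_times_cos_Arg: "cmod z * cos (Arg z) = Re z"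
  by (cases "z = 0") (simp_all add: cos_Arg)

lemma norm_times_sin_Arg: "cmod z * sin (Arg z) = Im z"
  by (cases "z = 0") (simp_all add: sin_Arg)

lemma norm_cis_Arg: "complex_of_real (cmod z) * cis (Arg z) = z"
  by (simp add: complex_eq_iff norm_times_cos_Arg norm_times_sin_Arg)

text \<open>Oblique coordinates along the two sides of a planar sector of angle \<open>B\<close>.\<close>

definition sector :: "real \<Rightarrow> real \<Rightarrow> real \<Rightarrow> complex" where
  "sector B c d = of_real c + of_real d * cis B"

lemma Arg_sector:
  assumes "0 \<le> c" "0 \<le> d" "0 \<le> B" "B \<le> pi"
  shows "0 \<le> Arg (sector B c d)" "Arg (sector B c d) \<le> B"
proof -
  let ?z = "sector B c d"
  have "Im ?z = d * sin B" by (simp add: sector_def)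
  then have "Im ?z \<ge> 0" using assms by (simp add: sin_ge_zero)
  then show 0: "0 \<le> Arg ?z" by (simp add: Arg_less_0)
  show "Arg ?z \<le> B"
  proof (rule ccontr)
    assume "\<not> Arg ?z \<le> B"
    then have gt: "B < Arg ?z" by simp
    then have "?z \<noteq> 0" using assms Arg_zero by auto
    then have pos: "cmod ?z > 0" by simp
    have "cmod ?z * sin (Arg ?z - B) = Im ?z * cos B - Re ?z * sin B"
      using norm_times_cos_Arg[of ?z] norm_times_sin_Arg[of ?z]
      by (simp add: sin_diff algebra_simps)
    also have "\<dots> = - c * sin B"
      by (simp add: sector_def algebra_simps)
    also have "\<dots> \<le> 0" using assms by (simp add: sin_ge_zero)
    finally have "sin (Arg ?z - B) \<le> 0"
      using pos by (simp add: mult_le_0_iff)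
    moreover have "Arg ?z - B > 0" "Arg ?z - B \<le> pi"
      using gt assms Arg_le_pi[of ?z] by auto
    ultimately have "Arg ?z - B = pi"
      using sin_gt_zero[of "Arg ?z - B"] by linarith
    then have "B = 0" "Arg ?z = pi" using Arg_le_pi[of ?z] assms by auto
    moreover have "Arg (sector 0 c d) = 0"
      using assms by (simp add: sector_def of_real_add[symmetric] del: of_real_add)
    ultimately show False by simp
  qed
qed

lemma norm_sector_le: "0 \<le> c \<Longrightarrow> 0 \<le> d \<Longrightarrow> cmod (sector B c d) \<le> c + d"
  unfolding sector_def using norm_triangle_ineq[of "of_real c" "of_real d * cis B"] by (simp add: norm_mult)

lemma sector_diff: "sector B c d - sector B c' d' = sector B (c - c') (d - d')"
  by (simp add: sector_def algebra_simps)

lemma norm_sector_diff_le: "cmod (sector B c d - sector B c' d') \<le> \<bar>c - c'\<bar> + \<bar>d - d'\<bar>"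
  unfolding sector_diff unfolding sector_def
  using norm_triangle_ineq[of "complex_of_real (c - c')" "of_real (d - d') * cis B"]
  by (simp add: norm_mult del: of_real_diff)

lemma sector_nonzero:
  assumes "0 \<le> c" "0 \<le> d" "0 \<le> B" "B < pi" "c + d > 0"
  shows "sector B c d \<noteq> 0"
proof
  assume z: "sector B c d = 0"
  then have "Im (sector B c d) = 0" "Re (sector B c d) = 0" by auto
  then have *: "d * sin B = 0" "c + d * cos B = 0" by (auto simp: sector_def)
  show False
  proof (cases "B = 0")
    case False
    then have "sin B > 0" using assms by (intro sin_gt_zero) auto
    then show False using * assms by auto
  qed (use * assms in auto)
qed

text \<open>The sign of the cross product of two points of the sector decides which of them comes first.\<close>

lemma Arg_sector_mono:
  assumes "0 \<le> c" "0 \<le> d" "0 \<le> c'" "0 \<le> d'" "0 \<le> B" "B < pi"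
    and nz: "sector B c d \<noteq> 0" "sector B c' d' \<noteq> 0" and le: "c' * d \<le> c * d'"
  shows "Arg (sector B c d) \<le> Arg (sector B c' d')"
proof (rule ccontr)
  let ?z = "sector B c d" and ?z' = "sector B c' d'"
  assume "\<not> ?thesis"
  then have "0 < Arg ?z - Arg ?z'" by simp
  moreover have "Arg ?z - Arg ?z' < pi"
    using Arg_sector[of c d B] Arg_sector[of c' d' B] assms by linarith
  ultimately have "sin (Arg ?z - Arg ?z') > 0" by (rule sin_gt_zero)
  then have "cmod ?z * cmod ?z' * sin (Arg ?z - Arg ?z') > 0"
    using nz by simp
  also have "cmod ?z * cmod ?z' * sin (Arg ?z - Arg ?z') =
    (cmod ?z * sin (Arg ?z)) * (cmod ?z' * cos (Arg ?z')) - (cmod ?z * cos (Arg ?z)) * (cmod ?z' * sin (Arg ?z'))"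
    by (simp add: sin_diff algebra_simps)
  also have "\<dots> = Im ?z * Re ?z' - Re ?z * Im ?z'"
    unfolding norm_times_cos_Arg norm_times_sin_Arg ..
  also have "\<dots> = (c' * d - c * d') * sin B"
    by (simp add: sector_def algebra_simps)
  also have "\<dots> \<le> 0"
    using le assms sin_ge_zero[of B] by (simp add: mult_le_0_iff)
  finally show False by simp
qed

lemma Arg_sector_right: "0 \<le> c \<Longrightarrow> Arg (sector B c 0) = 0"
  by (simp add: sector_def)

lemma Arg_sector_left: "0 < d \<Longrightarrow> 0 \<le> B \<Longrightarrow> B \<le> pi \<Longrightarrow> Arg (sector B 0 d) = B"
  using Arg_rcis[of B d] pi_gt_zero by (auto simp: sector_def rcis_def)

lemma norm_sector_right: "0 \<le> c \<Longrightarrow> cmod (sector B c 0) = c"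
  by (simp add: sector_def)

lemma norm_sector_left: "0 \<le> d \<Longrightarrow> cmod (sector B 0 d) = d"
  by (simp add: sector_def norm_mult)

section \<open>Geodesics and near-geodesics in the cone\<close>

text \<open>The path from \<open>x\<close> to \<open>y\<close> with parameter \<open>s\<close> is drawn in a
  planar sector and carried over to the cone by \<open>link_arc\<close>, with angles stretched
  such that it ends at \<open>y\<close>. Let \<open>A\<close> be the angle between
  \<open>x\<close> and \<open>y\<close>. For \<open>A \<le> pi - s\<close> the path is the
  straight segment. It cannot be the segment of a narrower sector when \<open>A \<ge>
  pi\<close>, for after stretching the two points might run off the ends of their arms.
  Therefore, if \<open>A \<ge> pi - s / 2\<close>, the path moves along the ray of
  \<open>x\<close>, crosses over at a radius of at most \<open>slack x y s\<close>, and
  continues along the ray of \<open>y\<close>; for angles in between the two paths are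
  interpolated. The bound 1 on the slack keeps the crossing away from the ends of the arms; the
  bounds by the radii make the path start at \<open>x\<close> and end at \<open>y\<close>.\<close>

definition slack :: "cone_point \<Rightarrow> cone_point \<Rightarrow> real \<Rightarrow> real" where
  "slack x y s = s * min 1 (min (fst x) (fst y))"

text \<open>The radius along the ray of \<open>x\<close>. Without slack it is the radius of the path with
  constant speed through the apex; the slack lets this ray and the ray of \<open>y\<close>
  overlap in time, and the crossing takes place during the overlap.\<close>

definition inward :: "cone_point \<Rightarrow> cone_point \<Rightarrow> real \<Rightarrow> real \<Rightarrow> real" where
  "inward x y s t = max 0 (fst x - t * (fst x + fst y - slack x y s))"

definition outward :: "cone_point \<Rightarrow> cone_point \<Rightarrow> real \<Rightarrow> real \<Rightarrow> real" where
  "outward x y s t = max 0 (fst y - (1 - t) * (fst x + fst y - slack x y s))"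

text \<open>Since division by 0 yields 0, at \<open>s = 0\<close> the segment is taken for all angles. This
  makes the path at \<open>s = 0\<close> a geodesic.\<close>

definition blend :: "real \<Rightarrow> real \<Rightarrow> real" where
  "blend A s = max 0 (min 1 ((A - (pi - s)) / (s / 2)))"

definition width :: "real \<Rightarrow> real \<Rightarrow> real" where
  "width A s = min A (pi - s / 2)"

definition in_coeff where
  "in_coeff x y s t = (let b = blend (angle x y) s in
     (1 - b) * ((1 - t) * fst x) + b * inward x y s t)"

definition out_coeff where
  "out_coeff x y s t = (let b = blend (angle x y) s in
     (1 - b) * (t * fst y) + b * outward x y s t)"

definition plane_path where
  "plane_path x y s t = sector (width (angle x y) s) (in_coeff x y s t) (out_coeff x y s t)"

definition arc_param where
  "arc_param x y s t = Arg (plane_path x y s t) * max 1 (angle x y / (pi - s / 2))"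

definition cone_path ::
  "cone_point \<Rightarrow> cone_point \<Rightarrow> real \<Rightarrow> real \<Rightarrow> cone_point" where
  "cone_path x y s t = (cmod (plane_path x y s t), link_arc (snd x) (snd y) (arc_param x y s t))"

lemma blend_bounds: "0 \<le> blend A s" "blend A s \<le> 1"
  by (auto simp: blend_def)

lemma blend_0 [simp]: "blend A 0 = 0"
  by (simp add: blend_def)

lemma blend_eq_0: "0 \<le> s \<Longrightarrow> A \<le> pi - s \<Longrightarrow> blend A s = 0"
  using divide_nonpos_nonneg[of "A - (pi - s)" "s / 2"] by (simp add: blend_def)

lemma blend_eq_1: "0 < s \<Longrightarrow> pi - s / 2 \<le> A \<Longrightarrow> blend A s = 1"
  by (auto simp: blend_def max_def min_def field_simps)

lemma half_less_pi: "s \<le> 1 \<Longrightarrow> 0 < pi - s / (2::real)"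
  using pi_gt3 by linarith

lemma width_bounds:
  assumes "0 \<le> A" "0 \<le> s" "s \<le> 1"
  shows "0 \<le> width A s" "width A s \<le> pi"
  using assms half_less_pi[of s] by (auto simp: width_def)

text \<open>After stretching, the far side of the sector is the direction of \<open>y\<close>.\<close>

lemma width_stretch:
  assumes "0 \<le> A" "0 \<le> s" "s \<le> 1"
  shows "width A s * max 1 (A / (pi - s / 2)) = A"
proof (cases "A \<le> pi - s / 2")
  case True
  then have "A / (pi - s / 2) \<le> 1"
    using half_less_pi[OF assms(3)] by (simp only: divide_le_eq_1_pos)
  then show ?thesis using True by (simp add: width_def)
next
  case False
  then have "1 \<le> A / (pi - s / 2)"
    using half_less_pi[OF assms(3)] by (simp only: le_divide_eq_1_pos)
  then have "max 1 (A / (pi - s / 2)) = A / (pi - s / 2)" by simp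
  then show ?thesis using False half_less_pi[OF assms(3)] unfolding width_def by simp
qed

lemma slack_bounds:
  assumes "0 \<le> s" "s \<le> 1" "0 \<le> fst x" "0 \<le> fst y"
  shows "0 \<le> slack x y s" "slack x y s \<le> s" "slack x y s \<le> fst x" "slack x y s \<le> fst y"
proof -
  have m: "0 \<le> min 1 (min (fst x) (fst y))" using assms by auto
  show "0 \<le> slack x y s" unfolding slack_def using m assms by auto
  have "slack x y s \<le> s * 1" unfolding slack_def using assms by (intro mult_left_mono) auto
  then show "slack x y s \<le> s" by simp
  have "slack x y s \<le> 1 * min 1 (min (fst x) (fst y))"
    unfolding slack_def using m assms by (intro mult_right_mono) auto
  then show "slack x y s \<le> fst x" "slack x y s \<le> fst y" by auto
qed

locale cone_pair =
  fixes x y :: "cone_point" and s :: real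
  assumes x: "x \<in> link_cone" and y: "y \<in> link_cone" and s: "0 \<le> s" "s \<le> 1"
begin

abbreviation "A \<equiv> angle x y"
abbreviation "B \<equiv> width A s"
abbreviation "e \<equiv> slack x y s"

lemmas X = link_cone_D[OF x] and Y = link_cone_D[OF y]

lemma A_nonneg: "0 \<le> A" using X Y link_dist_nonneg by auto

lemmas B_bounds = width_bounds[OF A_nonneg s]
lemmas e_bounds = slack_bounds[OF s X(1) Y(1)]

lemma inward_outward_nonneg: "0 \<le> inward x y s t" "0 \<le> outward x y s t"
  by (auto simp: inward_def outward_def)

lemma inward_outward_ge: "e \<le> inward x y s t + outward x y s t"
proof -
  have "e = (fst x - t * (fst x + fst y - e)) + (fst y - (1 - t) * (fst x + fst y - e))"
    by (simp add: algebra_simps)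
  then show ?thesis unfolding inward_def outward_def by linarith
qed

text \<open>During the overlap the two radii are affine with opposite slopes.\<close>

lemma inward_outward_eq:
  assumes "0 < inward x y s t" "0 < outward x y s t"
  shows "inward x y s t + outward x y s t = e"
proof -
  have "e = (fst x - t * (fst x + fst y - e)) + (fst y - (1 - t) * (fst x + fst y - e))"
    by (simp add: algebra_simps)
  then show ?thesis using assms unfolding inward_def outward_def by linarith
qed

lemma inward_le: "0 \<le> t \<Longrightarrow> t \<le> 1 \<Longrightarrow> inward x y s t \<le> (1 - t) * fst x"
  and outward_le: "0 \<le> t \<Longrightarrow> t \<le> 1 \<Longrightarrow> outward x y s t \<le> t * fst y"
proof -
  assume t: "0 \<le> t" "t \<le> 1"
  have "t * fst x \<le> t * (fst x + fst y - e)" "(1 - t) * fst y \<le> (1 - t) * (fst x + fst y - e)"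
    using t e_bounds by (auto intro!: mult_left_mono)
  then have "fst x - t * (fst x + fst y - e) \<le> (1 - t) * fst x"
    "fst y - (1 - t) * (fst x + fst y - e) \<le> t * fst y"
    unfolding left_diff_distrib by linarith+
  moreover have "0 \<le> (1 - t) * fst x" "0 \<le> t * fst y"
    using t X(1) Y(1) by auto
  ultimately show "inward x y s t \<le> (1 - t) * fst x" "outward x y s t \<le> t * fst y"
    unfolding inward_def outward_def by auto
qed

lemma coeff_bounds:
  assumes "0 \<le> t" "t \<le> 1"
  shows "0 \<le> in_coeff x y s t" "in_coeff x y s t \<le> (1 - t) * fst x"
    "0 \<le> out_coeff x y s t" "out_coeff x y s t \<le> t * fst y"
proof -
  have conv: "(1 - b) * a + b * c \<le> a" if "0 \<le> b" "c \<le> a" for a b c :: real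
    using mult_left_mono[OF that(2,1)] by (simp add: algebra_simps)
  show "0 \<le> in_coeff x y s t" "0 \<le> out_coeff x y s t"
    unfolding in_coeff_def out_coeff_def Let_def using blend_bounds[of A s] inward_outward_nonneg assms X(1) Y(1)
    by (auto intro!: add_nonneg_nonneg mult_nonneg_nonneg)
  show "in_coeff x y s t \<le> (1 - t) * fst x" "out_coeff x y s t \<le> t * fst y"
    unfolding in_coeff_def out_coeff_def Let_def
    by (intro conv blend_bounds inward_le outward_le assms)+
qed

lemma coeff_sum_pos:
  assumes "0 \<le> t" "t \<le> 1" "0 < fst x" "0 < fst y"
  shows "0 < in_coeff x y s t + out_coeff x y s t"
proof (cases "blend A s = 1")
  case True
  then have "s \<noteq> 0" by (intro notI) simp
  then have "0 < e" unfolding slack_def using s assms by auto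
  then show ?thesis using inward_outward_ge[of t] True by (simp add: in_coeff_def out_coeff_def)
next
  case False
  then have b: "0 < 1 - blend A s" "0 \<le> blend A s" using blend_bounds[of A s] by auto
  have "0 < (1 - t) * fst x + t * fst y"
    using assms by (cases "t = 0") (auto intro: add_nonneg_pos)
  then have "0 < (1 - blend A s) * ((1 - t) * fst x + t * fst y)"
    using b by simp
  also have "\<dots> \<le> (1 - blend A s) * ((1 - t) * fst x + t * fst y) + blend A s * (inward x y s t + outward x y s t)"
    using b inward_outward_nonneg by simp
  also have "\<dots> = in_coeff x y s t + out_coeff x y s t"
    by (simp only: in_coeff_def out_coeff_def Let_def distrib_left add_ac)
  finally show ?thesis .
qed

lemma plane_path_nonzero:
  assumes "0 \<le> t" "t \<le> 1" "0 < fst x" "0 < fst y" "0 < s \<or> A < pi"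
  shows "plane_path x y s t \<noteq> 0"
  unfolding plane_path_def
  by (rule sector_nonzero) (use assms coeff_bounds coeff_sum_pos B_bounds s in \<open>auto simp: width_def\<close>)

lemma Arg_bounds:
  assumes "0 \<le> t" "t \<le> 1"
  shows "0 \<le> Arg (plane_path x y s t)" "Arg (plane_path x y s t) \<le> B"
  unfolding plane_path_def by (intro Arg_sector coeff_bounds assms B_bounds)+

lemma arc_param_bounds:
  assumes "0 \<le> t" "t \<le> 1"
  shows "0 \<le> arc_param x y s t" "arc_param x y s t \<le> A"
proof -
  show "0 \<le> arc_param x y s t" unfolding arc_param_def using Arg_bounds[OF assms] by simp
  have "arc_param x y s t \<le> B * max 1 (A / (pi - s / 2))"
    unfolding arc_param_def using Arg_bounds[OF assms] by (intro mult_right_mono) auto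
  then show "arc_param x y s t \<le> A" using width_stretch[OF A_nonneg s] by simp
qed

lemma cone_path_in_cone:
  assumes "0 \<le> t" "t \<le> 1"
  shows "cone_path x y s t \<in> link_cone"
  using link_arc_in_link(1)[OF X(2) Y(2) arc_param_bounds[OF assms]]
  by (auto simp: cone_path_def link_cone_def)

lemma cone_path_fin:
  assumes "0 \<le> t" "t \<le> 1"
  shows "snd (snd (cone_path x y s t)) \<le> max (snd (snd x)) (snd (snd y))"
  using link_arc_in_link(2)[OF X(2) Y(2) arc_param_bounds[OF assms]]
  by (auto simp: cone_path_def)

lemma coeff_start: "in_coeff x y s 0 = fst x" "out_coeff x y s 0 = 0"
  using e_bounds by (auto simp: in_coeff_def out_coeff_def inward_def outward_def X(1) algebra_simps)

lemma coeff_end: "in_coeff x y s 1 = 0" "out_coeff x y s 1 = fst y"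
  using e_bounds by (auto simp: in_coeff_def out_coeff_def inward_def outward_def Y(1) algebra_simps)

lemma cone_path_start: "cone_path x y s 0 = x"
  unfolding cone_path_def arc_param_def plane_path_def coeff_start
  using X Y by (simp add: Arg_sector_right norm_sector_right link_arc_0)

lemma cone_path_end:
  assumes "0 < fst y"
  shows "cone_path x y s 1 = y"
  unfolding cone_path_def arc_param_def plane_path_def coeff_end
  using X Y assms B_bounds width_stretch[OF A_nonneg s]
  by (simp add: Arg_sector_left norm_sector_left link_arc_end)

lemma cone_path_end_dist: "cone_dist (cone_path x y s 1) y = 0"
proof (cases "0 < fst y")
  case False
  then have "fst y = 0" using Y by simp
  then show ?thesis
    by (simp add: cone_dist_apex cone_path_def plane_path_def coeff_end norm_sector_left)
qed (simp add: cone_path_end)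

lemma link_dist_path_le:
  assumes "0 \<le> t" "t \<le> 1" "0 \<le> t'" "t' \<le> 1"
  shows "angle (cone_path x y s t) (cone_path x y s t') \<le> \<bar>arc_param x y s t' - arc_param x y s t\<bar>"
  unfolding cone_path_def snd_conv
  by (intro link_arc_Lipschitz X Y arc_param_bounds assms)

text \<open>If \<open>A \<le> pi - s\<close>, the sector is developed into the cone without stretching. If
  \<open>s = 0\<close> and \<open>A > pi\<close>, it has degenerated to a line through the apex,
  and stretching affects directions but no radii. In both cases distances do not exceed those in
  the plane.\<close>

lemma cone_dist_straight:
  assumes t: "0 \<le> t" "t \<le> 1" "0 \<le> t'" "t' \<le> 1" and A: "A \<le> pi - s \<or> s = 0"
  shows "cone_dist (cone_path x y s t) (cone_path x y s t') \<le> \<bar>t - t'\<bar> * cone_dist x y"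
proof -
  have b: "blend A s = 0" using A blend_eq_0[of s A] s by auto
  have B: "B = min pi A" using A s by (auto simp: width_def)
  have z: "plane_path x y s t = sector B ((1 - t) * fst x) (t * fst y)" for t
    by (simp add: plane_path_def in_coeff_def out_coeff_def b)
  have "plane_path x y s t - plane_path x y s t' = of_real (t' - t) * (of_real (fst x) - of_real (fst y) * cis B)"
    unfolding z sector_def by (simp add: algebra_simps)
  then have zd: "cmod (plane_path x y s t - plane_path x y s t') = \<bar>t - t'\<bar> * cone_dist x y"
    by (simp only: norm_mult cone_dist_def B norm_of_real) (simp add: abs_minus_commute)
  have "cone_dist (cone_path x y s t) (cone_path x y s t') \<le> cmod (plane_path x y s t - plane_path x y s t')"
  proof (cases "A \<le> pi - s / 2")
    case True
    then have k: "max 1 (A / (pi - s / 2)) = 1"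
      using half_less_pi[OF s(2)] by (simp add: max_def field_simps)
    define u where "u = Arg (plane_path x y s t') - Arg (plane_path x y s t)"
    have "cone_dist (cone_path x y s t) (cone_path x y s t') \<le>
      cmod (complex_of_real (fst (cone_path x y s t)) - complex_of_real (fst (cone_path x y s t')) * cis u)"
    proof (rule cone_dist_le_develop)
      show "angle (cone_path x y s t) (cone_path x y s t') \<le> \<bar>u\<bar>"
        using link_dist_path_le[OF t] by (simp add: arc_param_def k u_def)
      show "\<bar>u\<bar> \<le> pi"
        using Arg_bounds[of t] Arg_bounds[of t'] t B_bounds by (simp add: u_def)
    qed (use cone_path_in_cone t in auto)
    also have "\<dots> = cmod (cis (Arg (plane_path x y s t)) * (complex_of_real (fst (cone_path x y s t)) - complex_of_real (fst (cone_path x y s t')) * cis u))"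
      by (simp add: norm_mult)
    also have "cis (Arg (plane_path x y s t)) * (complex_of_real (fst (cone_path x y s t)) - complex_of_real (fst (cone_path x y s t')) * cis u)
      = complex_of_real (cmod (plane_path x y s t)) * cis (Arg (plane_path x y s t)) - complex_of_real (cmod (plane_path x y s t')) * cis (Arg (plane_path x y s t'))"
      by (simp add: cone_path_def u_def right_diff_distrib mult.left_commute cis_mult)
    also have "\<dots> = plane_path x y s t - plane_path x y s t'"
      by (simp only: norm_cis_Arg)
    finally show ?thesis .
  next
    case False
    then have "s = 0" "B = pi" using A s B by auto
    define a where "a t = (1 - t) * fst x - t * fst y" for t
    have za: "plane_path x y s t = of_real (a t)" for t
      unfolding z \<open>B = pi\<close> sector_def a_def by simp
    have r: "fst (cone_path x y s t) = \<bar>a t\<bar>" for t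
      by (simp add: cone_path_def za)
    have ar: "arc_param x y s t = pi * (if a t < 0 then 1 else 0) * max 1 (A / (pi - s / 2))" for t
      unfolding arc_param_def za by simp
    note C = cone_path_in_cone[OF t(1,2)] cone_path_in_cone[OF t(3,4)]
    have "cone_dist (cone_path x y s t) (cone_path x y s t') \<le> \<bar>a t - a t'\<bar>"
    proof (cases "a t < 0 \<longleftrightarrow> a t' < 0")
      case True
      then have "arc_param x y s t = arc_param x y s t'" by (simp add: ar)
      then have "angle (cone_path x y s t) (cone_path x y s t') \<le> 0"
        using link_dist_path_le[OF t] by simp
      then have "fst (cone_path x y s t') * angle (cone_path x y s t) (cone_path x y s t') \<le> 0"
        using r by (simp add: mult_le_0_iff)
      then have "cone_dist (cone_path x y s t) (cone_path x y s t') \<le> \<bar>\<bar>a t\<bar> - \<bar>a t'\<bar>\<bar>"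
        using cone_dist_le_polar_right[OF C] unfolding r by linarith
      then show ?thesis by linarith
    next
      case False
      then show ?thesis using cone_dist_le_sum[OF C] unfolding r by linarith
    qed
    also have "\<dots> = cmod (plane_path x y s t - plane_path x y s t')"
      unfolding za by (metis norm_of_real of_real_diff)
    finally show ?thesis .
  qed
  then show ?thesis using zd by simp
qed

text \<open>An upper bound for the length of the path up to time \<open>t\<close>, for wide angles: the
  radial motion contributes the difference of the two radii, and turning happens at radius at
  most \<open>e\<close>.\<close>

definition potential :: "real \<Rightarrow> real" where
  "potential t = outward x y s t - inward x y s t + e * arc_param x y s t"

lemma cone_dist_wide:
  assumes t: "0 \<le> t" "t \<le> t'" "t' \<le> 1" and A: "pi \<le> A" and pos: "0 < s" "0 < fst x" "0 < fst y"
  shows "cone_dist (cone_path x y s t) (cone_path x y s t') \<le> potential t' - potential t"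
proof -
  have b: "blend A s = 1" using A pos by (intro blend_eq_1) auto
  have cf: "in_coeff x y s = inward x y s" "out_coeff x y s = outward x y s"
    by (auto simp: fun_eq_iff in_coeff_def out_coeff_def b)
  have B: "0 \<le> B" "B < pi" using A pos B_bounds by (auto simp: width_def)
  define M where "M = fst x + fst y - e"
  have e: "0 < e" "e \<le> fst x" "e \<le> fst y"
    using e_bounds pos by (auto simp: slack_def)
  then have M: "0 < M" unfolding M_def using pos by linarith
  have il: "inward x y s r = max 0 (fst x - r * M)" for r by (simp add: inward_def M_def)
  have ol: "outward x y s r = max 0 (e - fst x + r * M)" for r
    by (simp add: outward_def M_def algebra_simps)
  have pp: "plane_path x y s r = sector B (inward x y s r) (outward x y s r)" for r
    by (simp add: plane_path_def cf)
  have mono: "inward x y s r' \<le> inward x y s r" "outward x y s r \<le> outward x y s r'" if "r \<le> r'" for r r'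
    using mult_right_mono[OF that less_imp_le[OF M]] unfolding il ol by linarith+
  have param_mono: "arc_param x y s r \<le> arc_param x y s r'" if "0 \<le> r" "r \<le> r'" "r' \<le> 1" for r r'
    unfolding arc_param_def
  proof (rule mult_right_mono)
    have "inward x y s r' * outward x y s r \<le> inward x y s r * outward x y s r'"
      using mono[OF that(2)] inward_outward_nonneg by (intro mult_mono) auto
    then show "Arg (plane_path x y s r) \<le> Arg (plane_path x y s r')"
      unfolding pp using B that inward_outward_nonneg plane_path_nonzero[of r] plane_path_nonzero[of r'] pos
      by (intro Arg_sector_mono) (auto simp: pp)
  qed simp
  have rad: "\<bar>fst (cone_path x y s r) - fst (cone_path x y s r')\<bar>
      \<le> (outward x y s r' - inward x y s r') - (outward x y s r - inward x y s r)" if "r \<le> r'" for r r'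
  proof -
    have "\<bar>fst (cone_path x y s r) - fst (cone_path x y s r')\<bar> \<le> cmod (plane_path x y s r - plane_path x y s r')"
      unfolding cone_path_def fst_conv by (rule norm_triangle_ineq3)
    also have "\<dots> \<le> \<bar>inward x y s r - inward x y s r'\<bar> + \<bar>outward x y s r - outward x y s r'\<bar>"
      unfolding pp by (rule norm_sector_diff_le)
    finally show ?thesis using mono[OF that] by linarith
  qed
  have base: "cone_dist (cone_path x y s r) (cone_path x y s r') \<le> potential r' - potential r"
    if r: "0 \<le> r" "r \<le> r'" "r' \<le> 1"
      and m: "min (fst (cone_path x y s r)) (fst (cone_path x y s r')) \<le> e \<or> arc_param x y s r = arc_param x y s r'" for r r'
  proof -
    let ?m = "min (fst (cone_path x y s r)) (fst (cone_path x y s r'))"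
    let ?l = "angle (cone_path x y s r) (cone_path x y s r')"
    have C: "cone_path x y s r \<in> link_cone" "cone_path x y s r' \<in> link_cone"
      using r by (auto intro: cone_path_in_cone)
    have m0: "0 \<le> ?m" by (simp add: cone_path_def)
    have l0: "0 \<le> ?l" using C by (auto intro: link_dist_nonneg dest: link_cone_D)
    have l: "?l \<le> arc_param x y s r' - arc_param x y s r"
      using link_dist_path_le[of r r'] param_mono[OF r] r by auto
    have "?m * ?l \<le> e * (arc_param x y s r' - arc_param x y s r)"
    proof (cases "arc_param x y s r = arc_param x y s r'")
      case True
      then show ?thesis using l l0 by simp
    next
      case False
      then show ?thesis using m m0 l l0 e by (intro mult_mono) auto
    qed
    then show ?thesis
      using cone_dist_le_polar[OF C] rad[OF r(2)] unfolding potential_def by (simp add: algebra_simps)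
  qed
  (* At time t1 the ray of y is entered; before, the angle is 0, and afterwards the radius is at
     most e until the ray of x is left. *)
  define t1 where "t1 = (fst x - e) / M"
  have t1M: "t1 * M = fst x - e" using M by (simp add: t1_def)
  have t1: "0 \<le> t1" using e M by (simp add: t1_def)
  have early: "arc_param x y s r = 0" if "r \<le> t1" for r
  proof -
    have "r * M \<le> fst x - e" using that M t1M by (metis mult_right_mono less_imp_le)
    then have "outward x y s r = 0" by (simp add: ol)
    then show ?thesis unfolding arc_param_def pp using inward_outward_nonneg by (simp add: Arg_sector_right)
  qed
  have late: "fst (cone_path x y s r) \<le> e \<or> inward x y s r = 0 \<and> 0 < outward x y s r" if "t1 \<le> r" for r
  proof -
    have 1: "fst x - e \<le> r * M" using that M t1M by (metis mult_right_mono less_imp_le)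
    show ?thesis
    proof (cases "r * M \<le> fst x")
      case True
      then have "inward x y s r + outward x y s r = e" using 1 unfolding il ol by auto
      then show ?thesis using norm_sector_le[OF inward_outward_nonneg] unfolding cone_path_def pp fst_conv by metis
    next
      case False
      then show ?thesis using e unfolding il ol by auto
    qed
  qed
  have done2: "cone_dist (cone_path x y s r) (cone_path x y s r') \<le> potential r' - potential r"
    if r: "0 \<le> r" "r \<le> r'" "r' \<le> 1" and "t1 \<le> r" for r r'
  proof (rule base[OF r])
    show "min (fst (cone_path x y s r)) (fst (cone_path x y s r')) \<le> e \<or> arc_param x y s r = arc_param x y s r'"
    proof (cases "fst (cone_path x y s r) \<le> e \<or> fst (cone_path x y s r') \<le> e")
      case False
      then have "inward x y s r = 0 \<and> 0 < outward x y s r" "inward x y s r' = 0 \<and> 0 < outward x y s r'"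
        using late[of r] late[of r'] that by auto
      then show ?thesis unfolding arc_param_def pp using B by (simp add: Arg_sector_left)
    qed auto
  qed
  show ?thesis
  proof (cases "t1 \<le> t")
    case True
    then show ?thesis using done2 t by auto
  next
    case F: False
    show ?thesis
    proof (cases "t' \<le> t1")
      case True
      then show ?thesis using base[of t t'] early[of t] early[of t'] t by auto
    next
      case False
      have "cone_dist (cone_path x y s t) (cone_path x y s t') \<le>
          cone_dist (cone_path x y s t) (cone_path x y s t1) + cone_dist (cone_path x y s t1) (cone_path x y s t')"
        using F False t t1 by (intro cone_dist_triangle cone_path_in_cone) auto
      also have "\<dots> \<le> (potential t1 - potential t) + (potential t' - potential t1)"
        using F False t t1 early[of t] early[of t1] by (intro add_mono base done2) auto
      finally show ?thesis by simp
    qed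
  qed
qed

lemma potential_total:
  assumes "pi \<le> A" "0 < s" "0 < fst x" "0 < fst y"
  shows "potential 1 - potential 0 \<le> cone_dist x y + s * A"
proof -
  have b: "blend A s = 1" using assms by (intro blend_eq_1) auto
  have cf: "in_coeff x y s = inward x y s" "out_coeff x y s = outward x y s"
    by (auto simp: fun_eq_iff in_coeff_def out_coeff_def b)
  have "potential 1 - potential 0 = fst y + fst x + e * (arc_param x y s 1 - arc_param x y s 0)"
    unfolding potential_def using coeff_start coeff_end by (simp add: cf algebra_simps)
  also have "cone_dist x y = fst x + fst y"
  proof -
    have "min pi A = pi" using assms by simp
    then have "cone_dist x y = cmod (of_real (fst x + fst y))"
      unfolding cone_dist_def by (simp add: sector_def)
    then show ?thesis using assms by (simp only: norm_of_real)
  qed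
  moreover have "e * (arc_param x y s 1 - arc_param x y s 0) \<le> e * A"
    using e_bounds arc_param_bounds[of 0] arc_param_bounds[of 1] by (intro mult_left_mono) auto
  moreover have "e * A \<le> s * A"
    using e_bounds A_nonneg by (intro mult_right_mono) auto
  ultimately show ?thesis by simp
qed

end

section \<open>Continuity of the near-geodesics\<close>

lemma plane_path_split:
  "plane_path x y s t = sector (width (angle x y) s) ((1 - t) * fst x) (t * fst y)
    + of_real (blend (angle x y) s) *
      sector (width (angle x y) s) (inward x y s t - (1 - t) * fst x) (outward x y s t - t * fst y)"
  by (simp add: plane_path_def in_coeff_def out_coeff_def sector_def Let_def algebra_simps)

text \<open>At \<open>s = 0\<close> and \<open>A \<ge> pi\<close> the crossing path and the segment
  coincide. This is what keeps the interpolated path continuous there, where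
  \<open>blend\<close> is discontinuous.\<close>

lemma inward_outward_at_0:
  assumes "x \<in> link_cone" "y \<in> link_cone"
  shows "sector pi (inward x y 0 t - (1 - t) * fst x) (outward x y 0 t - t * fst y) = 0"
proof -
  have "outward x y 0 t = max 0 (- (fst x - t * (fst x + fst y)))"
    by (simp add: outward_def slack_def algebra_simps)
  then have "inward x y 0 t - outward x y 0 t = fst x - t * (fst x + fst y)"
    unfolding inward_def by (simp add: slack_def)
  then have "(inward x y 0 t - (1 - t) * fst x) - (outward x y 0 t - t * fst y) = 0"
    by (simp add: algebra_simps)
  then have "complex_of_real ((inward x y 0 t - (1 - t) * fst x) - (outward x y 0 t - t * fst y)) = 0"
    by (simp only: of_real_0)
  then show ?thesis
    by (simp add: sector_def algebra_simps)
qed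

lemma Arg_upper_half: "z \<noteq> 0 \<Longrightarrow> 0 \<le> Im z \<Longrightarrow> Arg z = arccos (Re z / cmod z)"
  using arccos_cos[of "Arg z"] Arg_le_pi[of z] cos_Arg[of z] by (simp add: Arg_less_0)

text \<open>On the closed upper half plane \<open>Arg\<close> has no jump along the negative axis.\<close>

lemma tendsto_Arg_upper_half:
  assumes "(f \<longlongrightarrow> z) F" "z \<noteq> 0" "0 \<le> Im z" "\<forall>\<^sub>F x in F. 0 \<le> Im (f x)"
  shows "((\<lambda>x. Arg (f x)) \<longlongrightarrow> Arg z) F"
proof -
  have nz: "\<forall>\<^sub>F x in F. f x \<noteq> 0"
    using tendsto_imp_eventually_ne[OF assms(1,2)] .
  have "((\<lambda>x. Re (f x) / cmod (f x)) \<longlongrightarrow> Re z / cmod z) F"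
    using assms by (intro tendsto_intros) auto
  moreover have "Re u / cmod u \<in> {-1..1}" if "u \<noteq> 0" for u
    using abs_Re_le_cmod[of u] that by (auto simp: abs_le_iff field_simps)
  ultimately have "((\<lambda>x. arccos (Re (f x) / cmod (f x))) \<longlongrightarrow> arccos (Re z / cmod z)) F"
    using nz assms(2) by (intro continuous_on_tendsto_compose[OF continuous_on_arccos']) (auto elim: eventually_mono)
  moreover have "\<forall>\<^sub>F x in F. arccos (Re (f x) / cmod (f x)) = Arg (f x)"
    using nz assms(4) by eventually_elim (simp add: Arg_upper_half)
  ultimately show ?thesis
    unfolding Arg_upper_half[OF assms(2,3)] by (rule Lim_transform_eventually)
qed

lemma tendsto_cis_real: "(f \<longlongrightarrow> a) F \<Longrightarrow> ((\<lambda>x. cis (f x)) \<longlongrightarrow> cis a) F"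
  by (intro tendsto_intros)

lemma tendsto_sector:
  assumes "(B \<longlongrightarrow> b) F" "(C \<longlongrightarrow> c) F" "(D \<longlongrightarrow> d) F"
  shows "((\<lambda>x. sector (B x) (C x) (D x)) \<longlongrightarrow> sector b c d) F"
  unfolding sector_def by (intro tendsto_intros tendsto_cis_real assms)

lemma tendsto_link_arc:
  assumes P: "(P \<longlongrightarrow> p) F" and Q: "(Q \<longlongrightarrow> q) F" and u: "(u \<longlongrightarrow> \<tau>) F"
    and ev: "\<forall>\<^sub>F a in F. P a \<in> link \<and> Q a \<in> link" and pq: "p \<in> link" "q \<in> link"
    and disp: "((\<lambda>a. disp (fst (P a)) (fst (Q a))) \<longlongrightarrow> disp (fst p) (fst q)) F"
  shows "((\<lambda>a. link_arc (P a) (Q a) (u a)) \<longlongrightarrow> link_arc p q \<tau>) F"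
proof -
  have A: "((\<lambda>a. link_dist (P a) (Q a)) \<longlongrightarrow> link_dist p q) F"
    by (rule tendsto_link_dist_both) (use P Q pq ev in \<open>auto elim: eventually_mono\<close>)
  have o: "((\<lambda>a. overlap (P a) (Q a)) \<longlongrightarrow> overlap p q) F"
    unfolding overlap_def by (intro tendsto_intros A disp P Q) auto
  show ?thesis
    unfolding link_arc_def clamp_def by (intro tendsto_intros A o disp P Q u)
qed

text \<open>All ingredients are continuous except for three. The displacement is covered by a hypothesis.
  Where \<open>blend\<close> jumps, it multiplies a quantity that tends to 0. Where the path
  meets the apex, the direction has no limit, but the radius tends to 0.\<close>

lemma tendsto_cone_path:
  fixes X Y :: "'a \<Rightarrow> cone_point"
  assumes X: "(X \<longlongrightarrow> x) F" and Y: "(Y \<longlongrightarrow> y) F" and S: "(S \<longlongrightarrow> s) F" and T: "(T \<longlongrightarrow> t) F"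
    and ev: "\<forall>\<^sub>F a in F. X a \<in> link_cone \<and> Y a \<in> link_cone \<and> S a \<in> {0..1} \<and> T a \<in> {0..1}"
    and x: "x \<in> link_cone" and y: "y \<in> link_cone" and s: "s \<in> {0..1}" and t: "t \<in> {0..1}"
    and disp: "((\<lambda>a. disp (fst (snd (X a))) (fst (snd (Y a)))) \<longlongrightarrow> disp (fst (snd x)) (fst (snd y))) F"
  shows "((\<lambda>a. cone_dist (cone_path (X a) (Y a) (S a) (T a)) (cone_path x y s t)) \<longlongrightarrow> 0) F"
proof -
  define A where "A a = angle (X a) (Y a)" for a
  define A0 where "A0 = angle x y"
  have cp: "cone_pair x y s" using x y s by unfold_locales auto
  have cpa: "\<forall>\<^sub>F a in F. cone_pair (X a) (Y a) (S a) \<and> 0 \<le> T a \<and> T a \<le> 1"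
    using ev by eventually_elim (auto simp: cone_pair_def)
  have snds: "((\<lambda>a. snd (X a)) \<longlongrightarrow> snd x) F" "((\<lambda>a. snd (Y a)) \<longlongrightarrow> snd y) F"
    using X Y by (auto intro: tendsto_intros)
  have A: "(A \<longlongrightarrow> A0) F"
    unfolding A_def[abs_def] A0_def
    by (rule tendsto_link_dist_both) (use snds x y ev in \<open>auto elim!: eventually_mono dest: link_cone_D\<close>)
  have r: "((\<lambda>a. fst (X a)) \<longlongrightarrow> fst x) F" "((\<lambda>a. fst (Y a)) \<longlongrightarrow> fst y) F"
    using X Y by (auto intro: tendsto_intros)
  have sl: "((\<lambda>a. slack (X a) (Y a) (S a)) \<longlongrightarrow> slack x y s) F"
    unfolding slack_def by (intro tendsto_intros r S)
  have il: "((\<lambda>a. inward (X a) (Y a) (S a) (T a)) \<longlongrightarrow> inward x y s t) F"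
    unfolding inward_def by (intro tendsto_intros r T sl)
  have ol: "((\<lambda>a. outward (X a) (Y a) (S a) (T a)) \<longlongrightarrow> outward x y s t) F"
    unfolding outward_def by (intro tendsto_intros r T sl)
  have wd: "((\<lambda>a. width (A a) (S a)) \<longlongrightarrow> width A0 s) F"
    unfolding width_def by (intro tendsto_intros A S) auto
  define W where "W a = sector (width (A a) (S a)) (inward (X a) (Y a) (S a) (T a) - (1 - T a) * fst (X a))
      (outward (X a) (Y a) (S a) (T a) - T a * fst (Y a))" for a
  define W0 where "W0 = sector (width A0 s) (inward x y s t - (1 - t) * fst x) (outward x y s t - t * fst y)"
  have W: "(W \<longlongrightarrow> W0) F"
    unfolding W_def[abs_def] W0_def by (intro tendsto_sector tendsto_intros il ol wd r T)
  have str: "((\<lambda>a. sector (width (A a) (S a)) ((1 - T a) * fst (X a)) (T a * fst (Y a)))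
     \<longlongrightarrow> sector (width A0 s) ((1 - t) * fst x) (t * fst y)) F"
    by (intro tendsto_sector tendsto_intros wd r T)
  have bW: "((\<lambda>a. of_real (blend (A a) (S a)) * W a) \<longlongrightarrow> of_real (blend A0 s) * W0) F"
  proof -
    \<comment> \<open>Only for \<open>s = 0\<close> and \<open>A0 = pi\<close> is \<open>blend\<close> discontinuous.\<close>
    consider "s \<noteq> 0" | "s = 0" "A0 < pi" | "s = 0" "pi \<le> A0" by linarith
    then show ?thesis
    proof cases
      case 1
      then have "((\<lambda>a. blend (A a) (S a)) \<longlongrightarrow> blend A0 s) F"
        unfolding blend_def by (intro tendsto_intros A S) auto
      then show ?thesis by (intro tendsto_intros W)
    next
      case 2
      have "((\<lambda>a. A a + S a) \<longlongrightarrow> A0 + s) F" by (intro tendsto_intros A S)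
      then have "\<forall>\<^sub>F a in F. A a + S a < pi"
        using 2 by (intro order_tendstoD(2)) auto
      then have "\<forall>\<^sub>F a in F. of_real (blend (A a) (S a)) * W a = of_real (blend A0 s) * W0"
        using ev by eventually_elim (simp add: blend_eq_0 2)
      then show ?thesis by (rule tendsto_eventually)
    next
      case 3
      then have "W0 = 0"
        unfolding W0_def width_def using inward_outward_at_0[OF x y, of t] by (simp add: min_def)
      then have W: "((\<lambda>a. norm (W a)) \<longlongrightarrow> 0) F" using W tendsto_norm_zero by blast
      have "\<forall>\<^sub>F a in F. norm (of_real (blend (A a) (S a)) * W a) \<le> norm (W a)"
        using blend_bounds by (intro always_eventually) (auto simp: norm_mult intro: mult_left_le_one_le)
      from Lim_null_comparison[OF this W] show ?thesis using \<open>W0 = 0\<close> by simp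
    qed
  qed
  define Z where "Z a = plane_path (X a) (Y a) (S a) (T a)" for a
  define Z0 where "Z0 = plane_path x y s t"
  have Z: "(Z \<longlongrightarrow> Z0) F"
    unfolding Z_def[abs_def] Z0_def plane_path_split A_def[symmetric] A0_def[symmetric] W_def[symmetric] W0_def[symmetric]
    by (rule tendsto_add[OF str bW])
  have evc: "\<forall>\<^sub>F a in F. cone_path (X a) (Y a) (S a) (T a) \<in> link_cone"
    using cpa by eventually_elim (auto intro: cone_pair.cone_path_in_cone)
  have c0: "cone_path x y s t \<in> link_cone"
    using cone_pair.cone_path_in_cone[OF cp] t by auto
  have r1: "((\<lambda>a. fst (cone_path (X a) (Y a) (S a) (T a))) \<longlongrightarrow> fst (cone_path x y s t)) F"
    unfolding cone_path_def fst_conv Z_def[symmetric] Z0_def[symmetric] by (intro tendsto_intros Z)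
  show ?thesis
  proof (cases "Z0 = 0")
    case True
    then have "fst (cone_path x y s t) = 0" by (simp add: cone_path_def Z0_def)
    then show ?thesis using r1 evc by (intro tendsto_cone_dist_apex) auto
  next
    case False
    have "((\<lambda>a. Arg (Z a)) \<longlongrightarrow> Arg Z0) F"
    proof (rule tendsto_Arg_upper_half[OF Z False])
      show "0 \<le> Im Z0"
        using cone_pair.Arg_bounds(1)[OF cp] t by (simp add: Arg_less_0 Z0_def)
      show "\<forall>\<^sub>F a in F. 0 \<le> Im (Z a)"
        using cpa by eventually_elim (metis cone_pair.Arg_bounds(1) Arg_less_0 Z_def)
    qed
    note argZ = this
    have ap: "((\<lambda>a. arc_param (X a) (Y a) (S a) (T a)) \<longlongrightarrow> arc_param x y s t) F"
      unfolding arc_param_def A_def[symmetric] A0_def[symmetric] Z_def[symmetric] Z0_def[symmetric]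
      using half_less_pi[of s] s by (intro tendsto_mult argZ tendsto_max tendsto_const tendsto_divide A tendsto_diff S) auto
    have "((\<lambda>a. link_arc (snd (X a)) (snd (Y a)) (arc_param (X a) (Y a) (S a) (T a)))
       \<longlongrightarrow> link_arc (snd x) (snd y) (arc_param x y s t)) F"
      by (rule tendsto_link_arc[OF snds ap]) (use ev x y disp in \<open>auto elim!: eventually_mono dest: link_cone_D\<close>)
    then have "((\<lambda>a. cone_path (X a) (Y a) (S a) (T a)) \<longlongrightarrow> cone_path x y s t) F"
      using tendsto_Pair[OF r1] by (simp add: cone_path_def)
    then show ?thesis by (rule tendsto_cone_dist[OF _ c0 evc])
  qed
qed

section \<open>Arms of finite length\<close>

abbreviation trunc_cos :: "real \<Rightarrow> real" where
  "trunc_cos u \<equiv> cos (min (pi / 2) u)"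

text \<open>The condition at \<open>vertex k\<close> bounds the distance of one of the points from the
  essential vertex by the length of the arm that it is on. In a fin, where both points are on
  one arm, this concerns the farther point and so bounds the other one as well.\<close>

definition region :: "(nat \<Rightarrow> real) \<Rightarrow> cone_point set" where
  "region l = {p \<in> link_cone. \<forall>k. fst p * trunc_cos (vertex_dist (snd p) k) \<le> l k}"

lemma trunc_cos_bounds:
  assumes "0 \<le> g" shows "0 \<le> trunc_cos g" "trunc_cos g \<le> 1"
proof -
  have "- (pi / 2) \<le> min (pi / 2) g" using assms pi_gt_zero by linarith
  then show "0 \<le> trunc_cos g" by (intro cos_ge_zero) auto
qed auto

lemma region_scale:
  assumes p: "p \<in> region l" and r: "0 \<le> r" "r \<le> fst p"
  shows "(r, snd p) \<in> region l"
proof -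
  have c: "p \<in> link_cone" using p by (simp add: region_def)
  have "r * trunc_cos (vertex_dist (snd p) k) \<le> fst p * trunc_cos (vertex_dist (snd p) k)" for k
    using r trunc_cos_bounds(1) link_dist_nonneg[OF link_cone_D(2)[OF c] link_vertex] by (intro mult_right_mono) auto
  moreover have "fst p * trunc_cos (vertex_dist (snd p) k) \<le> l k" for k
    using p by (simp add: region_def)
  ultimately have "r * trunc_cos (vertex_dist (snd p) k) \<le> l k" for k
    using order_trans by blast
  then show ?thesis using r link_cone_D(2)[OF c] by (simp add: region_def link_cone_def)
qed

lemma region_near_apex:
  assumes "(r, q) \<in> link_cone" "r \<le> 1" "\<And>k. 1 \<le> l k"
  shows "(r, q) \<in> region l"
proof -
  have r: "0 \<le> r" "q \<in> link" using assms by (auto simp: link_cone_def)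
  have "r * trunc_cos (vertex_dist q k) \<le> l k" for k
  proof -
    have "r * trunc_cos (vertex_dist q k) \<le> r * 1"
      using r by (intro mult_left_mono) auto
    then show ?thesis using assms(2) assms(3)[of k] by linarith
  qed
  then show ?thesis using assms by (simp add: region_def)
qed

text \<open>Starting at \<open>v\<close>, walk the distance \<open>d\<close> along the circle towards a
  vertex that is less than a right angle away. Either the walk reaches the vertex, or it stops
  before, where there is no fin that \<open>q\<close> could lie in.\<close>

lemma towards_vertex:
  assumes v: "norm v = 1" and q: "q \<in> link" and fq: "fst q = v * turn (\<sigma> * d)" and d: "0 \<le> d"
    and \<sigma>: "\<sigma> = 1 \<or> \<sigma> = -1" and side: "0 \<le> \<sigma> * disp v (vertex j)"
    and near: "circ_dist v (vertex j) < pi / 2"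
  shows "vertex_dist q j \<le> \<bar>circ_dist v (vertex j) - (d + snd q)\<bar>"
proof -
  define \<mu> where "\<mu> = disp v (vertex j)"
  note Q = link_D[OF q]
  have V: "vertex j = v * turn \<mu>"
    unfolding \<mu>_def using turn_disp[OF v norm_vertex] by simp
  also have "\<dots> = fst q * turn (\<mu> - \<sigma> * d)"
    unfolding fq by (simp add: turn_add[symmetric])
  finally have "circ_dist (fst q) (vertex j) \<le> \<bar>\<mu> - \<sigma> * d\<bar>"
    using circ_dist_turn_le[OF Q(1)] by metis
  also have "\<bar>\<mu> - \<sigma> * d\<bar> = \<bar>\<bar>\<mu>\<bar> - d\<bar>"
    using \<sigma> side d unfolding \<mu>_def[symmetric] by auto
  finally have le: "circ_dist (fst q) (vertex j) \<le> \<bar>\<bar>\<mu>\<bar> - d\<bar>" .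
  show ?thesis
  proof (cases "\<bar>\<mu>\<bar> \<le> d \<or> snd q = 0")
    case True
    then show ?thesis
      unfolding link_dist_vertex[OF q] using le Q unfolding \<mu>_def[symmetric] by auto
  next
    case False
    then have "circ_dist (fst q) (vertex j) < pi / 2"
      using le near d unfolding \<mu>_def[symmetric] by linarith
    moreover have "fst q ^ 6 = 1" using Q False by auto
    ultimately have "fst q = vertex j"
      using circ_dist_sixth_roots[of "fst q" "vertex j"] Q by force
    then have "\<bar>\<mu>\<bar> \<le> \<bar>\<sigma> * d\<bar>"
      unfolding \<mu>_def using circ_dist_turn_le[OF v, of "\<sigma> * d"] fq by simp
    then show ?thesis using False \<sigma> d by (auto simp: abs_mult)
  qed
qed

text \<open>From a point less than a right angle away from a vertex, one of the two halves of the arc heads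
  for the vertex, and it has no fin to turn into before it gets there.\<close>

lemma link_arc_branch:
  assumes p: "p \<in> link" and q: "q \<in> link" and \<tau>: "0 \<le> \<tau>" "\<tau> \<le> link_dist p q"
    and near: "vertex_dist (link_arc p q \<tau>) j < pi / 2" (is "?g < _")
  shows "vertex_dist p j \<le> \<bar>?g - \<tau>\<bar> \<or> vertex_dist q j \<le> \<bar>?g - (link_dist p q - \<tau>)\<bar>"
proof -
  note P = link_D[OF p] and Q = link_D[OF q]
  define m where "m = link_arc p q \<tau>"
  have m: "m \<in> link" unfolding m_def by (intro link_arc_in_link p q \<tau>)
  note M = link_D[OF m]
  have g: "vertex_dist m j = circ_dist (fst m) (vertex j) + snd m"
    by (rule link_dist_vertex[OF m])
  have gp: "vertex_dist p j = circ_dist (fst p) (vertex j) + snd p"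
    and gq: "vertex_dist q j = circ_dist (fst q) (vertex j) + snd q"
    by (auto intro: link_dist_vertex p q)
  have nr: "vertex_dist m j < pi / 2" using near m_def by simp
  have fin: "fst m = vertex j" if "fst m ^ 6 = 1"
    using circ_dist_sixth_roots[of "fst m" "vertex j"] that nr g M by force
  show ?thesis
    unfolding m_def[symmetric]
  proof (cases "fst p = fst q")
    case True
    have m_eq: "m = (fst p, max (min (snd p) (snd q)) (max (snd p - \<tau>) (snd q - (\<bar>snd p - snd q\<bar> - \<tau>))))"
      unfolding m_def by (rule link_arc_same[OF True])
    have \<tau>': "\<tau> \<le> \<bar>snd p - snd q\<bar>" using \<tau> True by (simp add: link_dist_def)
    have ld: "link_dist p q = \<bar>snd p - snd q\<bar>" using True by (simp add: link_dist_def)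
    show "vertex_dist p j \<le> \<bar>vertex_dist m j - \<tau>\<bar> \<or>
      vertex_dist q j \<le> \<bar>vertex_dist m j - (link_dist p q - \<tau>)\<bar>"
    proof (cases "fst p ^ 6 = 1")
      case True
      then have V: "fst p = vertex j" "fst q = vertex j" using fin \<open>fst p = fst q\<close> by (auto simp: m_eq)
      show ?thesis
        unfolding g gp gq ld V using \<tau>(1) \<tau>' P(2) Q(2) V by (simp add: m_eq) linarith
    next
      case False
      then have "snd p = 0" "snd q = 0" using P Q \<open>fst p = fst q\<close> by auto
      then show ?thesis unfolding g gp using \<tau>' \<tau> by (simp add: m_eq)
    qed
  next
    case F: False
    define \<delta> where "\<delta> = disp (fst p) (fst q)"
    have m_eq: "m = (fst p * turn (clamp (max 0 (\<tau> - snd p)) \<delta>), max 0 (max (snd p - \<tau>) (\<tau> - (\<bar>\<delta>\<bar> + snd p))))"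
      unfolding m_def \<delta>_def by (rule link_arc_diff[OF F])
    have ld: "link_dist p q = \<bar>\<delta>\<bar> + snd p + snd q" using F by (simp add: link_dist_def \<delta>_def)
    have fq: "fst q = fst p * turn \<delta>" unfolding \<delta>_def using turn_disp P Q by simp
    consider "\<tau> < snd p" | "\<bar>\<delta>\<bar> + snd p < \<tau>" | "snd p \<le> \<tau>" "\<tau> \<le> \<bar>\<delta>\<bar> + snd p" by linarith
    then show "vertex_dist p j \<le> \<bar>vertex_dist m j - \<tau>\<bar> \<or>
      vertex_dist q j \<le> \<bar>vertex_dist m j - (link_dist p q - \<tau>)\<bar>"
    proof cases
      case 1
      then have m1: "m = (fst p, snd p - \<tau>)" unfolding m_eq by simp
      moreover have "fst p ^ 6 = 1" using P 1 \<tau> by auto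
      ultimately have V: "fst p = vertex j" using fin by simp
      have "circ_dist (fst q) (vertex j) = \<bar>\<delta>\<bar>"
        using circ_dist_commute[OF P(1) Q(1)] V by (simp add: \<delta>_def)
      then show ?thesis unfolding g gq ld using V m1 by auto
    next
      case 2
      then have m1: "m = (fst q, \<tau> - (\<bar>\<delta>\<bar> + snd p))" unfolding m_eq using fq P by (simp add: clamp_big)
      moreover have "fst q ^ 6 = 1" using Q 2 \<tau> ld by auto
      ultimately have V: "fst q = vertex j" using fin by simp
      have "circ_dist (fst p) (vertex j) = \<bar>\<delta>\<bar>"
        using V by (simp add: \<delta>_def)
      then show ?thesis unfolding g gp ld using V m1 by auto
    next
      case 3
      define \<kappa> where "\<kappa> = \<tau> - snd p"
      define \<sigma> where "\<sigma> = (if 0 \<le> \<delta> then 1 else -1 :: real)"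
      have \<kappa>: "0 \<le> \<kappa>" "\<kappa> \<le> \<bar>\<delta>\<bar>" using 3 by (auto simp: \<kappa>_def)
      have cl: "clamp (max 0 (\<tau> - snd p)) \<delta> = \<sigma> * \<kappa>"
        using \<kappa> unfolding \<kappa>_def[symmetric] clamp_def \<sigma>_def by auto
      have m1: "fst m = fst p * turn (\<sigma> * \<kappa>)" "snd m = 0"
        unfolding m_eq cl using 3 by auto
      have \<delta>: "\<delta> = \<sigma> * \<bar>\<delta>\<bar>" by (simp add: \<sigma>_def)
      have q1: "fst q = fst m * turn (\<sigma> * (\<bar>\<delta>\<bar> - \<kappa>))"
        unfolding m1 mult.assoc turn_add[symmetric] fq by (subst (1) \<delta>) (simp add: algebra_simps)
      have p1: "fst p = fst m * turn ((- \<sigma>) * \<kappa>)"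
        unfolding m1 mult.assoc turn_add[symmetric] by simp
      have n: "circ_dist (fst m) (vertex j) < pi / 2" using nr g m1 by simp
      have s: "\<sigma> = 1 \<or> \<sigma> = -1" "- \<sigma> = 1 \<or> - \<sigma> = -1" by (auto simp: \<sigma>_def)
      show ?thesis
      proof (cases "0 \<le> \<sigma> * disp (fst m) (vertex j)")
        case True
        have "vertex_dist q j \<le> \<bar>circ_dist (fst m) (vertex j) - ((\<bar>\<delta>\<bar> - \<kappa>) + snd q)\<bar>"
          by (rule towards_vertex[OF M(1) q q1 _ s(1) True n]) (use \<kappa> in auto)
        moreover have "(\<bar>\<delta>\<bar> - \<kappa>) + snd q = link_dist p q - \<tau>"
          by (simp add: ld \<kappa>_def)
        ultimately show ?thesis unfolding g m1 by simp
      next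
        case False
        have "vertex_dist p j \<le> \<bar>circ_dist (fst m) (vertex j) - (\<kappa> + snd p)\<bar>"
          by (rule towards_vertex[OF M(1) p p1 \<kappa>(1) s(2) _ n]) (use False in auto)
        moreover have "\<kappa> + snd p = \<tau>" by (simp add: \<kappa>_def)
        ultimately show ?thesis unfolding g m1 by simp
      qed
    qed
  qed
qed

lemma cos_le_trunc_cos:
  assumes "0 \<le> g" "g \<le> \<bar>a\<bar>" "\<bar>a\<bar> \<le> 3 / 2 * pi"
  shows "cos a \<le> trunc_cos g"
proof (cases "\<bar>a\<bar> \<le> pi / 2")
  case True
  then have "cos \<bar>a\<bar> \<le> cos g" using assms pi_gt_zero by (intro cos_monotone_0_pi_le) linarith+
  moreover have "min (pi / 2) g = g" using True assms by auto
  ultimately show ?thesis by simp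
next
  case False
  have "cos (\<bar>a\<bar> - pi) \<ge> 0" using False assms by (intro cos_ge_zero) auto
  then have "cos a \<le> 0" by simp
  then show ?thesis using trunc_cos_bounds(1)[OF assms(1)] by linarith
qed

lemma norm_cos_Arg_diff:
  "cmod (sector B c d) * cos (Arg (sector B c d) - a) = c * cos a + d * cos (B - a)"
proof -
  have "cmod (sector B c d) * cos (Arg (sector B c d) - a) =
    (cmod (sector B c d) * cos (Arg (sector B c d))) * cos a + (cmod (sector B c d) * sin (Arg (sector B c d))) * sin a"
    by (simp add: cos_diff algebra_simps)
  also have "\<dots> = c * cos a + d * cos (B - a)"
    unfolding norm_times_cos_Arg norm_times_sin_Arg by (simp add: sector_def cos_diff algebra_simps)
  finally show ?thesis .
qed

text \<open>The triangle with the corners \<open>x\<close>, \<open>y\<close> and the apex stays in the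
  region. By \<open>link_arc_branch\<close> the vertex in question can be placed in the plane of
  the sector, at an angle \<open>a\<close>, such that the distance along its arm is the
  component in the direction \<open>a\<close> at the given point, and at least this component at
  \<open>x\<close> and at \<open>y\<close>. A linear functional on the triangle is bounded by
  its values at the corners.\<close>

lemma region_triangle:
  assumes x: "x \<in> region l" and y: "y \<in> region l" and A: "angle x y < pi" (is "?A < pi")
    and t: "0 \<le> t" "t \<le> 1" and c: "0 \<le> c" "c \<le> (1 - t) * fst x" and d: "0 \<le> d" "d \<le> t * fst y"
    and l: "\<And>k. 0 \<le> l k"
  shows "(cmod (sector ?A c d), link_arc (snd x) (snd y) (Arg (sector ?A c d))) \<in> region l"
proof -
  let ?\<tau> = "Arg (sector ?A c d)" and ?\<rho> = "cmod (sector ?A c d)"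
  let ?m = "link_arc (snd x) (snd y) ?\<tau>"
  have xc: "x \<in> link_cone" and yc: "y \<in> link_cone" using x y by (auto simp: region_def)
  note X = link_cone_D[OF xc] and Y = link_cone_D[OF yc]
  have A0: "0 \<le> ?A" using X Y link_dist_nonneg by auto
  have \<tau>: "0 \<le> ?\<tau>" "?\<tau> \<le> ?A" using Arg_sector[of c d ?A] c d A A0 by auto
  have m: "?m \<in> link" by (intro link_arc_in_link X Y \<tau>)
  have "?\<rho> * trunc_cos (vertex_dist ?m j) \<le> l j" for j
  proof -
    define g where "g q = vertex_dist q j" for q
    have g0: "0 \<le> g q" if "q \<in> link" for q using that link_dist_nonneg by (auto simp: g_def)
    show ?thesis
    proof (cases "g ?m < pi / 2")
      case False
      then show ?thesis using l by (simp add: g_def min_def)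
    next
      case True
      have dx: "link_dist (snd x) ?m \<le> ?\<tau>"
        using link_arc_Lipschitz[OF X(2) Y(2), of 0 ?\<tau>] \<tau> A0 link_arc_0[OF X(2) Y(2)] by simp
      have dy: "link_dist (snd y) ?m \<le> ?A - ?\<tau>"
        using link_arc_Lipschitz[OF X(2) Y(2), of ?A ?\<tau>] \<tau> A0 link_arc_end[OF X(2) Y(2)] by simp
      have tx: "g (snd x) \<le> ?\<tau> + g ?m"
        unfolding g_def using link_dist_triangle[OF X(2) m link_vertex[of j]] dx by linarith
      have ty: "g (snd y) \<le> ?A - ?\<tau> + g ?m"
        unfolding g_def using link_dist_triangle[OF Y(2) m link_vertex[of j]] dy by linarith
      have gm: "0 \<le> g ?m" using g0 m by auto
      have "\<exists>a. cos (?\<tau> - a) = cos (g ?m) \<and> g (snd x) \<le> \<bar>a\<bar> \<and> \<bar>a\<bar> \<le> 3 / 2 * pi \<and>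
          g (snd y) \<le> \<bar>?A - a\<bar> \<and> \<bar>?A - a\<bar> \<le> 3 / 2 * pi"
      proof -
        consider "g (snd x) \<le> \<bar>g ?m - ?\<tau>\<bar>" | "g (snd y) \<le> \<bar>g ?m - (?A - ?\<tau>)\<bar>"
          using link_arc_branch[OF X(2) Y(2) \<tau>, of j] True unfolding g_def by blast
        then show ?thesis
        proof cases
          case 1
          (* The vertex is placed on the side of x. *)
          show ?thesis
            by (rule exI[of _ "?\<tau> - g ?m"]) (use 1 tx ty gm \<tau> A True pi_gt_zero in \<open>intro conjI, simp, linarith+\<close>)
        next
          case 2
          (* The vertex is placed on the side of y. *)
          show ?thesis
            by (rule exI[of _ "?\<tau> + g ?m"]) (use 2 tx ty gm \<tau> A True pi_gt_zero in \<open>intro conjI, simp, linarith+\<close>)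
        qed
      qed
      then obtain a where a: "cos (?\<tau> - a) = cos (g ?m)" "g (snd x) \<le> \<bar>a\<bar>" "\<bar>a\<bar> \<le> 3 / 2 * pi"
        "g (snd y) \<le> \<bar>?A - a\<bar>" "\<bar>?A - a\<bar> \<le> 3 / 2 * pi" by blast
      let ?cx = "trunc_cos (g (snd x))" and ?cy = "trunc_cos (g (snd y))"
      have c0: "0 \<le> ?cx" "0 \<le> ?cy" using trunc_cos_bounds g0 X Y by auto
      have "?\<rho> * trunc_cos (g ?m) = ?\<rho> * cos (?\<tau> - a)"
        using True a(1) by (simp add: min_def)
      also have "\<dots> = c * cos a + d * cos (?A - a)"
        by (rule norm_cos_Arg_diff)
      also have "\<dots> \<le> c * ?cx + d * ?cy"
        using c d a g0 X Y by (intro add_mono mult_left_mono cos_le_trunc_cos) auto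
      also have "\<dots> \<le> ((1 - t) * fst x) * ?cx + (t * fst y) * ?cy"
        using c d c0 by (intro add_mono mult_right_mono) auto
      also have "\<dots> = (1 - t) * (fst x * ?cx) + t * (fst y * ?cy)" by simp
      also have "\<dots> \<le> (1 - t) * l j + t * l j"
        using x y t unfolding g_def region_def by (intro add_mono mult_left_mono) auto
      also have "\<dots> = l j" by (simp add: algebra_simps)
      finally show ?thesis by (simp add: g_def)
    qed
  qed
  then show ?thesis using m by (simp add: region_def link_cone_def)
qed

context cone_pair
begin

text \<open>The path stays in the triangle or on the rays of \<open>x\<close> and \<open>y\<close>, except
  when it crosses over, and then its radius is at most 1, less than any arm length.\<close>

lemma cone_path_in_region:
  assumes xr: "x \<in> region l" and yr: "y \<in> region l" and t: "0 \<le> t" "t \<le> 1" and l: "\<And>k. 1 \<le> l k"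
  shows "cone_path x y s t \<in> region l"
proof -
  have l0: "0 \<le> l k" for k using l[of k] by simp
  have radial_x: "(r, link_arc (snd x) (snd y) 0) \<in> region l" if "0 \<le> r" "r \<le> fst x" for r
    using region_scale[OF xr that] by (simp add: link_arc_0 X Y)
  have radial_y: "(r, link_arc (snd x) (snd y) A) \<in> region l" if "0 \<le> r" "r \<le> fst y" for r
    using region_scale[OF yr that] by (simp add: link_arc_end X Y)
  consider "A \<le> pi - s / 2" "A < pi" | "s = 0" "pi \<le> A" | "0 < s" "pi - s / 2 < A"
    using s by fastforce
  then show ?thesis
  proof cases
    case 1
    then have "max 1 (A / (pi - s / 2)) = 1"
      using half_less_pi[OF s(2)] by (simp add: max_def)
    moreover have "B = A" using 1 by (simp add: width_def)
    ultimately have "cone_path x y s t = (cmod (sector A (in_coeff x y s t) (out_coeff x y s t)),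
        link_arc (snd x) (snd y) (Arg (sector A (in_coeff x y s t) (out_coeff x y s t))))"
      unfolding cone_path_def arc_param_def plane_path_def by simp
    then show ?thesis
      using region_triangle[OF xr yr 1(2) t coeff_bounds[OF t] l0] by simp
  next
    case 2
    then have B: "B = pi" by (simp add: width_def)
    define a where "a = (1 - t) * fst x - t * fst y"
    have za: "plane_path x y s t = of_real a"
      unfolding plane_path_def B using 2 by (simp add: sector_def in_coeff_def out_coeff_def a_def)
    have fxy: "(1 - t) * fst x \<le> fst x" "t * fst y \<le> fst y" "0 \<le> (1 - t) * fst x" "0 \<le> t * fst y"
      using t X Y by (auto intro: mult_left_le_one_le)
    show ?thesis
    proof (cases "a < 0")
      case True
      then have "arc_param x y s t = A"
        using 2 unfolding arc_param_def za by (simp add: max_def)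
      then show ?thesis unfolding cone_path_def za norm_of_real
        using True fxy by (simp only:) (rule radial_y, auto simp: a_def)
    next
      case False
      then have "arc_param x y s t = 0" unfolding arc_param_def za by simp
      then show ?thesis unfolding cone_path_def za norm_of_real
        using False fxy by (simp only:) (rule radial_x, auto simp: a_def)
    qed
  next
    case 3
    then have b: "blend A s = 1" by (intro blend_eq_1) auto
    have cf: "in_coeff x y s t = inward x y s t" "out_coeff x y s t = outward x y s t"
      by (auto simp: in_coeff_def out_coeff_def b)
    have z: "plane_path x y s t = sector B (inward x y s t) (outward x y s t)"
      by (simp add: plane_path_def cf)
    have bnd: "inward x y s t \<le> fst x" "outward x y s t \<le> fst y"
      using coeff_bounds[OF t] t X Y mult_left_le_one_le[of "fst x" "1 - t"] mult_left_le_one_le[of "fst y" t]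
      unfolding cf by auto
    consider "outward x y s t = 0" | "inward x y s t = 0" "0 < outward x y s t"
      | "0 < inward x y s t" "0 < outward x y s t"
      using inward_outward_nonneg[of t] by linarith
    then show ?thesis
    proof cases
      case 1
      then show ?thesis
        unfolding cone_path_def arc_param_def z
        using inward_outward_nonneg bnd by (simp add: Arg_sector_right norm_sector_right radial_x)
    next
      case 2
      then show ?thesis
        unfolding cone_path_def arc_param_def z
        using inward_outward_nonneg bnd B_bounds width_stretch[OF A_nonneg s]
        by (simp add: Arg_sector_left norm_sector_left radial_y)
    next
      case 3
      then have "fst (cone_path x y s t) \<le> e"
        using norm_sector_le[OF inward_outward_nonneg] inward_outward_eq unfolding cone_path_def z fst_conv by metis
      then have "fst (cone_path x y s t) \<le> 1" using e_bounds s by linarith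
      then show ?thesis
        using region_near_apex[of "fst (cone_path x y s t)" "snd (cone_path x y s t)" l]
          cone_path_in_cone[OF t] l by simp
    qed
  qed
qed

end

section \<open>Cartesian coordinates in the cone\<close>

lemma vertex_add3: "vertex (k + 3) = - vertex k"
proof -
  have "turn (real 3 * pi / 2) = -1"
    by (simp add: turn_def complex_eq_iff)
  then show ?thesis by (simp only: vertex_add) simp
qed

lemma vertex_eq_iff: "vertex j = vertex k \<longleftrightarrow> j mod 6 = k mod 6"
proof
  assume "vertex j = vertex k"
  then have "vertex (j mod 6) = vertex (k mod 6)" by (simp only: vertex_mod)
  moreover have "inj_on (\<lambda>k. cis (2 * pi * real k / real 6)) {..<6}"
    using Complex.bij_betw_roots_unity[of 6] by (simp add: bij_betw_def)
  moreover have "vertex k = cis (2 * pi * real k / real 6)" for k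
    by (simp add: vertex_def turn_def field_simps)
  ultimately show "j mod 6 = k mod 6" by (simp add: inj_on_def)
next
  assume "j mod 6 = k mod 6"
  then show "vertex j = vertex k" by (metis vertex_mod)
qed

lemma less_6_cases: "(k::nat) < 6 \<Longrightarrow> k = 0 \<or> k = 1 \<or> k = 2 \<or> k = 3 \<or> k = 4 \<or> k = 5"
  by linarith

lemma shift_mod_6:
  "(k + 1) mod 6 \<noteq> k mod (6 :: nat)" "(k + 3) mod 6 \<noteq> k mod (6 :: nat)" "(k + 5) mod 6 \<noteq> k mod (6 :: nat)"
  using less_6_cases[of "k mod 6"] unfolding mod_add_left_eq[of k, symmetric] by auto

lemma circ_dist_opposite: "norm v = 1 \<Longrightarrow> circ_dist (- v) v = 3 / 2 * pi"
proof -
  assume v: "norm v = 1"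
  then have "v \<noteq> 0" by auto
  then have "(v / - v) = -1" by simp
  moreover have "Arg (- 1) = pi" using Arg_of_real[of "-1"] by simp
  ultimately show ?thesis by (simp add: disp_def)
qed

lemma near_vertex:
  assumes w: "norm w = 1"
  obtains k \<psi> where "w = vertex k * turn \<psi>" "0 \<le> \<psi>" "\<psi> < pi / 2"
proof -
  \<comment> \<open>A full turn is added so that the index of the vertex is not negative.\<close>
  define \<alpha> where "\<alpha> = disp 1 w + 3 * pi"
  have \<alpha>: "0 \<le> \<alpha>" using circ_dist_le[of 1 w] pi_gt_zero unfolding \<alpha>_def by linarith
  define k where "k = nat \<lfloor>\<alpha> / (pi / 2)\<rfloor>"
  have k: "real k = of_int \<lfloor>\<alpha> / (pi / 2)\<rfloor>" using \<alpha> by (simp add: k_def)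
  then have "real k \<le> \<alpha> / (pi / 2)" "\<alpha> / (pi / 2) < real k + 1" by linarith+
  then have b: "0 \<le> \<alpha> - real k * pi / 2" "\<alpha> - real k * pi / 2 < pi / 2"
    using pi_gt_zero by (auto simp: field_simps)
  have "vertex k * turn (\<alpha> - real k * pi / 2) = turn \<alpha>"
    by (simp add: vertex_def turn_add[symmetric])
  also have "turn \<alpha> = turn (disp 1 w) * turn (3 * pi)" by (simp add: \<alpha>_def turn_add)
  also have "turn (3 * pi) = 1" by (simp add: turn_def complex_eq_iff)
  also have "turn (disp 1 w) * 1 = w" using turn_disp[of 1 w] w by simp
  finally show ?thesis using b that by metis
qed

text \<open>Seen from inside a rectangle, the two vertices that bound it are the ones less than a right
  angle away.\<close>

lemma vertex_dist_cell:
  assumes \<psi>: "0 \<le> \<psi>" "\<psi> < pi / 2" and near: "circ_dist (vertex k * turn \<psi>) (vertex j) < pi / 2"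
  shows "j mod 6 = k mod 6 \<and> circ_dist (vertex k * turn \<psi>) (vertex j) = \<psi> \<or>
    j mod 6 = (k + 1) mod 6 \<and> circ_dist (vertex k * turn \<psi>) (vertex j) = pi / 2 - \<psi>"
proof -
  define \<mu> where "\<mu> = disp (vertex k * turn \<psi>) (vertex j)"
  have "vertex j = vertex k * turn \<psi> * turn \<mu>"
    unfolding \<mu>_def by (subst turn_disp) (auto simp: norm_mult)
  then have V: "vertex j = vertex k * turn (\<psi> + \<mu>)" by (simp add: turn_add)
  have "vertex j ^ 6 = vertex k ^ 6 * turn (\<psi> + \<mu>) ^ 6" unfolding V power_mult_distrib ..
  then have "turn (\<psi> + \<mu>) ^ 6 = 1" by simp
  then obtain n where n: "\<psi> + \<mu> = of_int n * pi / 2" by (rule sixth_root_turn)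
  have \<mu>: "\<bar>\<mu>\<bar> < pi / 2" using near by (simp add: \<mu>_def)
  have "of_int n * (pi / 2) < 2 * (pi / 2)" "(-1) * (pi / 2) < of_int n * (pi / 2)"
    using n \<psi> \<mu> by (simp_all only: times_divide_eq_right[symmetric])
  then have "(of_int n :: real) < 2" "(-1 :: real) < of_int n"
    using pi_gt_zero by (metis half_gt_zero mult_less_cancel_right_pos)+
  then consider "n = 0" | "n = 1" by linarith
  then show ?thesis
  proof cases
    case 1
    then have "vertex j = vertex k" "\<mu> = - \<psi>" using V n by auto
    then show ?thesis using \<psi> by (simp add: vertex_eq_iff \<mu>_def)
  next
    case 2
    then have "vertex j = vertex (k + 1)" "\<mu> = pi / 2 - \<psi>" using V n vertex_add[of k 1] by auto
    then show ?thesis using \<psi> by (simp add: vertex_eq_iff \<mu>_def)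
  qed
qed

text \<open>A leg is an arm as it is used by one of the two points. Even indices belong to the first point,
  odd ones to the second, and \<open>k\<close> and \<open>k + 3\<close> are the same arm. The
  value is the distance from the essential vertex of the point in question, or 0 if it is not on
  this arm. The first case is that of the fin over \<open>vertex (k + 3)\<close>, where both
  points are on the arm.\<close>

definition leg :: "nat \<Rightarrow> cone_point \<Rightarrow> real" where
  "leg k p = fst p * (if fst (snd p) = - vertex k then sin (snd (snd p))
     else trunc_cos (vertex_dist (snd p) k))"

text \<open>The three branches of the link at \<open>vertex k\<close>: the arcs to the two neighbouring
  vertices, and the fin. They are numbered such that the other point moves along leg \<open>k +
  b\<close>.\<close>

definition star_point :: "nat \<Rightarrow> nat \<Rightarrow> real \<Rightarrow> link_point" where
  "star_point k b \<psi> = (if b = 3 then (vertex k, \<psi>) else (vertex k * turn (if b = 1 then \<psi> else - \<psi>), 0))"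

lemma star_point_in_link:
  assumes "0 \<le> \<psi>" "b = 3 \<Longrightarrow> \<psi> \<le> pi / 4"
  shows "star_point k b \<psi> \<in> link"
  using assms by (auto simp: star_point_def norm_mult intro!: link_I)

lemma star_form:
  assumes q: "q \<in> link" and near: "vertex_dist q k < pi / 2"
  obtains b \<psi> where "b \<in> {1, 3, 5}" "q = star_point k b \<psi>" "0 \<le> \<psi>" "\<psi> < pi / 2" "b = 3 \<longrightarrow> \<psi> = snd q"
proof -
  note Q = link_D[OF q]
  have ld: "circ_dist (fst q) (vertex k) + snd q < pi / 2"
    using near link_dist_vertex[OF q] by simp
  show ?thesis
  proof (cases "snd q = 0")
    case False
    then have "fst q = vertex k"
      using circ_dist_sixth_roots[of "fst q" "vertex k"] Q ld by force
    then have "q = star_point k 3 (snd q)" by (simp add: star_point_def prod_eq_iff)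
    then show ?thesis using that[of 3 "snd q"] Q ld by auto
  next
    case True
    define \<mu> where "\<mu> = disp (vertex k) (fst q)"
    have w: "fst q = vertex k * turn \<mu>" unfolding \<mu>_def using turn_disp Q by simp
    have \<mu>: "\<bar>\<mu>\<bar> < pi / 2"
      using ld circ_dist_commute[of "fst q" "vertex k"] Q True by (simp add: \<mu>_def)
    show ?thesis
    proof (cases "0 \<le> \<mu>")
      case True
      then show ?thesis using that[of 1 \<mu>] w \<open>snd q = 0\<close> \<mu> by (simp add: star_point_def prod_eq_iff)
    next
      case False
      then show ?thesis using that[of 5 "- \<mu>"] w \<open>snd q = 0\<close> \<mu> by (simp add: star_point_def prod_eq_iff)
    qed
  qed
qed

lemma star_form_ex:
  assumes q: "q \<in> link"
  obtains k b \<psi> where "b \<in> {1, 3, 5}" "q = star_point k b \<psi>" "0 \<le> \<psi>" "\<psi> < pi / 2" "b = 3 \<longrightarrow> \<psi> = snd q"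
proof -
  note Q = link_D[OF q]
  show ?thesis
  proof (cases "snd q = 0")
    case True
    obtain k \<psi> where "fst q = vertex k * turn \<psi>" "0 \<le> \<psi>" "\<psi> < pi / 2"
      using near_vertex[OF Q(1)] by blast
    then show ?thesis using that[of 1 k \<psi>] True by (simp add: star_point_def prod_eq_iff)
  next
    case False
    then obtain k where "fst q = vertex k" using sixth_root_vertex Q by blast
    then have "q = star_point k 3 (snd q)" by (simp add: star_point_def prod_eq_iff)
    moreover have "snd q < pi / 2" using Q pi_gt_zero by linarith
    ultimately show ?thesis using that[of 3 k "snd q"] Q by auto
  qed
qed

lemma leg_cell:
  assumes \<psi>: "0 \<le> \<psi>" "\<psi> < pi / 2"
  shows "leg j (r, vertex k * turn \<psi>, 0) = r * (if j mod 6 = k mod 6 then cos \<psi> else if j mod 6 = (k + 1) mod 6 then sin \<psi> else 0)"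
proof -
  let ?w = "vertex k * turn \<psi>"
  have n: "norm ?w = 1" by (simp add: norm_mult)
  have l: "(?w, 0) \<in> link" using n by (auto intro: link_I)
  have neq: "k mod 6 \<noteq> (k + 1) mod 6" by (rule not_sym[OF shift_mod_6(1)])
  have L: "vertex_dist (?w, 0) j = circ_dist ?w (vertex j)"
    using link_dist_vertex[OF l] by simp
  show ?thesis
  proof (cases "circ_dist ?w (vertex j) < pi / 2")
    case True
    have "?w \<noteq> - vertex j"
      using True circ_dist_opposite[OF norm_vertex[of j]] pi_gt_zero by (intro notI) simp
    then have leg: "leg j (r, ?w, 0) = r * cos (circ_dist ?w (vertex j))"
      using True unfolding leg_def fst_conv snd_conv L by (simp add: min_def del: cos_abs_real)
    from vertex_dist_cell[OF \<psi> True] show ?thesis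
      using neq unfolding leg by (elim disjE) (auto simp: cos_diff simp del: cos_abs_real)
  next
    case False
    have "leg j (r, ?w, 0) = 0"
      using False unfolding leg_def fst_conv snd_conv L by (auto simp: min_def)
    moreover have "j mod 6 \<noteq> k mod 6"
    proof
      assume "j mod 6 = k mod 6"
      then have "vertex j = vertex k" by (simp add: vertex_eq_iff)
      then show False using False circ_dist_turn[of "vertex k" \<psi>] circ_dist_commute[OF n norm_vertex] \<psi> by simp
    qed
    moreover have "\<psi> = 0" if "j mod 6 = (k + 1) mod 6"
    proof -
      have "vertex j = vertex (k + 1)" using that by (simp only: vertex_eq_iff)
      also have "vertex (k + 1) = ?w * turn (pi / 2 - \<psi>)"
        unfolding vertex_add by (simp add: turn_add[symmetric])
      finally have "circ_dist ?w (vertex j) = pi / 2 - \<psi>"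
        using circ_dist_turn[OF n, of "pi / 2 - \<psi>"] \<psi> by simp
      then show ?thesis using False \<psi> by simp
    qed
    ultimately show ?thesis by auto
  qed
qed

lemma leg_star:
  assumes b: "b \<in> {1, 3, 5}" and \<psi>: "0 \<le> \<psi>" "\<psi> < pi / 2"
  shows "leg j (r, star_point k b \<psi>) = r * (if j mod 6 = k mod 6 then cos \<psi> else if j mod 6 = (k + b) mod 6 then sin \<psi> else 0)"
proof -
  consider "b = 1" | "b = 3" | "b = 5" "\<psi> = 0" | "b = 5" "0 < \<psi>" using b \<psi> by fastforce
  then show ?thesis
  proof cases
    case 1
    then show ?thesis using leg_cell[OF \<psi>, of j r k] by (simp add: star_point_def)
  next
    case 2
    have opp: "vertex k = - vertex j \<longleftrightarrow> j mod 6 = (k + 3) mod 6"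
      unfolding vertex_eq_iff[symmetric] vertex_add3 by (auto simp: minus_equation_iff)
    have neq: "k mod 6 \<noteq> (k + 3) mod 6" by (rule not_sym[OF shift_mod_6(2)])
    have ld: "vertex_dist (vertex k, \<psi>) j = circ_dist (vertex k) (vertex j) + \<psi>"
      using \<psi> by (simp add: link_dist_def)
    show ?thesis
    proof (cases "j mod 6 = k mod 6")
      case True
      then have "vertex j = vertex k" by (simp only: vertex_eq_iff)
      moreover have "vertex_dist (vertex k, \<psi>) k = \<psi>" using \<psi> by (simp add: link_dist_def)
      ultimately show ?thesis using True 2 neq opp \<psi> by (simp add: leg_def star_point_def min_def)
    next
      case False
      then have "circ_dist (vertex k) (vertex j) \<ge> pi / 2"
        using circ_dist_sixth_roots[of "vertex k" "vertex j"] vertex_eq_iff[of k j] by auto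
      then have "min (pi / 2) (vertex_dist (vertex k, \<psi>) j) = pi / 2"
        using \<psi> by (simp add: ld)
      then show ?thesis using False 2 opp by (simp add: leg_def star_point_def)
    qed
  next
    case 3
    then show ?thesis using leg_cell[of 0 j r k] pi_gt_zero by (simp add: star_point_def)
  next
    case 4
    have "vertex (k + 5 + 1) = vertex (k + 5) * turn (pi / 2)"
      using vertex_add[of "k + 5" 1] by simp
    moreover have "k + 5 + 1 = k + 6" by simp
    ultimately have "vertex k = vertex (k + 5) * turn (pi / 2)"
      using vertex_6[of k] by metis
    then have w: "vertex k * turn (- \<psi>) = vertex (k + 5) * turn (pi / 2 - \<psi>)"
      by (simp add: turn_add[symmetric])
    have m: "(k + 5 + 1) mod 6 = k mod 6" by simp
    have neq: "k mod 6 \<noteq> (k + 5) mod 6" by (rule not_sym[OF shift_mod_6(3)])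
    show ?thesis
      using 4 leg_cell[of "pi / 2 - \<psi>" j r "k + 5"] \<psi> neq unfolding m
      by (simp add: star_point_def w cos_diff sin_diff)
  qed
qed

text \<open>The even residue modulo 6 that is \<open>i\<close> modulo 3.\<close>

definition even_leg :: "3 \<Rightarrow> nat" where
  "even_leg i = (if i = 0 then 0 else if i = 1 then 4 else 2)"

type_synonym config = "(real ^ 3) \<times> (real ^ 3)"

definition cart :: "cone_point \<Rightarrow> config" where
  "cart p = (\<chi> i. leg (even_leg i) p, \<chi> i. leg (even_leg i + 3) p)"

definition coord :: "nat \<Rightarrow> config \<Rightarrow> real" where
  "coord k f = (if even k then fst f else snd f) $ of_nat k"

lemma of_nat_3_mod6: "(of_nat k :: 3) = of_nat (k mod 6)"
proof -
  have "(of_nat k :: 3) = of_nat (k mod 6 + 6 * (k div 6))" by simp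
  also have "\<dots> = of_nat (k mod 6) + 6 * of_nat (k div 6)" by (simp only: of_nat_add of_nat_mult of_nat_numeral)
  also have "(6 :: 3) = 0" by simp
  finally show ?thesis by simp
qed

lemma even_mod6: "even k \<longleftrightarrow> even (k mod 6 :: nat)"
  by presburger

lemma vertex_even_leg:
  assumes "even k" shows "vertex (even_leg (of_nat k)) = vertex k"
proof -
  have "k mod 6 = 0 \<or> k mod 6 = 1 \<or> k mod 6 = 2 \<or> k mod 6 = 3 \<or> k mod 6 = 4 \<or> k mod 6 = 5"
    by (intro less_6_cases) simp
  then have "even_leg (of_nat k) mod 6 = k mod 6"
    using assms unfolding of_nat_3_mod6[of k] even_mod6[of k] by (auto simp: even_leg_def)
  then show ?thesis by (simp add: vertex_eq_iff)
qed

lemma vertex_odd_leg: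
  assumes "odd k" shows "vertex (even_leg (of_nat k) + 3) = vertex k"
  using vertex_even_leg[of "k + 3"] assms vertex_6[of k] of_nat_3_mod6[of k]
proof -
  have "(of_nat (k + 3) :: 3) = of_nat k" by simp
  then have "vertex (even_leg (of_nat k)) = vertex (k + 3)"
    using vertex_even_leg[of "k + 3"] assms by (metis even_add odd_numeral)
  then show ?thesis unfolding vertex_add3 by simp
qed

lemma leg_cong: "vertex j = vertex k \<Longrightarrow> leg j p = leg k p"
  by (simp add: leg_def)

lemma coord_cart: "coord k (cart p) = leg k p"
  using vertex_even_leg[of k] vertex_odd_leg[of k] by (auto simp: coord_def cart_def intro: leg_cong)

text \<open>As \<open>b\<close> is odd, the legs \<open>k\<close> and \<open>k + b\<close> belong to
  different points, so that \<open>s\<close> and \<open>t\<close> are independent coordinates.\<close>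

definition chart :: "nat \<Rightarrow> nat \<Rightarrow> real \<Rightarrow> real \<Rightarrow> config" where
  "chart k b s t = (if even k then (axis (of_nat k) s, axis (of_nat (k + b)) t)
     else (axis (of_nat (k + b)) t, axis (of_nat k) s))"

lemma chart_mod: "chart (k mod 6) b s t = chart k b s t"
proof -
  have "(of_nat (k mod 6 + b) :: 3) = of_nat (k + b)"
    unfolding of_nat_add of_nat_3_mod6[of k, symmetric] ..
  then show ?thesis
    unfolding chart_def even_mod6[of k, symmetric] of_nat_3_mod6[of k, symmetric] by simp
qed

lemma chart_legs:
  assumes k: "k < 6" and b: "b \<in> {1, 3, 5}"
  shows "fst (chart k b s t) $ i = (if even_leg i mod 6 = k then s else if even_leg i mod 6 = (k + b) mod 6 then t else 0)"
    "snd (chart k b s t) $ i = (if (even_leg i + 3) mod 6 = k then s else if (even_leg i + 3) mod 6 = (k + b) mod 6 then t else 0)"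
proof -
  have arm: "of_nat (k + b) = (of_nat ((k + b) mod 6) :: 3)" by (rule of_nat_3_mod6)
  have i: "i = 0 \<or> i = 1 \<or> i = 2" using exhaust_3[of i] by auto
  show "fst (chart k b s t) $ i = (if even_leg i mod 6 = k then s else if even_leg i mod 6 = (k + b) mod 6 then t else 0)"
    unfolding chart_def arm using less_6_cases[OF k] b i
    by (elim disjE insertE emptyE; simp add: even_leg_def axis_def)
  show "snd (chart k b s t) $ i = (if (even_leg i + 3) mod 6 = k then s else if (even_leg i + 3) mod 6 = (k + b) mod 6 then t else 0)"
    unfolding chart_def arm using less_6_cases[OF k] b i
    by (elim disjE insertE emptyE; simp add: even_leg_def axis_def)
qed

lemma cart_star:
  assumes b: "b \<in> {1, 3, 5}" and \<psi>: "0 \<le> \<psi>" "\<psi> < pi / 2"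
  shows "cart (r, star_point k b \<psi>) = chart k b (r * cos \<psi>) (r * sin \<psi>)"
proof -
  have sp: "star_point (k mod 6) b \<psi> = star_point k b \<psi>"
    by (simp add: star_point_def vertex_mod)
  have "cart (r, star_point (k mod 6) b \<psi>) = chart (k mod 6) b (r * cos \<psi>) (r * sin \<psi>)"
    unfolding cart_def by (intro prod_eqI vec_eq_iff[THEN iffD2] allI)
      (simp_all only: fst_conv snd_conv vec_lambda_beta leg_star[OF b \<psi>] mod_mod_trivial
        chart_legs[OF mod_less_divisor b] if_distrib mult_zero_right, auto)
  then show ?thesis by (simp only: sp chart_mod)
qed

section \<open>The configuration space as a part of the cone\<close>

lemma mspace_config:
  "mspace (config2 (Y_graph L)) =
    {(axis i s, axis j t) | i j s t. 0 \<le> s \<and> s \<le> L i \<and> 0 \<le> t \<and> t \<le> L j \<and> axis i s \<noteq> (axis j t :: real ^ 3)}"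
  by (auto simp: config2_def mspace_Y_graph)

lemma config_I:
  "\<lbrakk>0 \<le> s; s \<le> L i; 0 \<le> t; t \<le> L j; axis i s \<noteq> (axis j t :: real ^ 3)\<rbrakk>
    \<Longrightarrow> (axis i s, axis j t) \<in> mspace (config2 (Y_graph L))"
  unfolding mspace_config by blast

lemma mdist_config:
  "mdist (config2 (Y_graph L)) (a, a') (b, b') = sqrt ((mdist (Y_graph L) a b)\<^sup>2 + (mdist (Y_graph L) a' b')\<^sup>2)"
  by (simp add: config2_def prod_dist_def)

lemma arms_distinct:
  assumes "b \<in> {1, 3, 5::nat}" "b' \<in> {1, 3, 5}"
  shows "(of_nat (k + b) :: 3) = of_nat (k + b') \<longleftrightarrow> b = b'"
  using assms by auto

lemma mdist_chart:
  assumes b: "b \<in> {1, 3, 5}" "b' \<in> {1, 3, 5}" and nn: "0 \<le> s" "0 \<le> t" "0 \<le> s'" "0 \<le> t'"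
  shows "mdist (config2 (Y_graph L)) (chart k b s t) (chart k b' s' t') =
    sqrt ((s - s')\<^sup>2 + (if b = b' then t - t' else t + t')\<^sup>2)"
  using arms_distinct[OF b, of k] nn
  by (simp add: chart_def mdist_config mdist_Y_graph add.commute del: of_nat_add)

lemma link_dist_star:
  assumes b: "b \<in> {1, 3, 5}" "b' \<in> {1, 3, 5}" and \<psi>: "0 \<le> \<psi>" "\<psi> < pi / 2" "0 \<le> \<psi>'" "\<psi>' < pi / 2"
  shows "link_dist (star_point k b \<psi>) (star_point k b' \<psi>') = (if b = b' then \<bar>\<psi> - \<psi>'\<bar> else \<psi> + \<psi>')"
proof -
  have c: "circ_dist (vertex k * turn x) (vertex k * turn y) = \<bar>y - x\<bar>"
    if "\<bar>x\<bar> < pi / 2" "\<bar>y\<bar> < pi / 2" for x y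
  proof -
    have eq: "vertex k * turn y = (vertex k * turn x) * turn (y - x)"
      by (simp add: turn_add[symmetric])
    have "circ_dist (vertex k * turn x) ((vertex k * turn x) * turn (y - x)) = \<bar>y - x\<bar>"
      using that pi_gt_zero by (intro circ_dist_turn) (simp add: norm_mult, linarith)
    then show ?thesis by (subst eq)
  qed
  have e: "vertex k * turn x = vertex k * turn y \<longleftrightarrow> x = y" if "\<bar>x\<bar> < pi / 2" "\<bar>y\<bar> < pi / 2" for x y
  proof -
    have "disp (vertex k * turn x) (vertex k * turn y) = 0 \<longleftrightarrow> vertex k * turn x = vertex k * turn y"
      by (rule circ_dist_0_iff) (simp_all add: norm_mult)
    then show ?thesis using c[OF that] by (smt (verit))
  qed
  have e0: "vertex k * turn x = vertex k \<longleftrightarrow> x = 0" "vertex k = vertex k * turn x \<longleftrightarrow> x = 0"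
    and c0: "circ_dist (vertex k * turn x) (vertex k) = \<bar>x\<bar>" "circ_dist (vertex k) (vertex k * turn x) = \<bar>x\<bar>"
    if "\<bar>x\<bar> < pi / 2" for x
    using c[of 0 x] c[of x 0] e[of 0 x] e[of x 0] that pi_gt_zero by (simp_all only: turn_0 mult_1_right) auto
  have te: "turn x = turn y \<longleftrightarrow> x = y" if "\<bar>x\<bar> < pi / 2" "\<bar>y\<bar> < pi / 2" for x y
    using e[OF that] by auto
  have vnz: "vertex k \<noteq> 0" using norm_vertex[of k] by (metis norm_zero zero_neq_one)
  show ?thesis
    using b \<psi> by (elim insertE emptyE) (simp_all add: star_point_def link_dist_def c e e0 c0 te vnz abs_minus_commute del: mult_cancel_left mult_cancel_left1 mult_cancel_left2)
qed

text \<open>Any two of the three branches unfold to a part of the plane in which the segment of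
  \<open>vertex k\<close> is an axis. On different arms the distances from the essential vertex
  add up, just as coordinates of opposite sign do on different sides of the axis.\<close>

lemma cone_dist_star_points:
  assumes b: "b \<in> {1, 3, 5}" "b' \<in> {1, 3, 5}" and \<psi>: "0 \<le> \<psi>" "\<psi> < pi / 2" "0 \<le> \<psi>'" "\<psi>' < pi / 2"
    and r: "0 \<le> r" "0 \<le> r'"
  shows "cone_dist (r, star_point k b \<psi>) (r', star_point k b' \<psi>') =
    mdist (config2 (Y_graph L)) (cart (r, star_point k b \<psi>)) (cart (r', star_point k b' \<psi>'))"
proof -
  have nn: "0 \<le> r * cos \<psi>" "0 \<le> r * sin \<psi>" "0 \<le> r' * cos \<psi>'" "0 \<le> r' * sin \<psi>'"
    using \<psi> r by (auto intro!: mult_nonneg_nonneg cos_ge_zero sin_ge_zero)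
  define u where "u = (if b = b' then \<psi> - \<psi>' else \<psi> + \<psi>')"
  have "min pi (link_dist (star_point k b \<psi>) (star_point k b' \<psi>')) = \<bar>u\<bar>"
    unfolding link_dist_star[OF b \<psi>] u_def using \<psi> by auto
  then have "(cone_dist (r, star_point k b \<psi>) (r', star_point k b' \<psi>'))\<^sup>2 = r\<^sup>2 + r'\<^sup>2 - 2 * r * r' * cos u"
    unfolding cone_dist_squared by simp
  also have "\<dots> = r\<^sup>2 * ((sin \<psi>)\<^sup>2 + (cos \<psi>)\<^sup>2) + r'\<^sup>2 * ((sin \<psi>')\<^sup>2 + (cos \<psi>')\<^sup>2) - 2 * r * r' * cos u"
    by (simp only: sin_cos_squared_add mult_1_right)
  also have "\<dots> = (r * cos \<psi> - r' * cos \<psi>')\<^sup>2 + (if b = b' then r * sin \<psi> - r' * sin \<psi>' else r * sin \<psi> + r' * sin \<psi>')\<^sup>2"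
    unfolding u_def power2_eq_square by (cases "b = b'") (simp_all only: simp_thms if_True if_False cos_diff cos_add mult_2 algebra_simps)
  finally have "cone_dist (r, star_point k b \<psi>) (r', star_point k b' \<psi>') =
    sqrt ((r * cos \<psi> - r' * cos \<psi>')\<^sup>2 + (if b = b' then r * sin \<psi> - r' * sin \<psi>' else r * sin \<psi> + r' * sin \<psi>')\<^sup>2)"
    by (metis cone_dist_nonneg real_sqrt_abs abs_of_nonneg)
  then show ?thesis
    unfolding cart_star[OF b(1) \<psi>(1,2)] cart_star[OF b(2) \<psi>(3,4)] mdist_chart[OF b nn] .
qed

abbreviation arm_length :: "(3 \<Rightarrow> real) \<Rightarrow> nat \<Rightarrow> real" where
  "arm_length L \<equiv> \<lambda>k. L (of_nat k)"

text \<open>At radius 0 both points would be at the essential vertex, and at height \<open>pi / 4\<close>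
  they would be equal.\<close>

definition config_cone :: "(3 \<Rightarrow> real) \<Rightarrow> cone_point set" where
  "config_cone L = {p \<in> region (arm_length L). 0 < fst p \<and> snd (snd p) < pi / 4}"

lemma config_cone_D:
  assumes "p \<in> config_cone L"
  shows "p \<in> link_cone" "p \<in> region (arm_length L)" "0 < fst p" "snd (snd p) < pi / 4" "snd p \<in> link"
    "0 \<le> snd (snd p)" "norm (fst (snd p)) = 1"
proof -
  show 1: "p \<in> link_cone" "p \<in> region (arm_length L)" "0 < fst p" "snd (snd p) < pi / 4"
    using assms by (auto simp: config_cone_def region_def)
  then show 2: "snd p \<in> link" by (auto dest: link_cone_D)
  then show "0 \<le> snd (snd p)" "norm (fst (snd p)) = 1" by (auto dest: link_D)
qed

lemma sin_le_cos: "0 \<le> b \<Longrightarrow> b \<le> pi / 4 \<Longrightarrow> sin b \<le> cos b"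
  using sin_monotone_2pi_le[of b "pi / 2 - b"] pi_gt_zero by (simp add: sin_cos_eq)

lemma sin_less_cos: "0 \<le> b \<Longrightarrow> b < pi / 4 \<Longrightarrow> sin b < cos b"
  using sin_monotone_2pi[of b "pi / 2 - b"] pi_gt_zero by (simp add: sin_cos_eq)

lemma add_3_mod_3: "(x :: 3) + 3 = x"
  by simp

lemma leg_opposite:
  assumes "fst (snd p) = - vertex k" "snd p \<in> link"
  shows "leg k p = fst p * sin (snd (snd p))" "leg (k + 3) p = fst p * cos (snd (snd p))"
    "vertex_dist (snd p) (k + 3) = snd (snd p)"
proof -
  have V: "fst (snd p) = vertex (k + 3)" using assms by (simp add: vertex_add3)
  have b: "0 \<le> snd (snd p)" "snd (snd p) \<le> pi / 4" using link_D[OF assms(2)] by auto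
  show ld: "vertex_dist (snd p) (k + 3) = snd (snd p)"
    using V b by (simp add: link_dist_def)
  show "leg k p = fst p * sin (snd (snd p))" using assms by (simp add: leg_def)
  have "vertex (k + 3) \<noteq> - vertex (k + 3)"
    unfolding vertex_add3[symmetric] vertex_eq_iff using shift_mod_6(2)[of "k + 3"] by (rule not_sym)
  moreover have "min (pi / 2) (snd (snd p)) = snd (snd p)" using b by simp
  ultimately show "leg (k + 3) p = fst p * cos (snd (snd p))"
    unfolding leg_def ld V by simp
qed

lemma leg_nonneg:
  assumes "p \<in> link_cone" shows "0 \<le> leg k p"
proof -
  note P = link_cone_D[OF assms] and Q = link_D[OF link_cone_D(2)[OF assms]]
  have "0 \<le> sin (snd (snd p))" using Q pi_gt_zero by (intro sin_ge_zero) linarith+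
  then show ?thesis
    unfolding leg_def using P trunc_cos_bounds(1)[OF link_dist_nonneg[OF P(2) link_vertex]] by auto
qed

lemma leg_le_arm:
  assumes p: "p \<in> region (arm_length L)"
  shows "leg k p \<le> L (of_nat k)"
proof -
  have pc: "p \<in> link_cone" using p by (simp add: region_def)
  note P = link_cone_D[OF pc] and Q = link_D[OF link_cone_D(2)[OF pc]]
  show ?thesis
  proof (cases "fst (snd p) = - vertex k")
    case True
    note o = leg_opposite[OF True P(2)]
    have "leg k p \<le> fst p * cos (snd (snd p))"
      unfolding o using P Q sin_le_cos by (intro mult_left_mono) auto
    also have "\<dots> = fst p * trunc_cos (vertex_dist (snd p) (k + 3))"
    proof -
      have "min (pi / 2) (snd (snd p)) = snd (snd p)" using Q pi_gt_zero by linarith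
      then show ?thesis by (simp only: o)
    qed
    also have "\<dots> \<le> arm_length L (k + 3)" using p unfolding region_def by blast
    finally show ?thesis by (simp add: add_3_mod_3)
  next
    case False
    then show ?thesis using p by (simp add: leg_def region_def)
  qed
qed

lemma star_of_leg:
  assumes p: "p \<in> link_cone" and gt: "leg (k + 3) p < leg k p"
  shows "vertex_dist (snd p) k < pi / 2"
proof (cases "fst (snd p) = - vertex k")
  case True
  have "fst p * sin (snd (snd p)) \<le> fst p * cos (snd (snd p))"
    using link_cone_D[OF p] link_D[OF link_cone_D(2)[OF p]] by (intro mult_left_mono sin_le_cos) auto
  then show ?thesis using gt leg_opposite[OF True link_cone_D(2)[OF p]] by simp
next
  case False
  have "0 < leg k p" using leg_nonneg[OF p, of "k + 3"] gt by linarith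
  then show ?thesis using False by (auto simp: leg_def min_def split: if_splits)
qed

text \<open>The stars around the six vertices cover the space, so this local statement is enough to compare
  lengths of paths.\<close>

lemma star_isometry:
  assumes p: "p \<in> config_cone L" and q: "q \<in> config_cone L"
    and near: "vertex_dist (snd p) k < pi / 2" "vertex_dist (snd q) k < pi / 2"
  shows "cone_dist p q = mdist (config2 (Y_graph L)) (cart p) (cart q)"
proof -
  note P = config_cone_D[OF p] and Q = config_cone_D[OF q]
  obtain b \<psi> where b: "b \<in> {1, 3, 5}" "snd p = star_point k b \<psi>" "0 \<le> \<psi>" "\<psi> < pi / 2"
    by (rule star_form[OF P(5) near(1)])
  obtain b' \<psi>' where b': "b' \<in> {1, 3, 5}" "snd q = star_point k b' \<psi>'" "0 \<le> \<psi>'" "\<psi>' < pi / 2"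
    by (rule star_form[OF Q(5) near(2)])
  have "p = (fst p, star_point k b \<psi>)" "q = (fst q, star_point k b' \<psi>')"
    using b b' by (auto simp: prod_eq_iff)
  then show ?thesis
    using cone_dist_star_points[OF b(1) b'(1) b(3,4) b'(3,4), of "fst p" "fst q" k L] P Q by (metis less_imp_le)
qed

lemma config_chart:
  assumes f: "f \<in> mspace (config2 (Y_graph L))" and gt: "coord (k + 3) f < coord k f"
  obtains b s t where "b \<in> {1, 3, 5}" "f = chart k b s t" "0 < s" "0 \<le> t" "b = 3 \<Longrightarrow> t < s"
    "s \<le> L (of_nat k)" "t \<le> L (of_nat (k + b))"
proof -
  obtain i j u v where f_eq: "f = (axis i u, axis j v)" and b: "0 \<le> u" "u \<le> L i" "0 \<le> v" "v \<le> L j"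
    using f by (auto simp: mspace_config)
  have arm3: "(of_nat (k + 3) :: 3) = of_nat k" by simp
  have arms: "\<exists>b\<in>{1, 3, 5}. (m :: 3) = of_nat (k + b)" for m
  proof -
    have "m - of_nat k = 1 \<or> m - of_nat k = 2 \<or> m - of_nat k = 3" by (rule exhaust_3)
    then have "m = of_nat k + of_nat 1 \<or> m = of_nat k + of_nat 5 \<or> m = of_nat k + of_nat 3"
      by (auto simp: algebra_simps)
    then show ?thesis by (auto simp only: of_nat_add[symmetric])
  qed
  show ?thesis
  proof (cases "even k")
    case True
    then have g: "axis j v $ of_nat k < axis i u $ of_nat k"
      using gt by (simp add: coord_def f_eq add_3_mod_3)
    then have i: "i = of_nat k" "0 < u" using b by (auto simp: axis_def split: if_splits)
    obtain b' where b': "b' \<in> {1, 3, 5}" "j = of_nat (k + b')" using arms by blast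
    show ?thesis
    proof (rule that[of b' u v])
      show "f = chart k b' u v" using True f_eq i b' by (simp add: chart_def)
      show "v < u" if "b' = 3" using g i b' that by (simp add: axis_def add_3_mod_3)
    qed (use b b' i in auto)
  next
    case False
    then have g: "axis i u $ of_nat k < axis j v $ of_nat k"
      using gt by (simp add: coord_def f_eq add_3_mod_3)
    then have j: "j = of_nat k" "0 < v" using b by (auto simp: axis_def split: if_splits)
    obtain b' where b': "b' \<in> {1, 3, 5}" "i = of_nat (k + b')" using arms by blast
    show ?thesis
    proof (rule that[of b' v u])
      show "f = chart k b' v u" using False f_eq j b' by (simp add: chart_def)
      show "u < v" if "b' = 3" using g j b' that by (simp add: axis_def add_3_mod_3)
    qed (use b b' j in auto)
  qed
qed

text \<open>Two different points differ in the distance along some arm, and the farther one determines the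
  leg.\<close>

lemma config_star_ex:
  assumes f: "f \<in> mspace (config2 (Y_graph L))"
  shows "\<exists>k<6. coord (k + 3) f < coord k f"
proof -
  have "fst f \<noteq> snd f" using f by (auto simp: mspace_config)
  then obtain i where i: "fst f $ i \<noteq> snd f $ i" by (auto simp: vec_eq_iff)
  have arm3: "(of_nat (m + 3) :: 3) = of_nat m" for m by simp
  have e: "(of_nat (even_leg i) :: 3) = i" "even (even_leg i)" "even_leg i < 6"
    using exhaust_3[of i] by (auto simp: even_leg_def)
  define k where "k = (if snd f $ i < fst f $ i then even_leg i else (even_leg i + 3) mod 6)"
  have "coord (k + 3) f < coord k f"
  proof (cases "snd f $ i < fst f $ i")
    case True
    then show ?thesis using e by (simp add: k_def coord_def add_3_mod_3)
  next
    case False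
    have "(of_nat k :: 3) = of_nat (even_leg i + 3)"
      unfolding k_def using False of_nat_3_mod6[of "even_leg i + 3"] by simp
    then have "(of_nat k :: 3) = i" using arm3[of "even_leg i"] e by simp
    moreover have "odd k" using False e even_mod6[of "even_leg i + 3"] by (simp add: k_def)
    ultimately show ?thesis using False i by (simp add: coord_def add_3_mod_3)
  qed
  moreover have "k < 6" using e by (simp add: k_def)
  ultimately show ?thesis by blast
qed

lemma polar_form:
  assumes "0 < s" "0 \<le> t"
  obtains r \<psi> where "0 < r" "0 \<le> \<psi>" "\<psi> < pi / 2" "s = r * cos \<psi>" "t = r * sin \<psi>" "t < s \<Longrightarrow> \<psi> < pi / 4"
proof -
  define \<psi> where "\<psi> = arctan (t / s)"
  have \<psi>: "0 \<le> \<psi>" "\<psi> < pi / 2" using assms arctan_ubound[of "t / s"] by (auto simp: \<psi>_def)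
  have c: "0 < cos \<psi>" using \<psi> by (intro cos_gt_zero_pi) auto
  have "tan \<psi> = t / s" using arctan[of "t / s"] by (simp add: \<psi>_def)
  then have "sin \<psi> * s = t * cos \<psi>" using c assms by (simp add: tan_def field_simps)
  moreover have "\<psi> < pi / 4" if "t < s"
    using that assms arctan_less_iff[of "t / s" 1] by (simp add: \<psi>_def arctan_one)
  ultimately show ?thesis
    using that[of "s / cos \<psi>" \<psi>] c assms \<psi> by (simp add: field_simps)
qed

lemma cart_surj:
  assumes f: "f \<in> mspace (config2 (Y_graph L))" and gt: "coord (k + 3) f < coord k f" and L: "\<And>i. 0 \<le> L i"
  shows "\<exists>p\<in>config_cone L. cart p = f"
proof -
  obtain b s t where b: "b \<in> {1, 3, 5}" and f_eq: "f = chart k b s t" and st: "0 < s" "0 \<le> t" "b = 3 \<Longrightarrow> t < s"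
    "s \<le> L (of_nat k)" "t \<le> L (of_nat (k + b))"
    using config_chart[OF f gt] by blast
  obtain r \<psi> where r: "0 < r" and \<psi>: "0 \<le> \<psi>" "\<psi> < pi / 2" and s: "s = r * cos \<psi>" and t: "t = r * sin \<psi>"
    and less: "t < s \<Longrightarrow> \<psi> < pi / 4"
    using polar_form[OF st(1,2)] by blast
  define p where "p = (r, star_point k b \<psi>)"
  have q: "star_point k b \<psi> \<in> link" using \<psi> st less by (intro star_point_in_link) auto
  have pc: "p \<in> link_cone" using q r by (simp add: p_def link_cone_def)
  have "fst p * trunc_cos (vertex_dist (snd p) j) \<le> L (of_nat j)" for j
  proof (cases "fst (snd p) = - vertex j")
    case True
    have "circ_dist (fst (snd p)) (vertex j) = 3 / 2 * pi"
      unfolding True by (simp add: circ_dist_opposite)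
    then have "min (pi / 2) (vertex_dist (snd p) j) = pi / 2"
      using link_dist_vertex[of "snd p" j] link_D[OF q] q by (simp add: p_def)
    then show ?thesis using L by simp
  next
    case False
    then have "fst p * trunc_cos (vertex_dist (snd p) j) = leg j p" by (simp add: leg_def)
    also have "\<dots> = r * (if j mod 6 = k mod 6 then cos \<psi> else if j mod 6 = (k + b) mod 6 then sin \<psi> else 0)"
      unfolding p_def by (rule leg_star[OF b \<psi>])
    also have "\<dots> \<le> L (of_nat j)"
      using st s t L of_nat_3_mod6[of j] of_nat_3_mod6[of k] of_nat_3_mod6[of "k + b"] by auto
    finally show ?thesis .
  qed
  then have "p \<in> config_cone L"
    using pc r less st(3) by (auto simp: config_cone_def region_def p_def star_point_def)
  moreover have "cart p = f" unfolding p_def cart_star[OF b \<psi>] f_eq s t ..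
  ultimately show ?thesis by blast
qed

lemma cart_in_config:
  assumes p: "p \<in> config_cone L"
  shows "cart p \<in> mspace (config2 (Y_graph L))"
proof -
  note P = config_cone_D[OF p]
  obtain k b \<psi> where b: "b \<in> {1, 3, 5}" and sp: "snd p = star_point k b \<psi>" and \<psi>: "0 \<le> \<psi>" "\<psi> < pi / 2"
    and b3: "b = 3 \<longrightarrow> \<psi> = snd (snd p)"
    by (rule star_form_ex[OF P(5)])
  have p_eq: "p = (fst p, star_point k b \<psi>)" using sp by (metis prod.collapse)
  have n: "(k + b) mod 6 \<noteq> k mod 6"
    using b less_6_cases[of "k mod 6"] unfolding mod_add_left_eq[of k, symmetric] by auto
  have "leg k p = fst p * cos \<psi>" "leg (k + b) p = fst p * sin \<psi>"
    by (subst p_eq, simp add: leg_star[OF b \<psi>] n)+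
  then have le: "fst p * cos \<psi> \<le> L (of_nat k)" "fst p * sin \<psi> \<le> L (of_nat (k + b))"
    using leg_le_arm[OF P(2), of k] leg_le_arm[OF P(2), of "k + b"] by simp_all
  have pos: "0 < fst p * cos \<psi>" "0 \<le> fst p * sin \<psi>"
    using P \<psi> by (auto intro!: mult_pos_pos mult_nonneg_nonneg cos_gt_zero_pi sin_ge_zero)
  have ne: "axis (of_nat k) (fst p * cos \<psi>) \<noteq> (axis (of_nat (k + b)) (fst p * sin \<psi>) :: real ^ 3)"
  proof (cases "b = 3")
    case True
    then have "(of_nat (k + b) :: 3) = of_nat k" by simp
    moreover have "sin \<psi> < cos \<psi>" using b3 True P by (auto intro: sin_less_cos)
    ultimately show ?thesis using P(3) by (simp add: axis_eq_axis)
  next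
    case False
    then have "(of_nat (k + b) :: 3) \<noteq> of_nat (k + 3)" using arms_distinct[of b 3 k] b by simp
    then have "(of_nat k :: 3) \<noteq> of_nat (k + b)" using add_3_mod_3[of "of_nat k"] by auto
    then show ?thesis using pos by (auto simp: axis_eq_axis simp del: of_nat_add)
  qed
  have "cart p = chart k b (fst p * cos \<psi>) (fst p * sin \<psi>)"
    by (subst p_eq) (rule cart_star[OF b \<psi>])
  then show ?thesis
    unfolding chart_def using le pos ne ne[symmetric]
    by (cases "even k") (simp_all only: if_True if_False, (rule config_I; simp only: less_imp_le not_False_eq_True)+)
qed

lemma cart_inj: "inj_on cart (config_cone L)"
proof (rule inj_onI)
  fix p q assume p: "p \<in> config_cone L" and q: "q \<in> config_cone L" and eq: "cart p = cart q"
  obtain k where k: "coord (k + 3) (cart p) < coord k (cart p)"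
    using config_star_ex[OF cart_in_config[OF p]] by blast
  then have "leg (k + 3) p < leg k p" "leg (k + 3) q < leg k q"
    using eq coord_cart by metis+
  then have "vertex_dist (snd p) k < pi / 2" "vertex_dist (snd q) k < pi / 2"
    using star_of_leg config_cone_D(1)[OF p] config_cone_D(1)[OF q] by blast+
  then have "cone_dist p q = mdist (config2 (Y_graph L)) (cart p) (cart q)"
    by (rule star_isometry[OF p q])
  also have "\<dots> = 0" using eq cart_in_config[OF q] by simp
  finally show "p = q"
    using cone_dist_0_imp_eq config_cone_D[OF p] config_cone_D[OF q] by blast
qed

lemma cart_bij:
  assumes "\<And>i. 0 \<le> L i"
  shows "bij_betw cart (config_cone L) (mspace (config2 (Y_graph L)))"
  unfolding bij_betw_def
proof (intro conjI cart_inj subset_antisym subsetI)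
  fix f assume f: "f \<in> mspace (config2 (Y_graph L))"
  obtain k where "coord (k + 3) f < coord k f" using config_star_ex[OF f] by auto
  then have "\<exists>p\<in>config_cone L. cart p = f" by (rule cart_surj[OF f _ assms])
  then show "f \<in> cart ` config_cone L" by auto
qed (use cart_in_config in auto)

section \<open>Lengths of paths\<close>

lemma path_length_ge:
  assumes t: "mono_on {..n} t" "t ` {..n} \<subseteq> {0..1}"
  shows "(\<Sum>i<n. ennreal (mdist m (g (t i)) (g (t (Suc i))))) \<le> path_length m g"
  unfolding path_length_def using t by (intro SUP_upper2[of "(n, t)"]) auto

lemma path_length_ge_dist: "ennreal (mdist m (g 0) (g 1)) \<le> path_length m g"
proof -
  have "real ` {..1} \<subseteq> {0..1}" by auto
  then show ?thesis using path_length_ge[of 1 real m g] by (simp add: mono_on_def)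
qed

lemma path_length_le:
  assumes le: "\<And>t t'. 0 \<le> t \<Longrightarrow> t \<le> t' \<Longrightarrow> t' \<le> 1 \<Longrightarrow> mdist m (g t) (g t') \<le> F t' - F t"
  shows "path_length m g \<le> ennreal (F 1 - F 0)"
  unfolding path_length_def
proof (rule SUP_least, clarify)
  fix n and t :: "nat \<Rightarrow> real" assume mono: "mono_on {..n} t" and im: "t ` {..n} \<subseteq> {0..1}"
  have step: "0 \<le> t i" "t i \<le> t (Suc i)" "t (Suc i) \<le> 1" if "i < n" for i
    using mono im that by (auto simp: mono_on_def image_subset_iff)
  have "(\<Sum>i<n. ennreal (mdist m (g (t i)) (g (t (Suc i))))) = ennreal (\<Sum>i<n. mdist m (g (t i)) (g (t (Suc i))))"
    by (simp add: sum_ennreal)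
  also have "(\<Sum>i<n. mdist m (g (t i)) (g (t (Suc i)))) \<le> (\<Sum>i<n. F (t (Suc i)) - F (t i))"
    by (intro sum_mono le step) auto
  also have "\<dots> = F (t n) - F (t 0)"
    by (rule sum_lessThan_telescope)
  also have "\<dots> \<le> F 1 - F 0"
  proof -
    have "0 \<le> t 0" "t 0 \<le> 1" "0 \<le> t n" "t n \<le> 1" using im by (auto simp: image_subset_iff)
    then have "0 \<le> F (t 0) - F 0" "0 \<le> F 1 - F (t n)"
      using le[of 0 "t 0"] le[of "t n" 1] mdist_nonneg[of m "g 0" "g (t 0)"]
        mdist_nonneg[of m "g (t n)" "g 1"] by (auto simp del: mdist_nonneg)
    then show ?thesis by simp
  qed
  finally show "(\<Sum>i<n. ennreal (mdist m (g (t i)) (g (t (Suc i))))) \<le> ennreal (F 1 - F 0)"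
    by (simp add: ennreal_leI)
qed

text \<open>The number \<open>1 / n\<close> is chosen below a Lebesgue number of the cover.\<close>

lemma uniform_subdivision:
  assumes U: "\<And>k. openin (top_of_set {0..1::real}) (U k)" and cover: "\<And>t. 0 \<le> t \<Longrightarrow> t \<le> 1 \<Longrightarrow> \<exists>k::nat. t \<in> U k"
  obtains n :: nat where "0 < n" "\<And>t t'. 0 \<le> t \<Longrightarrow> t \<le> 1 \<Longrightarrow> 0 \<le> t' \<Longrightarrow> t' \<le> 1 \<Longrightarrow> \<bar>t - t'\<bar> \<le> 1 / real n \<Longrightarrow> \<exists>k. t \<in> U k \<and> t' \<in> U k"
proof -
  have "\<exists>V. open V \<and> U k = {0..1} \<inter> V" for k using U[of k] by (auto simp: openin_open)
  then obtain V where V: "\<And>k. open (V k)" "\<And>k. U k = {0..1} \<inter> V k" by metis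
  have "{0..1::real} \<subseteq> \<Union>(range V)" using cover V by fastforce
  then obtain e where e: "0 < e" "\<And>t. t \<in> {0..1} \<Longrightarrow> \<exists>W\<in>range V. ball t e \<subseteq> W"
    using Heine_Borel_lemma[of "{0..1::real}" "range V"] V by (metis compact_Icc rangeE)
  obtain n :: nat where n: "0 < n" "1 / real n < e"
    using e(1) by (metis nat_approx_posE zero_less_Suc)
  show ?thesis
  proof (rule that[OF n(1)])
    fix t t' :: real assume t: "0 \<le> t" "t \<le> 1" "0 \<le> t'" "t' \<le> 1" "\<bar>t - t'\<bar> \<le> 1 / real n"
    obtain k where "ball t e \<subseteq> V k" using e(2)[of t] t by auto
    moreover have "t \<in> ball t e" "t' \<in> ball t e" using e(1) t n by (auto simp: dist_real_def)
    ultimately show "\<exists>k. t \<in> U k \<and> t' \<in> U k" using t V by (auto intro!: exI[of _ k])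
  qed
qed

lemma polygon_inequality:
  fixes d :: "'a \<Rightarrow> 'a \<Rightarrow> real"
  assumes tri: "\<And>x y z. x \<in> S \<Longrightarrow> y \<in> S \<Longrightarrow> z \<in> S \<Longrightarrow> d x z \<le> d x y + d y z"
    and refl: "\<And>x. x \<in> S \<Longrightarrow> d x x = 0" and S: "\<And>i. i \<le> n \<Longrightarrow> f i \<in> S"
  shows "d (f 0) (f n) \<le> (\<Sum>i<n. d (f i) (f (Suc i)))"
  using S
proof (induction n)
  case (Suc n)
  have "d (f 0) (f (Suc n)) \<le> d (f 0) (f n) + d (f n) (f (Suc n))"
    using Suc.prems by (intro tri) auto
  also have "d (f 0) (f n) \<le> (\<Sum>i<n. d (f i) (f (Suc i)))" using Suc by auto
  finally show ?case by simp
qed (use refl in auto)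

lemma continuous_map_into_metric_tendsto:
  assumes "\<And>v. v \<in> S \<Longrightarrow> f v \<in> mspace m"
    and "\<And>v. v \<in> S \<Longrightarrow> ((\<lambda>u. mdist m (f u) (f v)) \<longlongrightarrow> 0) (at v within S)"
  shows "continuous_map (top_of_set S) (mtopology_of m) f"
proof -
  interpret Metric_space "mspace m" "mdist m" by simp
  have "\<exists>U. openin (top_of_set S) U \<and> v \<in> U \<and> (\<forall>u\<in>U. f u \<in> mball (f v) \<epsilon>)" if v: "v \<in> S" and e: "0 < \<epsilon>" for v \<epsilon>
  proof -
    have "\<forall>\<^sub>F u in at v within S. mdist m (f u) (f v) < \<epsilon>"
      using order_tendstoD(2)[OF assms(2)[OF v] e] .
    then obtain W where W: "open W" "v \<in> W" "\<And>u. u \<in> W \<Longrightarrow> u \<noteq> v \<Longrightarrow> u \<in> S \<Longrightarrow> mdist m (f u) (f v) < \<epsilon>"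
      unfolding eventually_at_topological by blast
    have "f u \<in> mball (f v) \<epsilon>" if "u \<in> S \<inter> W" for u
      using W(3)[of u] that v e assms(1) by (cases "u = v") (auto simp: commute)
    moreover have "openin (top_of_set S) (S \<inter> W)" using W by auto
    ultimately show ?thesis using v W by blast
  qed
  then show ?thesis
    unfolding mtopology_of_def continuous_map_to_metric by simp
qed

section \<open>Near-geodesics between configurations\<close>

context cone_pair
begin

text \<open>For fixed end points the assumption on the angle holds for all sufficiently small
  \<open>s\<close>, and the bound then tends to the distance of the end points.\<close>

lemma near_geodesic_bound:
  assumes "0 < s" "0 < fst x" "0 < fst y" "A \<le> pi - s \<or> pi \<le> A"
  obtains F where "\<And>t t'. 0 \<le> t \<Longrightarrow> t \<le> t' \<Longrightarrow> t' \<le> 1 \<Longrightarrow> cone_dist (cone_path x y s t) (cone_path x y s t') \<le> F t' - F t"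
    "F 1 - F 0 \<le> cone_dist x y + s * A"
proof (cases "A \<le> pi - s")
  case True
  show ?thesis
  proof (rule that[of "\<lambda>t. t * cone_dist x y"])
    show "cone_dist (cone_path x y s t) (cone_path x y s t') \<le> t' * cone_dist x y - t * cone_dist x y"
      if "0 \<le> t" "t \<le> t'" "t' \<le> 1" for t t'
      using cone_dist_straight[of t t'] that True by (simp add: algebra_simps)
  qed (use assms A_nonneg in auto)
next
  case False
  then show ?thesis
    using that[of potential] cone_dist_wide potential_total assms by auto
qed

lemma cone_path_pos:
  assumes "0 \<le> t" "t \<le> 1" "0 < fst x" "0 < fst y" "0 < s \<or> A < pi"
  shows "0 < fst (cone_path x y s t)"
  using plane_path_nonzero[OF assms] by (simp add: cone_path_def)

end

lemma arm_length_ge: "(\<And>i. 2 \<le> L i) \<Longrightarrow> 1 \<le> arm_length L k"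
  by (metis one_le_numeral order_trans)

lemma cone_path_in_config_cone:
  assumes x: "x \<in> config_cone L" and y: "y \<in> config_cone L" and L: "\<And>i. 2 \<le> L i"
    and st: "0 \<le> s" "s \<le> 1" "0 \<le> t" "t \<le> 1" and "0 < s \<or> angle x y < pi"
  shows "cone_path x y s t \<in> config_cone L"
proof -
  note CX = config_cone_D[OF x] and CY = config_cone_D[OF y]
  interpret cone_pair x y s using CX CY st by unfold_locales auto
  have "cone_path x y s t \<in> region (arm_length L)"
    by (intro cone_path_in_region CX CY st arm_length_ge[OF L])
  moreover have "snd (snd (cone_path x y s t)) < pi / 4"
    using cone_path_fin[of t] st CX CY by auto
  ultimately show ?thesis
    using cone_path_pos[of t] assms CX CY by (simp add: config_cone_def)
qed

lemma cone_path_tendsto_t: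
  assumes x: "x \<in> config_cone L" and y: "y \<in> config_cone L"
    and st: "0 < s" "s \<le> 1" "t \<in> {0..1}"
  shows "((\<lambda>u. cone_path x y s u) \<longlongrightarrow> cone_path x y s t) (at t within {0..1})"
proof -
  note CX = config_cone_D[OF x] and CY = config_cone_D[OF y]
  interpret cone_pair x y s using CX CY st by unfold_locales auto
  have ev: "\<forall>\<^sub>F u in at t within {0..1}. u \<in> {0..1}" by (auto simp: eventually_at_filter)
  show ?thesis
  proof (rule cone_dist_0_imp_tendsto)
    show "((\<lambda>u. cone_dist (cone_path x y s u) (cone_path x y s t)) \<longlongrightarrow> 0) (at t within {0..1})"
      by (rule tendsto_cone_path) (use ev CX(1) CY(1) st in \<open>auto elim: eventually_mono\<close>)
    show "\<forall>\<^sub>F u in at t within {0..1}. cone_path x y s u \<in> link_cone"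
      using ev by eventually_elim (auto intro: cone_path_in_cone)
  qed (use st CX CY in \<open>auto intro: cone_path_in_cone cone_path_pos\<close>)
qed

section \<open>The intrinsic metric\<close>

locale arms =
  fixes L :: "3 \<Rightarrow> real"
  assumes L: "\<And>i. 2 \<le> L i"
begin

abbreviation "M \<equiv> config2 (Y_graph L)"

definition polar where "polar = inv_into (config_cone L) cart"

lemma L_nonneg: "0 \<le> L i" using L[of i] by simp

lemma polar_in: "f \<in> mspace M \<Longrightarrow> polar f \<in> config_cone L"
  using cart_bij[of L, OF L_nonneg] by (auto simp: polar_def bij_betw_def intro: inv_into_into)

lemma cart_polar: "f \<in> mspace M \<Longrightarrow> cart (polar f) = f"
  using cart_bij[of L, OF L_nonneg] by (auto simp: polar_def bij_betw_def intro: f_inv_into_f)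

lemma polar_cart: "p \<in> config_cone L \<Longrightarrow> polar (cart p) = p"
  using cart_bij[of L, OF L_nonneg] by (auto simp: polar_def bij_betw_def intro: inv_into_f_f)

lemma polar_isometry:
  assumes f: "f \<in> mspace M" "coord (k + 3) f < coord k f" and g: "g \<in> mspace M" "coord (k + 3) g < coord k g"
  shows "cone_dist (polar f) (polar g) = mdist M f g"
proof -
  have *: "vertex_dist (snd (polar f)) k < pi / 2" if "f \<in> mspace M" "coord (k + 3) f < coord k f" for f
    using star_of_leg[of "polar f" k] that config_cone_D[OF polar_in[OF that(1)]] coord_cart cart_polar
    by (metis (no_types))
  then show ?thesis
    using star_isometry[OF polar_in[OF f(1)] polar_in[OF g(1)] *[OF f] *[OF g]] cart_polar f g by simp
qed

lemma coord_Lipschitz: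
  assumes "f \<in> mspace M" "g \<in> mspace M"
  shows "\<bar>coord k f - coord k g\<bar> \<le> mdist M f g"
proof -
  have Y: "\<bar>a $ i - b $ i\<bar> \<le> mdist (Y_graph L) a b" for a b :: "real ^ 3" and i
    unfolding Y_graph_def Metric_space.mdist_metric[OF Metric_space_Y_graph]
    by (rule member_le_sum) auto
  have "mdist (Y_graph L) (fst f) (fst g) \<le> mdist M f g" "mdist (Y_graph L) (snd f) (snd g) \<le> mdist M f g"
    using mdist_config[of L "fst f" "snd f" "fst g" "snd g"] by (auto intro: real_le_rsqrt)
  then show ?thesis
    unfolding coord_def using order_trans[OF Y] by (cases "even k") (simp_all only: if_True if_False)
qed

lemma star_ball:
  assumes f: "f \<in> mspace M" "coord (k + 3) f < coord k f" and g: "g \<in> mspace M"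
    and d: "mdist M f g < (coord k f - coord (k + 3) f) / 2"
  shows "coord (k + 3) g < coord k g"
  using coord_Lipschitz[OF f(1) g, of k] coord_Lipschitz[OF f(1) g, of "k + 3"] d
  by (simp add: abs_le_iff field_simps)

lemma openin_star: "openin (mtopology_of M) {f \<in> mspace M. coord (k + 3) f < coord k f}"
proof -
  interpret Metric_space "mspace M" "mdist M" by simp
  show ?thesis
    unfolding mtopology_of_def openin_mtopology
  proof (intro conjI allI impI)
    fix f assume "f \<in> {f \<in> mspace M. coord (k + 3) f < coord k f}"
    then show "\<exists>r>0. mball f r \<subseteq> {f \<in> mspace M. coord (k + 3) f < coord k f}"
      by (intro exI[of _ "(coord k f - coord (k + 3) f) / 2"]) (auto intro: star_ball)
  qed auto
qed

text \<open>Subdivide the path so finely that consecutive points lie in a common star, where the chords of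
  both metrics agree.\<close>

lemma cone_dist_le_path_length:
  assumes \<gamma>: "\<gamma> \<in> paths_between (mtopology_of M) f g"
  shows "ennreal (cone_dist (polar f) (polar g)) \<le> path_length M \<gamma>"
proof -
  have cont: "continuous_map (top_of_set {0..1}) (mtopology_of M) \<gamma>" and ends: "\<gamma> 0 = f" "\<gamma> 1 = g"
    using \<gamma> by (auto simp: paths_between_def path_space_def continuous_maps_def)
  have in_M: "\<gamma> t \<in> mspace M" if "0 \<le> t" "t \<le> 1" for t
    using cont that by (auto simp: continuous_map_def)
  define U where "U k = {t \<in> {0..1}. \<gamma> t \<in> {f \<in> mspace M. coord (k + 3) f < coord k f}}" for k
  obtain n where n: "0 < n" and sub: "\<And>t t'. 0 \<le> t \<Longrightarrow> t \<le> 1 \<Longrightarrow> 0 \<le> t' \<Longrightarrow> t' \<le> 1 \<Longrightarrow>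
      \<bar>t - t'\<bar> \<le> 1 / real n \<Longrightarrow> \<exists>k. t \<in> U k \<and> t' \<in> U k"
  proof (rule uniform_subdivision[of U])
    show "openin (top_of_set {0..1}) (U k)" for k
      using openin_continuous_map_preimage[OF cont openin_star[of k]] unfolding U_def by simp
    show "\<exists>k. t \<in> U k" if "0 \<le> t" "t \<le> 1" for t
      using config_star_ex[OF in_M[OF that]] in_M[OF that] that by (auto simp: U_def)
  qed blast
  define u where "u i = real i / real n" for i
  have u: "0 \<le> u i" "u i \<le> 1" if "i \<le> n" for i using that n by (auto simp: u_def)
  have "cone_dist (polar (\<gamma> (u 0))) (polar (\<gamma> (u n))) \<le> (\<Sum>i<n. cone_dist (polar (\<gamma> (u i))) (polar (\<gamma> (u (Suc i)))))"
    by (rule polygon_inequality[where S = link_cone and d = cone_dist and f = "\<lambda>i. polar (\<gamma> (u i))"])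
      (auto intro: cone_dist_triangle u in_M config_cone_D(1) polar_in)
  also have "\<dots> = (\<Sum>i<n. mdist M (\<gamma> (u i)) (\<gamma> (u (Suc i))))"
  proof (rule sum.cong)
    fix i assume "i \<in> {..<n}"
    then have b: "0 \<le> u i" "u i \<le> 1" "0 \<le> u (Suc i)" "u (Suc i) \<le> 1" using u by auto
    moreover have "\<bar>u i - u (Suc i)\<bar> \<le> 1 / real n" using n by (simp add: u_def field_simps)
    ultimately obtain k where "u i \<in> U k" "u (Suc i) \<in> U k" using sub by blast
    then show "cone_dist (polar (\<gamma> (u i))) (polar (\<gamma> (u (Suc i)))) = mdist M (\<gamma> (u i)) (\<gamma> (u (Suc i)))"
      by (intro polar_isometry[of _ k]) (auto simp: U_def)
  qed simp
  finally have "ennreal (cone_dist (polar f) (polar g)) \<le> (\<Sum>i<n. ennreal (mdist M (\<gamma> (u i)) (\<gamma> (u (Suc i)))))"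
    using n ends by (simp add: u_def sum_ennreal ennreal_leI)
  also have "\<dots> \<le> path_length M \<gamma>"
    by (rule path_length_ge) (use u n in \<open>auto simp: mono_on_def u_def divide_right_mono\<close>)
  finally show ?thesis .
qed

text \<open>Conversely, subdividing a path in the cone bounds the chords of its image in the configuration
  space by those in the cone.\<close>

lemma path_of_cone_path:
  assumes P: "\<And>t. t \<in> {0..1} \<Longrightarrow> P t \<in> config_cone L"
    and cont: "\<And>t. t \<in> {0..1} \<Longrightarrow> (P \<longlongrightarrow> P t) (at t within {0..1})"
    and F: "\<And>t t'. 0 \<le> t \<Longrightarrow> t \<le> t' \<Longrightarrow> t' \<le> 1 \<Longrightarrow> cone_dist (P t) (P t') \<le> F t' - F t"
  shows "restrict (\<lambda>t. cart (P t)) {0..1} \<in> paths_between (mtopology_of M) (cart (P 0)) (cart (P 1))"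
    and "path_length M (restrict (\<lambda>t. cart (P t)) {0..1}) \<le> ennreal (F 1 - F 0)"
proof -
  define g where "g = restrict (\<lambda>t. cart (P t)) {0..1}"
  have g: "g t = cart (P t)" "g t \<in> mspace M" if "t \<in> {0..1}" for t
    using that P cart_in_config by (auto simp: g_def)
  define U where "U k = {t \<in> {0..1}. vertex_dist (snd (P t)) k < pi / 2}" for k
  have ev01: "\<forall>\<^sub>F u in at t within {0..1}. u \<in> {0..1}" for t :: real by (auto simp: eventually_at_filter)
  have lk: "snd (P u) \<in> link" "P u \<in> link_cone" if "u \<in> {0..1}" for u
    using config_cone_D[OF P[OF that]] by auto
  have evl: "\<forall>\<^sub>F u in at t within {0..1}. snd (P u) \<in> link" "\<forall>\<^sub>F u in at t within {0..1}. P u \<in> link_cone" for t :: real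
    using eventually_mono[OF ev01 lk(1)] eventually_mono[OF ev01 lk(2)] by auto
  have Uev: "\<forall>\<^sub>F u in at t within {0..1}. u \<in> U k" if t: "t \<in> U k" for t k
  proof -
    have t01: "t \<in> {0..1}" using t by (simp add: U_def)
    have "((\<lambda>u. snd (P u)) \<longlongrightarrow> snd (P t)) (at t within {0..1})"
      using cont[OF t01] by (rule tendsto_snd)
    then have "((\<lambda>u. vertex_dist (snd (P u)) k) \<longlongrightarrow> vertex_dist (snd (P t)) k) (at t within {0..1})"
      by (rule tendsto_link_dist_both) (use t01 lk evl in auto)
    then have "\<forall>\<^sub>F u in at t within {0..1}. vertex_dist (snd (P u)) k < pi / 2"
      using t by (intro order_tendstoD(2)) (auto simp: U_def)
    then show ?thesis using ev01 by eventually_elim (simp add: U_def)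
  qed
  have Uopen: "openin (top_of_set {0..1}) (U k)" for k
  proof (subst openin_subopen, intro ballI)
    fix t assume t: "t \<in> U k"
    obtain W where W: "open W" "t \<in> W" "\<And>u. u \<in> W \<Longrightarrow> u \<noteq> t \<Longrightarrow> u \<in> {0..1} \<Longrightarrow> u \<in> U k"
      using Uev[OF t] unfolding eventually_at_topological by blast
    show "\<exists>T. openin (top_of_set {0..1}) T \<and> t \<in> T \<and> T \<subseteq> U k"
    proof (intro exI conjI)
      show "openin (top_of_set {0..1}) ({0..1} \<inter> W)" using W(1) by auto
      show "t \<in> {0..1} \<inter> W" using W(2) t by (simp add: U_def)
      show "{0..1} \<inter> W \<subseteq> U k"
      proof
        fix u assume "u \<in> {0..1} \<inter> W"
        then show "u \<in> U k" using W(3)[of u] t by (cases "u = t") auto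
      qed
    qed
  qed
  have iso: "mdist M (g t) (g t') = cone_dist (P t) (P t')" if "t \<in> U k" "t' \<in> U k" for t t' k
    using that g P star_isometry[of "P t" L "P t'" k] by (auto simp: U_def)
  have cover: "\<exists>k. t \<in> U k" if "0 \<le> t" "t \<le> 1" for t
  proof -
    have Pt: "P t \<in> config_cone L" using P that by auto
    obtain k where "coord (k + 3) (cart (P t)) < coord k (cart (P t))"
      using config_star_ex[OF cart_in_config[OF Pt]] by blast
    then show ?thesis
      using star_of_leg[of "P t" k] config_cone_D[OF Pt] that by (auto simp: coord_cart U_def)
  qed
  have "continuous_map (top_of_set {0..1}) (mtopology_of M) g"
  proof (rule continuous_map_into_metric_tendsto)
    fix t :: real assume t: "t \<in> {0..1}"
    obtain k where k: "t \<in> U k" using cover t by auto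
    have "((\<lambda>u. cone_dist (P u) (P t)) \<longlongrightarrow> 0) (at t within {0..1})"
      by (rule tendsto_cone_dist[OF cont[OF t]]) (use t lk evl in auto)
    moreover have "\<forall>\<^sub>F u in at t within {0..1}. cone_dist (P u) (P t) = mdist M (g u) (g t)"
      using Uev[OF k] by eventually_elim (use iso k in simp)
    ultimately show "((\<lambda>u. mdist M (g u) (g t)) \<longlongrightarrow> 0) (at t within {0..1})"
      by (rule Lim_transform_eventually)
  qed (use g in auto)
  then show "restrict (\<lambda>t. cart (P t)) {0..1} \<in> paths_between (mtopology_of M) (cart (P 0)) (cart (P 1))"
    unfolding g_def[symmetric] paths_between_def path_space_def topspace_compact_open_topology continuous_maps_def
    using g by (simp add: g_def[THEN arg_cong[where f = "\<lambda>h. h \<in> extensional {0..1}"]])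
  obtain n where n: "0 < n" and sub: "\<And>t t'. 0 \<le> t \<Longrightarrow> t \<le> 1 \<Longrightarrow> 0 \<le> t' \<Longrightarrow> t' \<le> 1 \<Longrightarrow>
      \<bar>t - t'\<bar> \<le> 1 / real n \<Longrightarrow> \<exists>k. t \<in> U k \<and> t' \<in> U k"
    using uniform_subdivision[of U, OF Uopen cover] by blast
  have "mdist M (g t) (g t') \<le> F t' - F t" if t: "0 \<le> t" "t \<le> t'" "t' \<le> 1" for t t'
  proof -
    define u where "u i = t + (t' - t) * (real i / real n)" for i
    have u: "0 \<le> u i" "u i \<le> 1" if "i \<le> n" for i
    proof -
      have "0 \<le> real i / real n" "real i / real n \<le> 1" using that n by auto
      then have "0 \<le> (t' - t) * (real i / real n)" "(t' - t) * (real i / real n) \<le> t' - t"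
        using t mult_left_le[of "real i / real n" "t' - t"] mult_nonneg_nonneg[of "t' - t" "real i / real n"] by simp_all
      then show "0 \<le> u i" "u i \<le> 1" using t by (auto simp: u_def)
    qed
    have un: "u 0 = t" "u n = t'" using n by (auto simp: u_def)
    have su: "u (Suc i) - u i = (t' - t) * (1 / real n)" for i
      by (simp add: u_def add_divide_distrib algebra_simps)
    have step: "0 \<le> u (Suc i) - u i" "u (Suc i) - u i \<le> 1 / real n" for i
      unfolding su using t mult_right_mono[of "t' - t" 1 "1 / real n"] by auto
    have "mdist M (g (u 0)) (g (u n)) \<le> (\<Sum>i<n. mdist M (g (u i)) (g (u (Suc i))))"
      by (rule polygon_inequality[where S = "mspace M" and d = "mdist M" and f = "\<lambda>i. g (u i)"])
        (use u g in \<open>auto intro: mdist_triangle\<close>)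
    also have "\<dots> \<le> (\<Sum>i<n. F (u (Suc i)) - F (u i))"
    proof (rule sum_mono)
      fix i assume "i \<in> {..<n}"
      then have b: "0 \<le> u i" "u i \<le> 1" "0 \<le> u (Suc i)" "u (Suc i) \<le> 1" using u by auto
      moreover have "\<bar>u i - u (Suc i)\<bar> \<le> 1 / real n" using step[of i] by (simp add: abs_minus_commute)
      ultimately obtain k where "u i \<in> U k" "u (Suc i) \<in> U k" using sub by blast
      then have "mdist M (g (u i)) (g (u (Suc i))) = cone_dist (P (u i)) (P (u (Suc i)))" by (rule iso)
      then show "mdist M (g (u i)) (g (u (Suc i))) \<le> F (u (Suc i)) - F (u i)"
        using F[of "u i" "u (Suc i)"] b step[of i] by simp
    qed
    also have "\<dots> = F (u n) - F (u 0)" by (rule sum_lessThan_telescope)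
    finally show ?thesis by (simp add: un)
  qed
  then show "path_length M (restrict (\<lambda>t. cart (P t)) {0..1}) \<le> ennreal (F 1 - F 0)"
    unfolding g_def[symmetric] by (rule path_length_le)
qed

lemma near_optimal_path:
  assumes f: "f \<in> mspace M" and g: "g \<in> mspace M" and e: "0 < e"
  shows "(INF \<gamma> \<in> paths_between (mtopology_of M) f g. path_length M \<gamma>) \<le> ennreal (cone_dist (polar f) (polar g) + e)"
proof -
  define x y where "x = polar f" and "y = polar g"
  have px: "x \<in> config_cone L" and py: "y \<in> config_cone L" using polar_in f g by (auto simp: x_def y_def)
  note CX = config_cone_D[OF px] and CY = config_cone_D[OF py]
  define A where "A = angle x y"
  have A0: "0 \<le> A" using CX CY link_dist_nonneg by (auto simp: A_def)
  \<comment> \<open>Small enough for the error \<open>s * A\<close> to be at most \<open>e\<close>, and for the segment to be used if \<open>A < pi\<close>.\<close>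
  define s where "s = (if A < pi then min (e / (A + 1)) (min 1 (pi - A)) else min (e / (A + 1)) 1)"
  have hs: "0 < s" "s \<le> 1" "A \<le> pi - s \<or> pi \<le> A" using e A0 by (auto simp: s_def)
  have "s * A \<le> e / (A + 1) * A" using A0 by (intro mult_right_mono) (auto simp: s_def)
  also have "\<dots> \<le> e" using A0 e by (simp add: field_simps)
  finally have sA: "s * A \<le> e" .
  interpret cone_pair x y s using CX CY hs by unfold_locales auto
  obtain F where F: "\<And>t t'. 0 \<le> t \<Longrightarrow> t \<le> t' \<Longrightarrow> t' \<le> 1 \<Longrightarrow> cone_dist (cone_path x y s t) (cone_path x y s t') \<le> F t' - F t"
    "F 1 - F 0 \<le> cone_dist x y + s * A"
    using near_geodesic_bound[OF hs(1) CX(3) CY(3)] hs(3) unfolding A_def by blast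
  let ?\<gamma> = "restrict (\<lambda>t. cart (cone_path x y s t)) {0..1}"
  have P: "cone_path x y s t \<in> config_cone L" if "t \<in> {0..1}" for t
    using that hs by (intro cone_path_in_config_cone px py L) auto
  have C: "((\<lambda>u. cone_path x y s u) \<longlongrightarrow> cone_path x y s t) (at t within {0..1})" if "t \<in> {0..1}" for t
    using that hs by (intro cone_path_tendsto_t[OF px py])
  note cp = path_of_cone_path[OF P C F(1)]
  have "?\<gamma> \<in> paths_between (mtopology_of M) f g"
    using cp(1) unfolding cone_path_start cone_path_end[OF CY(3)]
    by (simp only: x_def y_def cart_polar[OF f] cart_polar[OF g])
  then have "(INF \<gamma> \<in> paths_between (mtopology_of M) f g. path_length M \<gamma>) \<le> path_length M ?\<gamma>"
    by (rule INF_lower)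
  also have "\<dots> \<le> ennreal (F 1 - F 0)" by (rule cp(2))
  also have "\<dots> \<le> ennreal (cone_dist x y + e)" using F(2) sA by (intro ennreal_leI) auto
  finally show ?thesis by (simp add: x_def y_def)
qed

text \<open>The infimum need not be attained: a geodesic through the apex is approximated by paths that
  avoid it.\<close>

lemma intrinsic_eq:
  assumes f: "f \<in> mspace M" and g: "g \<in> mspace M"
  shows "(INF \<gamma> \<in> paths_between (mtopology_of M) f g. path_length M \<gamma>) = ennreal (cone_dist (polar f) (polar g))"
proof (rule antisym)
  show "(INF \<gamma> \<in> paths_between (mtopology_of M) f g. path_length M \<gamma>) \<le> ennreal (cone_dist (polar f) (polar g))"
  proof (rule ennreal_le_epsilon)
    fix e :: real assume "0 < e"
    then show "(INF \<gamma> \<in> paths_between (mtopology_of M) f g. path_length M \<gamma>) \<le> ennreal (cone_dist (polar f) (polar g)) + ennreal e"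
      using near_optimal_path[OF f g] by (simp add: ennreal_plus[symmetric] del: ennreal_plus)
  qed
  show "ennreal (cone_dist (polar f) (polar g)) \<le> (INF \<gamma> \<in> paths_between (mtopology_of M) f g. path_length M \<gamma>)"
    by (rule INF_greatest) (rule cone_dist_le_path_length)
qed

text \<open>A chord is not longer than any path between its ends.\<close>

lemma mdist_le_cone_dist:
  assumes f: "f \<in> mspace M" and g: "g \<in> mspace M"
  shows "mdist M f g \<le> cone_dist (polar f) (polar g)"
proof -
  have "ennreal (mdist M f g) \<le> (INF \<gamma> \<in> paths_between (mtopology_of M) f g. path_length M \<gamma>)"
    by (rule INF_greatest) (use path_length_ge_dist in \<open>auto simp: paths_between_def\<close>)
  then show ?thesis unfolding intrinsic_eq[OF f g] by simp
qed

abbreviation "X \<equiv> intrinsic_metric M"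

definition intrinsic_dist where "intrinsic_dist f g = enn2real (INF \<gamma> \<in> paths_between (mtopology_of M) f g. path_length M \<gamma>)"

lemma intrinsic_dist_eq: "f \<in> mspace M \<Longrightarrow> g \<in> mspace M \<Longrightarrow> intrinsic_dist f g = cone_dist (polar f) (polar g)"
  by (simp add: intrinsic_dist_def intrinsic_eq)

lemma polar_link_cone: "f \<in> mspace M \<Longrightarrow> polar f \<in> link_cone"
  using polar_in config_cone_D by blast

text \<open>A metric has to be symmetric on the whole type. Outside the space there are no paths, the
  infimum is \<open>\<infinity>\<close>, and \<open>enn2real\<close> maps it to 0.\<close>

lemma intrinsic_dist_outside:
  assumes "f \<notin> mspace M \<or> g \<notin> mspace M" shows "intrinsic_dist f g = 0"
proof -
  have "paths_between (mtopology_of M) f g = {}"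
    using assms by (fastforce simp: paths_between_def path_space_def continuous_maps_def continuous_map_def Pi_iff)
  then show ?thesis by (simp add: intrinsic_dist_def)
qed

lemma Metric_space_intrinsic_dist: "Metric_space (mspace M) intrinsic_dist"
proof
  fix f g
  show "0 \<le> intrinsic_dist f g" by (simp add: intrinsic_dist_def)
  show "intrinsic_dist f g = intrinsic_dist g f"
    using intrinsic_dist_outside[of f g] intrinsic_dist_outside[of g f] intrinsic_dist_eq[of f g] intrinsic_dist_eq[of g f]
      cone_dist_commute[OF polar_link_cone polar_link_cone, of f g] by metis
next
  fix f g assume f: "f \<in> mspace M" and g: "g \<in> mspace M"
  have "polar f = polar g \<longleftrightarrow> f = g" using cart_polar f g by metis
  then show "(intrinsic_dist f g = 0) = (f = g)"
    unfolding intrinsic_dist_eq[OF f g]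
    using cone_dist_0_imp_eq[of "polar f" "polar g"] config_cone_D[OF polar_in[OF f]] config_cone_D[OF polar_in[OF g]] by auto
next
  fix f g h assume "f \<in> mspace M" "g \<in> mspace M" "h \<in> mspace M"
  then show "intrinsic_dist f h \<le> intrinsic_dist f g + intrinsic_dist g h"
    using intrinsic_dist_eq cone_dist_triangle polar_link_cone by simp
qed

lemma X_def: "X = metric (mspace M, intrinsic_dist)"
  by (simp add: intrinsic_metric_def intrinsic_dist_def[abs_def])

lemma mspace_X [simp]: "mspace X = mspace M"
  unfolding X_def by (rule Metric_space.mspace_metric[OF Metric_space_intrinsic_dist])

lemma mdist_X: "f \<in> mspace M \<Longrightarrow> g \<in> mspace M \<Longrightarrow> mdist X f g = cone_dist (polar f) (polar g)"
  unfolding X_def Metric_space.mdist_metric[OF Metric_space_intrinsic_dist] by (rule intrinsic_dist_eq)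

text \<open>The intrinsic distance is never smaller than the given one, and equal to it within a star.\<close>

lemma mtopology_X: "mtopology_of X = mtopology_of M"
proof -
  interpret M: Metric_space "mspace M" "mdist M" by simp
  interpret X: Metric_space "mspace X" "mdist X" by (rule Metric_space_mspace_mdist)
  have "openin (mtopology_of X) U = openin (mtopology_of M) U" for U
  proof
    assume "openin (mtopology_of M) U"
    then have U: "U \<subseteq> mspace M" "\<And>f. f \<in> U \<Longrightarrow> \<exists>r>0. M.mball f r \<subseteq> U"
      unfolding mtopology_of_def M.openin_mtopology by auto
    have "\<exists>r>0. X.mball f r \<subseteq> U" if "f \<in> U" for f
    proof -
      obtain r where r: "r > 0" "M.mball f r \<subseteq> U" using U(2)[OF \<open>f \<in> U\<close>] by blast
      have "X.mball f r \<subseteq> M.mball f r"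
      proof
        fix g assume g: "g \<in> X.mball f r"
        then have fg: "f \<in> mspace M" "g \<in> mspace M" "mdist X f g < r" by (simp_all add: X.in_mball[unfolded mspace_X])
        then show "g \<in> M.mball f r" using mdist_le_cone_dist[OF fg(1,2)] mdist_X[OF fg(1,2)] by simp
      qed
      then show ?thesis using r by blast
    qed
    then show "openin (mtopology_of X) U"
      unfolding mtopology_of_def X.openin_mtopology using U by auto
  next
    assume "openin (mtopology_of X) U"
    then have U: "U \<subseteq> mspace M" "\<And>f. f \<in> U \<Longrightarrow> \<exists>r>0. X.mball f r \<subseteq> U"
      unfolding mtopology_of_def X.openin_mtopology by auto
    have "\<exists>r>0. M.mball f r \<subseteq> U" if "f \<in> U" for f
    proof -
      have f: "f \<in> mspace M" using U that by auto
      obtain r where r: "r > 0" "X.mball f r \<subseteq> U" using U(2)[OF \<open>f \<in> U\<close>] by blast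
      obtain k where k: "coord (k + 3) f < coord k f" using config_star_ex[OF f] by blast
      define e where "e = min r ((coord k f - coord (k + 3) f) / 2)"
      have "M.mball f e \<subseteq> X.mball f r"
      proof
        fix g assume g: "g \<in> M.mball f e"
        then have fg: "g \<in> mspace M" "mdist M f g < e" by auto
        then have "coord (k + 3) g < coord k g"
          using star_ball[OF f k fg(1)] by (simp add: e_def)
        then have "mdist X f g = mdist M f g"
          unfolding mdist_X[OF f fg(1)] by (rule polar_isometry[OF f k fg(1)])
        then show "g \<in> X.mball f r" using f fg by (simp add: e_def X.in_mball[unfolded mspace_X])
      qed
      moreover have "e > 0" using r k by (simp add: e_def)
      ultimately show ?thesis using r by blast
    qed
    then show "openin (mtopology_of M) U"
      unfolding mtopology_of_def M.openin_mtopology using U by auto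
  qed
  then show ?thesis by (simp add: topology_eq)
qed

end

section \<open>The exponential law for the compact-open topology\<close>

text \<open>By the tube lemma, a compact slice in an open set has a neighbourhood of such slices.\<close>

lemma continuous_map_curry:
  assumes f: "continuous_map (prod_topology T Y) Z f"
  shows "continuous_map T (compact_open_topology Y Z) (\<lambda>x. restrict (\<lambda>y. f (x, y)) (topspace Y))"
proof -
  let ?g = "\<lambda>x. restrict (\<lambda>y. f (x, y)) (topspace Y)"
  have slice: "continuous_map Y Z (\<lambda>y. f (x, y))" if "x \<in> topspace T" for x
    using continuous_map_compose[OF _ f, of Y "\<lambda>y. (x, y)"] that
    by (simp add: o_def continuous_map_pairedI)
  have maps: "?g x \<in> continuous_maps Y Z" if "x \<in> topspace T" for x
  proof -
    have "continuous_map Y Z (?g x)"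
      using slice[OF that] by (rule continuous_map_eq) auto
    then show ?thesis by (simp add: continuous_maps_def)
  qed
  have "openin T {x \<in> topspace T. ?g x ` K \<subseteq> U}" if K: "compactin Y K" and U: "openin Z U" for K U
  proof (subst openin_subopen, intro ballI)
    fix x assume x: "x \<in> {x \<in> topspace T. ?g x ` K \<subseteq> U}"
    have KY: "K \<subseteq> topspace Y" using K by (rule compactin_subset_topspace)
    let ?W = "{p \<in> topspace (prod_topology T Y). f p \<in> U}"
    have W: "openin (prod_topology T Y) ?W" by (rule openin_continuous_map_preimage[OF f U])
    have "f (x, y) \<in> U" if "y \<in> K" for y
      using x that KY by (auto simp: image_subset_iff subset_iff)
    then have "{x} \<times> K \<subseteq> ?W" using x KY by auto
    moreover have "x \<in> topspace T" using x by simp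
    ultimately have "\<exists>A B. openin T A \<and> openin Y B \<and> x \<in> A \<and> K \<subseteq> B \<and> A \<times> B \<subseteq> ?W"
      by (intro tube_lemma_right[OF W K])
    then obtain A B where A: "openin T A" "x \<in> A" and B: "K \<subseteq> B" and AB: "A \<times> B \<subseteq> ?W"
      by (elim exE conjE)
    have "A \<subseteq> {x \<in> topspace T. ?g x ` K \<subseteq> U}"
    proof
      fix z assume z: "z \<in> A"
      have "f (z, y) \<in> U" if "y \<in> K" for y using AB B that z by blast
      then have "?g z ` K \<subseteq> U" using KY by auto
      then show "z \<in> {x \<in> topspace T. ?g x ` K \<subseteq> U}" using openin_subset[OF A(1)] z by blast
    qed
    then show "\<exists>A. openin T A \<and> x \<in> A \<and> A \<subseteq> {x \<in> topspace T. ?g x ` K \<subseteq> U}"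
      using A by blast
  qed
  moreover have "{x \<in> topspace T. ?g x ` K \<subseteq> U} = ?g -` {h \<in> continuous_maps Y Z. h ` K \<subseteq> U} \<inter> topspace T" for K U
    using maps by auto
  ultimately have "openin T (?g -` V \<inter> topspace T)"
    if "V \<in> {{h \<in> continuous_maps Y Z. h ` K \<subseteq> U} |K U. compactin Y K \<and> openin Z U}" for V
    using that by auto
  moreover have "?g ` topspace T \<subseteq> topspace (compact_open_topology Y Z)"
    using maps by auto
  ultimately show ?thesis
    unfolding compact_open_topology_def continuous_on_generated_topo_iff topology_generated_by_topspace
    by (auto simp: image_subset_iff)
qed

text \<open>For this direction points of \<open>Y\<close> need small compact neighbourhoods: they provide
  the compact sets that occur in the subbasis of the compact-open topology.\<close>

lemma continuous_map_uncurry: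
  assumes g: "continuous_map T (compact_open_topology Y Z) g" and Y: "neighbourhood_base_of (compactin Y) Y"
  shows "continuous_map (prod_topology T Y) Z (\<lambda>p. g (fst p) (snd p))"
proof -
  have maps: "g x \<in> continuous_maps Y Z" if "x \<in> topspace T" for x
    using g that by (auto simp: continuous_map_def)
  have "openin (prod_topology T Y) {p \<in> topspace (prod_topology T Y). g (fst p) (snd p) \<in> V}" if V: "openin Z V" for V
  proof (subst openin_subopen, intro ballI)
    fix p assume p: "p \<in> {p \<in> topspace (prod_topology T Y). g (fst p) (snd p) \<in> V}"
    obtain x y where xy: "p = (x, y)" "x \<in> topspace T" "y \<in> topspace Y" "g x y \<in> V" using p by auto
    have "openin Y {y \<in> topspace Y. g x y \<in> V}"
      using maps[OF xy(2)] V by (intro openin_continuous_map_preimage) (auto simp: continuous_maps_def)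
    then obtain B K where B: "openin Y B" "compactin Y K" "y \<in> B" "B \<subseteq> K" "K \<subseteq> {y \<in> topspace Y. g x y \<in> V}"
      using Y xy unfolding neighbourhood_base_of by (metis (mono_tags, lifting) mem_Collect_eq)
    let ?N = "{h \<in> continuous_maps Y Z. h ` K \<subseteq> V}"
    have "openin (compact_open_topology Y Z) ?N"
      unfolding compact_open_topology_def using B(2) V by (intro topology_generated_by_Basis) blast
    then have A: "openin T {x \<in> topspace T. g x \<in> ?N}" by (rule openin_continuous_map_preimage[OF g])
    show "\<exists>W. openin (prod_topology T Y) W \<and> p \<in> W \<and> W \<subseteq> {p \<in> topspace (prod_topology T Y). g (fst p) (snd p) \<in> V}"
    proof (intro exI conjI)
      show "openin (prod_topology T Y) ({x \<in> topspace T. g x \<in> ?N} \<times> B)"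
        using A B(1) by (simp add: openin_prod_Times_iff)
      show "p \<in> {x \<in> topspace T. g x \<in> ?N} \<times> B"
        using xy B maps[OF xy(2)] by auto
      show "{x \<in> topspace T. g x \<in> ?N} \<times> B \<subseteq> {p \<in> topspace (prod_topology T Y). g (fst p) (snd p) \<in> V}"
        using B openin_subset[OF B(1)] by fastforce
    qed
  qed
  moreover have "g (fst p) (snd p) \<in> topspace Z" if "p \<in> topspace (prod_topology T Y)" for p
    using that maps by (force simp: continuous_maps_def continuous_map_def Pi_iff)
  ultimately show ?thesis by (simp add: continuous_map_def)
qed

lemma unit_interval_base: "neighbourhood_base_of (compactin unit_interval) unit_interval"
proof (rule locally_compact_imp_neighbourhood_base)
  have "compact_space unit_interval" by (simp add: compact_space_subtopology)
  moreover have "Hausdorff_space unit_interval" by (intro Hausdorff_space_subtopology) simp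
  ultimately show "locally_compact_space unit_interval" "regular_space unit_interval"
    by (auto intro: compact_imp_locally_compact_space compact_Hausdorff_imp_regular_space)
qed

lemma path_space_topspace: "g \<in> topspace (path_space Z) \<longleftrightarrow> g \<in> extensional {0..1} \<and> continuous_map unit_interval Z g"
  by (auto simp: path_space_def continuous_maps_def)

lemma isometry_homeomorphic_maps:
  fixes X :: "'a metric" and Z :: "'b metric"
  assumes e: "\<And>x. x \<in> mspace X \<Longrightarrow> e x \<in> mspace Z"
    and iso: "\<And>x y. x \<in> mspace X \<Longrightarrow> y \<in> mspace X \<Longrightarrow> mdist Z (e x) (e y) = mdist X x y"
  shows "homeomorphic_maps (mtopology_of X) (subtopology (mtopology_of Z) (e ` mspace X)) e (inv_into (mspace X) e)"
proof -
  have inj: "inj_on e (mspace X)"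
    using iso e by (intro inj_onI) (metis mdist_zero)
  let ?S = "submetric Z (e ` mspace X)"
  have sp: "mspace ?S = e ` mspace X" using e by auto
  have inv: "inv_into (mspace X) e (e x) = x" if "x \<in> mspace X" for x
    using inj that by (rule inv_into_f_f)
  have S: "subtopology (mtopology_of Z) (e ` mspace X) = mtopology_of ?S"
    by (simp add: mtopology_of_submetric)
  have "Lipschitz_continuous_map X ?S e"
    unfolding Lipschitz_continuous_map_def sp using iso by (intro conjI exI[of _ 1]) auto
  moreover have "Lipschitz_continuous_map ?S X (inv_into (mspace X) e)"
    unfolding Lipschitz_continuous_map_def sp using iso inv by (intro conjI exI[of _ 1]) auto
  ultimately show ?thesis
    unfolding homeomorphic_maps_def S
    using inv sp by (auto intro!: Lipschitz_continuous_imp_continuous_map)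
qed

section \<open>The completion\<close>

text \<open>An upper bound for the distances suffices, because by the triangle inequality the three parts
  into which \<open>t\<close> and \<open>t'\<close> divide the path have to make up for the
  whole distance.\<close>

lemma geodesic_I:
  assumes ext: "g \<in> extensional {0..1}" and m: "\<And>t. t \<in> {0..1} \<Longrightarrow> g t \<in> mspace m"
    and ends: "g 0 = x" "g 1 = y"
    and le: "\<And>t t'. t \<in> {0..1} \<Longrightarrow> t' \<in> {0..1} \<Longrightarrow> mdist m (g t) (g t') \<le> \<bar>t - t'\<bar> * mdist m x y"
  shows "geodesic m x y g"
proof -
  have "continuous_map (top_of_set {0..1}) (mtopology_of m) g"
  proof (rule continuous_map_into_metric_tendsto)
    fix t :: real assume t: "t \<in> {0..1}"
    have ev: "\<forall>\<^sub>F u in at t within {0..1}. norm (mdist m (g u) (g t)) \<le> \<bar>u - t\<bar> * mdist m x y"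
      using le t by (auto simp: eventually_at_filter)
    have "((\<lambda>u. \<bar>u - t\<bar> * mdist m x y) \<longlongrightarrow> \<bar>t - t\<bar> * mdist m x y) (at t within {0..1})"
      by (intro tendsto_intros)
    then show "((\<lambda>u. mdist m (g u) (g t)) \<longlongrightarrow> 0) (at t within {0..1})"
      using Lim_null_comparison[OF ev] by simp
  qed (use m in auto)
  then have "g \<in> paths_between (mtopology_of m) x y"
    using ext ends by (simp add: paths_between_def path_space_topspace)
  moreover have "mdist m (g t) (g t') = \<bar>t - t'\<bar> * mdist m x y" if t: "t \<in> {0..1}" "t' \<in> {0..1}" for t t'
  proof -
    have *: "mdist m (g t) (g t') = (t' - t) * mdist m x y" if t: "0 \<le> t" "t \<le> t'" "t' \<le> 1" for t t'
    proof -
      have "mdist m x y \<le> mdist m (g 0) (g t) + mdist m (g t) (g t') + mdist m (g t') (g 1)"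
        using mdist_triangle[of "g 0" m "g t" "g 1"] mdist_triangle[of "g t" m "g t'" "g 1"] m t ends by auto
      moreover have "mdist m (g 0) (g t) \<le> t * mdist m x y" "mdist m (g t') (g 1) \<le> (1 - t') * mdist m x y"
        "mdist m (g t) (g t') \<le> (t' - t) * mdist m x y"
        using le[of 0 t] le[of t' 1] le[of t t'] t by auto
      ultimately show ?thesis by (simp add: algebra_simps)
    qed
    show ?thesis
      using *[of t t'] *[of t' t] t mdist_commute[of m "g t" "g t'"] by (cases "t \<le> t'") auto
  qed
  ultimately show ?thesis by (simp add: geodesic_def)
qed

lemma closed_link: "closed link"
proof -
  have eq: "link = {q. norm (fst q) = 1} \<inter> {q. 0 \<le> snd q} \<inter> {q. snd q \<le> pi / 4} \<inter> {q. complex_of_real (snd q) * (fst q ^ 6 - 1) = 0}"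
    by (auto simp: link_def)
  show ?thesis
    unfolding eq by (intro closed_Int closed_Collect_eq closed_Collect_le continuous_intros)
qed

lemma closed_region: "closed (region l)"
proof (rule closed_sequential_limits[THEN iffD2], clarify)
  fix p :: "nat \<Rightarrow> cone_point" and r w b
  assume p: "\<forall>n. p n \<in> region l" and lim: "p \<longlonglongrightarrow> (r, w, b)"
  have pc: "p n \<in> link_cone" for n using p by (auto simp: region_def)
  have pl: "snd (p n) \<in> link" for n using link_cone_D(2)[OF pc] .
  have l1: "(\<lambda>n. fst (p n)) \<longlonglongrightarrow> r" and l2: "(\<lambda>n. snd (p n)) \<longlonglongrightarrow> (w, b)"
    using tendsto_fst[OF lim] tendsto_snd[OF lim] by auto
  have r: "0 \<le> r" using l1 pc by (intro LIMSEQ_le_const[OF l1]) (auto dest: link_cone_D)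
  have w: "(w, b) \<in> link"
    by (rule closed_sequentially[OF closed_link _ l2]) (use pl in auto)
  have "r * trunc_cos (vertex_dist (w, b) k) \<le> l k" for k
  proof (rule LIMSEQ_le_const2)
    have "(\<lambda>n. vertex_dist (snd (p n)) k) \<longlonglongrightarrow> vertex_dist (w, b) k"
      by (rule tendsto_link_dist_both[OF l2 w]) (use pl in auto)
    then show "(\<lambda>n. fst (p n) * trunc_cos (vertex_dist (snd (p n)) k))
        \<longlonglongrightarrow> r * trunc_cos (vertex_dist (w, b) k)"
      by (intro tendsto_intros l1)
    show "\<exists>N. \<forall>n\<ge>N. fst (p n) * trunc_cos (vertex_dist (snd (p n)) k) \<le> l k"
      using p by (auto simp: region_def)
  qed
  then show "(r, w, b) \<in> region l" using r w by (simp add: region_def link_cone_def)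
qed

context arms
begin

abbreviation "R \<equiv> region (arm_length L)"

text \<open>The radius is at most the sum of the distances of the two points from the essential vertex.\<close>

lemma region_radius_le:
  assumes p: "p \<in> R" shows "fst p \<le> 2 * sum L UNIV"
proof -
  have pc: "p \<in> link_cone" using p by (simp add: region_def)
  note P = link_cone_D[OF pc]
  have K: "L i \<le> sum L UNIV" for i using L_nonneg by (intro member_le_sum) auto
  obtain k b \<psi> where b: "b \<in> {1, 3, 5}" and sp: "snd p = star_point k b \<psi>" and \<psi>: "0 \<le> \<psi>" "\<psi> < pi / 2"
    and "b = 3 \<longrightarrow> \<psi> = snd (snd p)"
    by (rule star_form_ex[OF P(2)])
  have p_eq: "p = (fst p, star_point k b \<psi>)" using sp by (metis prod.collapse)
  have n: "(k + b) mod 6 \<noteq> k mod 6" using b shift_mod_6[of k] by auto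
  have "leg k p = fst p * cos \<psi>" "leg (k + b) p = fst p * sin \<psi>"
    by (subst p_eq, simp add: leg_star[OF b \<psi>] n)+
  then have le: "fst p * cos \<psi> \<le> sum L UNIV" "fst p * sin \<psi> \<le> sum L UNIV"
    using leg_le_arm[OF p, of k] leg_le_arm[OF p, of "k + b"] K order_trans by metis+
  have c: "0 \<le> cos \<psi>" "0 \<le> sin \<psi>" using \<psi> by (auto intro!: cos_ge_zero sin_ge_zero)
  have "1 = sin \<psi> * sin \<psi> + cos \<psi> * cos \<psi>"
    using sin_cos_squared_add[of \<psi>] by (simp add: power2_eq_square)
  also have "\<dots> \<le> sin \<psi> * 1 + cos \<psi> * 1" using c by (intro add_mono mult_left_mono) auto
  finally have "fst p * 1 \<le> fst p * (sin \<psi> + cos \<psi>)" using P by (intro mult_left_mono) auto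
  then show ?thesis using le by (simp add: distrib_left)
qed

lemma compact_region: "compact R"
proof -
  have "R \<subseteq> {0..2 * sum L UNIV} \<times> (cball 0 1 \<times> {0..pi / 4})"
  proof
    fix p assume p: "p \<in> R"
    then have pc: "p \<in> link_cone" by (simp add: region_def)
    note P = link_cone_D[OF pc] and Q = link_D[OF link_cone_D(2)[OF pc]]
    show "p \<in> {0..2 * sum L UNIV} \<times> (cball 0 1 \<times> {0..pi / 4})"
      using region_radius_le[OF p] P Q by (auto simp: mem_Times_iff)
  qed
  moreover have "bounded ({0..2 * sum L UNIV} \<times> (cball (0::complex) 1 \<times> {0..pi / 4}))"
    by (intro bounded_Times) auto
  ultimately show ?thesis
    using closed_region bounded_subset by (auto simp: compact_eq_bounded_closed)
qed

text \<open>The apex is approached along a ray, and a point of height \<open>pi / 4\<close> from below in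
  its fin. In the latter case the radius is adjusted such that the farther point does not move
  off the end of its arm.\<close>

lemma config_cone_dense:
  assumes p: "p \<in> R" and e: "0 < e"
  shows "\<exists>q\<in>config_cone L. cone_dist p q < e"
proof -
  have pc: "p \<in> link_cone" using p by (simp add: region_def)
  note P = link_cone_D[OF pc] and Q = link_D[OF link_cone_D(2)[OF pc]]
  consider "fst p = 0" | "0 < fst p" "snd (snd p) < pi / 4" | "0 < fst p" "snd (snd p) = pi / 4"
    using P Q by fastforce
  then show ?thesis
  proof cases
    case 1
    define q :: "cone_point" where "q = (min 1 (e / 2), vertex 0, 0)"
    have qc: "q \<in> link_cone" using e by (simp add: q_def link_cone_def)
    have "q \<in> R" unfolding q_def
      by (rule region_near_apex) (use qc arm_length_ge[OF L] in \<open>auto simp: q_def\<close>)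
    then have "q \<in> config_cone L" using e by (simp add: config_cone_def q_def)
    moreover have "cone_dist p q = fst q" using 1 qc by (simp add: cone_dist_apex link_cone_D)
    moreover have "fst q < e" using e by (simp add: q_def)
    ultimately show ?thesis by force
  next
    case 2
    then show ?thesis using p e by (intro bexI[of _ p]) (auto simp: config_cone_def)
  next
    case 3
    define w b r where "w = fst (snd p)" and "b = snd (snd p)" and "r = fst p"
    have p_eq: "p = (r, w, b)" by (simp add: w_def b_def r_def)
    have b: "b = pi / 4" and r: "0 < r" using 3 by (auto simp: b_def r_def)
    have w: "norm w = 1" "w ^ 6 = 1" using Q 3 by (auto simp: w_def)
    define c where "c n = b * (1 - 1 / real (n + 2))" for n
    \<comment> \<open>The farther point stays at the distance \<open>r * cos b\<close> from the essential vertex.\<close>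
    define q where "q n = (r * cos b / cos (c n), w, c n)" for n
    have c: "0 \<le> c n" "c n < b" for n
    proof -
      have "0 \<le> 1 - 1 / real (n + 2)" "1 - 1 / real (n + 2) < 1" by auto
      moreover have "0 < b" unfolding b by simp
      ultimately show "0 \<le> c n" "c n < b"
        unfolding c_def using mult_strict_left_mono[of "1 - 1 / real (n + 2)" 1 b] by auto
    qed
    have cosb: "0 < cos b" "cos b \<le> cos (c n)" for n
      using b c[of n] pi_gt_zero by (auto intro!: cos_gt_zero_pi cos_monotone_0_pi_le)
    then have cosc: "0 < cos (c n)" for n using less_le_trans by blast
    have ql: "(w, c n) \<in> link" for n using c[of n] b w by (intro link_I) auto
    have qc: "q n \<in> link_cone" for n
      using ql[of n] r cosb cosc[of n] by (simp add: q_def link_cone_def)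
    have "q n \<in> R" for n
    proof -
      have "fst (q n) * trunc_cos (vertex_dist (snd (q n)) k) \<le> L (of_nat k)" for k
      proof (cases "w = vertex k")
        case True
        have "min (pi / 2) (vertex_dist (w, c n) k) = c n"
          using True c[of n] b by (simp add: link_dist_def)
        then have "fst (q n) * trunc_cos (vertex_dist (snd (q n)) k) = r * cos b"
          using cosc[of n] by (simp add: q_def)
        also have "\<dots> = fst p * trunc_cos (vertex_dist (snd p) k)"
        proof -
          have "min (pi / 2) \<bar>b\<bar> = b" unfolding b using pi_gt_zero by linarith
          then show ?thesis using True by (simp add: p_eq link_dist_def)
        qed
        also have "\<dots> \<le> L (of_nat k)" using p by (simp add: region_def)
        finally show ?thesis .
      next
        case False
        then have "circ_dist w (vertex k) \<ge> pi / 2" using circ_dist_sixth_roots w by simp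
        then have "min (pi / 2) (vertex_dist (w, c n) k) = pi / 2"
          using c[of n] by (simp add: link_dist_vertex[OF ql])
        then show ?thesis using L_nonneg by (simp add: q_def)
      qed
      then show ?thesis using qc by (simp add: region_def)
    qed
    moreover have "c n < pi / 4" for n using c(2)[of n] unfolding b .
    ultimately have qR: "q n \<in> config_cone L" for n
      using r cosb(1) cosc[of n] by (simp add: config_cone_def q_def)
    have "(\<lambda>n. c n) \<longlonglongrightarrow> b * (1 - 0)"
      unfolding c_def by (intro tendsto_intros LIMSEQ_ignore_initial_segment[OF lim_1_over_n])
    then have cl: "c \<longlonglongrightarrow> b" by simp
    have "q \<longlonglongrightarrow> (r * cos b / cos b, w, b)"
      unfolding q_def[abs_def] using cosb by (intro tendsto_intros cl) auto
    then have "q \<longlonglongrightarrow> p" using cosb by (simp add: p_eq)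
    then have "(\<lambda>n. cone_dist (q n) p) \<longlonglongrightarrow> 0"
      by (rule tendsto_cone_dist) (use pc qc in auto)
    then have "\<forall>\<^sub>F n in sequentially. cone_dist (q n) p < e" using e by (rule order_tendstoD)
    then obtain n where "cone_dist (q n) p < e" by (auto simp: eventually_sequentially)
    then show ?thesis using qR cone_dist_commute[OF qc pc] by metis
  qed
qed

abbreviation "Xc \<equiv> metric_completion X"

definition base_point where "base_point = (SOME a. a \<in> mspace X)"

text \<open>The Kuratowski embedding, extended from the configurations to the region by means of the cone
  metric.\<close>

definition complete_point :: "cone_point \<Rightarrow> config \<Rightarrow> real" where
  "complete_point p = (\<lambda>u \<in> mspace X. cone_dist p (polar u) - cone_dist (polar base_point) (polar u))"

lemma config_nonempty: "cart (1, vertex 0, 0) \<in> mspace M"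
proof -
  have "(1, vertex 0, 0) \<in> R"
    by (rule region_near_apex) (auto simp: link_cone_def intro: arm_length_ge[OF L])
  then show ?thesis by (intro cart_in_config) (simp add: config_cone_def)
qed

lemma base_point_in: "base_point \<in> mspace M"
  unfolding base_point_def mspace_X using config_nonempty by (rule someI)

lemma completion_embedding_polar:
  assumes "f \<in> mspace M" shows "completion_embedding X f = complete_point (polar f)"
  unfolding completion_embedding_def complete_point_def base_point_def[symmetric]
  using assms base_point_in by (intro restrict_ext) (simp add: mdist_X)

lemma region_link_cone: "p \<in> R \<Longrightarrow> p \<in> link_cone"
  by (simp add: region_def)

lemma cone_dist_diff_le:
  assumes "p \<in> link_cone" "q \<in> link_cone" "u \<in> link_cone"
  shows "\<bar>cone_dist p u - cone_dist q u\<bar> \<le> cone_dist p q"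
  using cone_dist_triangle[of p q u] cone_dist_triangle[of q p u] cone_dist_commute[of p q] assms by auto

lemma complete_point_fspace:
  assumes p: "p \<in> R"
  shows "complete_point p \<in> mspace (funspace (mspace X) euclidean_metric)"
proof -
  have "(\<lambda>u. cone_dist p (polar u) - cone_dist (polar base_point) (polar u)) ` mspace X
      \<subseteq> cball 0 (cone_dist p (polar base_point))"
  proof (rule image_subsetI)
    fix u assume "u \<in> mspace X"
    then have "polar u \<in> link_cone" using polar_link_cone by simp
    then show "cone_dist p (polar u) - cone_dist (polar base_point) (polar u) \<in> cball 0 (cone_dist p (polar base_point))"
      using cone_dist_diff_le[OF region_link_cone[OF p] polar_link_cone[OF base_point_in]]
      by (simp add: dist_real_def abs_minus_commute)
  qed
  then have "bounded ((\<lambda>u. cone_dist p (polar u) - cone_dist (polar base_point) (polar u)) ` mspace X)"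
    by (rule bounded_subset[OF bounded_cball])
  then have "bounded (complete_point p ` mspace X)"
    unfolding complete_point_def image_restrict_eq .
  moreover have "complete_point p \<in> extensional (mspace X)" by (simp add: complete_point_def)
  ultimately show ?thesis
    by (simp add: Met_TC.fspace_def)
qed

lemma fdist_complete_point:
  assumes p: "p \<in> R" and q: "q \<in> R"
  shows "mdist (funspace (mspace X) euclidean_metric) (complete_point p) (complete_point q) = cone_dist p q"
proof -
  note pc = region_link_cone[OF p] and qc = region_link_cone[OF q]
  let ?D = "\<lambda>u. dist (complete_point p u) (complete_point q u)"
  have D: "?D u = \<bar>cone_dist p (polar u) - cone_dist q (polar u)\<bar>" if "u \<in> mspace X" for u
    using that by (simp add: complete_point_def dist_real_def)
  have le: "?D u \<le> cone_dist p q" if "u \<in> mspace X" for u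
    unfolding D[OF that] using that by (intro cone_dist_diff_le pc qc polar_link_cone) simp
  have ne: "mspace X \<noteq> {}" using base_point_in by auto
  have "(SUP u\<in>mspace X. ?D u) = cone_dist p q"
  proof (rule antisym)
    show "(SUP u\<in>mspace X. ?D u) \<le> cone_dist p q" using ne le by (intro cSUP_least) auto
    show "cone_dist p q \<le> (SUP u\<in>mspace X. ?D u)"
    proof (rule field_le_epsilon)
      fix e :: real assume e: "0 < e"
      obtain v where v: "v \<in> config_cone L" "cone_dist q v < e / 2" using config_cone_dense[OF q, of "e / 2"] e by auto
      have u: "cart v \<in> mspace X" "polar (cart v) = v" using v cart_in_config polar_cart by auto
      have "cone_dist p q \<le> cone_dist p v + cone_dist q v"
        using cone_dist_triangle[of p v q] cone_dist_commute[of v q] pc qc config_cone_D(1)[OF v(1)] by auto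
      then have "cone_dist p q - e \<le> ?D (cart v)" unfolding D[OF u(1)] u(2) using v(2) by linarith
      also have "\<dots> \<le> (SUP u\<in>mspace X. ?D u)"
        using u(1) le by (intro cSUP_upper bdd_aboveI2) auto
      finally show "cone_dist p q \<le> (SUP u\<in>mspace X. ?D u) + e" by simp
    qed
  qed
  then show ?thesis
    using complete_point_fspace[OF p] complete_point_fspace[OF q] ne by (auto simp: Met_TC.fdist_def)
qed

lemma mdist_Xc:
  assumes "p \<in> R" "q \<in> R"
  shows "mdist Xc (complete_point p) (complete_point q) = cone_dist p q"
  using fdist_complete_point[OF assms] by (simp add: metric_completion_def)

lemma complete_point_in:
  assumes p: "p \<in> R" shows "complete_point p \<in> mspace Xc"
proof -
  let ?F = "funspace (mspace X) (euclidean_metric :: real metric)"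
  interpret F: Metric_space "mspace ?F" "mdist ?F" by (rule Metric_space_mspace_mdist)
  have "complete_point p \<in> F.mtopology closure_of (completion_embedding X ` mspace X)"
    unfolding F.metric_closure_of
  proof (intro CollectI conjI allI impI)
    show "complete_point p \<in> mspace ?F" by (rule complete_point_fspace[OF p])
    fix r :: real assume "0 < r"
    then obtain v where v: "v \<in> config_cone L" "cone_dist p v < r" using config_cone_dense[OF p] by blast
    have vR: "v \<in> R" using v by (simp add: config_cone_def)
    have "completion_embedding X (cart v) = complete_point v"
      using completion_embedding_polar[OF cart_in_config[OF v(1)]] polar_cart[OF v(1)] by simp
    moreover have "complete_point v \<in> F.mball (complete_point p) r"
      using v complete_point_fspace[OF p] complete_point_fspace[OF vR] fdist_complete_point[OF p vR]
      unfolding F.in_mball by metis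
    ultimately show "\<exists>y\<in>completion_embedding X ` mspace X. y \<in> F.mball (complete_point p) r"
      using cart_in_config[OF v(1)] by (metis imageI mspace_X)
  qed
  then show ?thesis
    using complete_point_fspace[OF p] by (simp add: metric_completion_def mtopology_of_def)
qed

lemma continuous_complete_point: "continuous_map (top_of_set R) (mtopology_of Xc) complete_point"
proof (rule continuous_map_into_metric_tendsto)
  fix p assume p: "p \<in> R"
  have ev: "\<forall>\<^sub>F q in at p within R. q \<in> R" by (auto simp: eventually_at_filter)
  have "((\<lambda>q. cone_dist q p) \<longlongrightarrow> 0) (at p within R)"
    by (rule tendsto_cone_dist) (use ev region_link_cone p in \<open>auto intro: tendsto_ident_at elim!: eventually_mono\<close>)
  then show "((\<lambda>q. mdist Xc (complete_point q) (complete_point p)) \<longlongrightarrow> 0) (at p within R)"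
    by (rule Lim_transform_eventually) (use eventually_mono[OF ev mdist_Xc[OF _ p, symmetric]] in auto)
qed (rule complete_point_in)

lemma Hausdorff_Xc: "Hausdorff_space (mtopology_of Xc)"
  unfolding mtopology_of_def by (intro Metric_space.Hausdorff_space_mtopology) simp

lemma closedin_complete_point:
  assumes "closed S" "S \<subseteq> R"
  shows "closedin (mtopology_of Xc) (complete_point ` S)"
proof (rule compactin_imp_closedin[OF Hausdorff_Xc])
  have "compact S" using compact_Int_closed[OF compact_region assms(1)] assms(2) by (simp add: Int_absorb1)
  then have "compactin (top_of_set R) S" using assms by (simp add: compactin_subtopology)
  then show "compactin (mtopology_of Xc) (complete_point ` S)"
    using continuous_complete_point by (rule image_compactin)
qed

lemma embedding_image: "completion_embedding X ` mspace X = complete_point ` config_cone L"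
proof -
  have "completion_embedding X ` mspace X = (\<lambda>f. complete_point (polar f)) ` mspace M"
    using completion_embedding_polar by (intro image_cong) auto
  also have "\<dots> = complete_point ` (polar ` mspace M)" by (simp add: image_image)
  also have "polar ` mspace M = config_cone L"
    using polar_in polar_cart cart_in_config by force
  finally show ?thesis .
qed

lemma config_cone_subset: "config_cone L \<subseteq> R"
  by (auto simp: config_cone_def)

text \<open>The image of the compact region is closed, and it contains the dense image of the space.\<close>

lemma mspace_Xc: "mspace Xc = complete_point ` R"
proof
  show "complete_point ` R \<subseteq> mspace Xc" using complete_point_in by auto
  have "mspace Xc = mtopology_of Xc closure_of (completion_embedding X ` mspace X)"
    by (rule completion_embedding_dense[symmetric])
  also have "\<dots> \<subseteq> complete_point ` R"
    unfolding embedding_image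
    using config_cone_subset by (intro closure_of_minimal image_mono closedin_complete_point closed_region) auto
  finally show "mspace Xc \<subseteq> complete_point ` R" .
qed

lemma complete_point_eq:
  assumes "p \<in> R" "q \<in> R" "cone_dist p q = 0" shows "complete_point p = complete_point q"
  using mdist_Xc[OF assms(1,2)] assms complete_point_in mdist_zero by metis

lemma geodesic_complete:
  assumes p: "p \<in> R" and q: "q \<in> R"
  shows "geodesic Xc (complete_point p) (complete_point q) (restrict (\<lambda>t. complete_point (cone_path p q 0 t)) {0..1})"
proof -
  interpret cone_pair p q 0 using region_link_cone p q by unfold_locales auto
  have reg: "cone_path p q 0 t \<in> R" if "t \<in> {0..1}" for t
    using that by (intro cone_path_in_region p q arm_length_ge[OF L]) auto
  show ?thesis
  proof (rule geodesic_I)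
    show "restrict (\<lambda>t. complete_point (cone_path p q 0 t)) {0..1} 0 = complete_point p"
      by (simp add: cone_path_start)
    show "restrict (\<lambda>t. complete_point (cone_path p q 0 t)) {0..1} 1 = complete_point q"
      using complete_point_eq[OF reg[of 1] q cone_path_end_dist] by simp
    show "mdist Xc (restrict (\<lambda>t. complete_point (cone_path p q 0 t)) {0..1} t)
        (restrict (\<lambda>t. complete_point (cone_path p q 0 t)) {0..1} t') \<le> \<bar>t - t'\<bar> * mdist Xc (complete_point p) (complete_point q)"
      if "t \<in> {0..1}" "t' \<in> {0..1}" for t t'
      using that reg cone_dist_straight[of t t'] by (simp add: mdist_Xc p q)
  qed (use reg complete_point_in in auto)
qed

lemma geodesic_space_Xc: "geodesic_space Xc"
  unfolding geodesic_space_def mspace_Xc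
proof (intro ballI)
  fix x y assume "x \<in> complete_point ` R" "y \<in> complete_point ` R"
  then obtain p q where "p \<in> R" "q \<in> R" "x = complete_point p" "y = complete_point q" by blast
  then show "\<exists>g. geodesic Xc x y g" using geodesic_complete[of p q] by blast
qed

lemma openin_embedding: "openin (mtopology_of Xc) (completion_embedding X ` mspace X)"
proof -
  let ?B = "{p \<in> R. fst p = 0 \<or> snd (snd p) = pi / 4}"
  have "?B = (R \<inter> {p. fst p = 0}) \<union> (R \<inter> {p. snd (snd p) = pi / 4})" by auto
  moreover have "closed \<dots>"
    by (intro closed_Un closed_Int closed_region closed_Collect_eq continuous_intros)
  ultimately have cl: "closedin (mtopology_of Xc) (complete_point ` ?B)"
    by (intro closedin_complete_point) auto
  have Reg: "R = config_cone L \<union> ?B"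
  proof -
    have "p \<in> config_cone L \<or> p \<in> ?B" if "p \<in> R" for p
      using that link_cone_D[OF region_link_cone[OF that]] link_D[OF link_cone_D(2)[OF region_link_cone[OF that]]]
      by (auto simp: config_cone_def)
    then show ?thesis using config_cone_subset by blast
  qed
  have nin: "complete_point q \<notin> complete_point ` ?B" if q: "q \<in> config_cone L" for q
  proof
    assume "complete_point q \<in> complete_point ` ?B"
    then obtain p where p: "p \<in> ?B" "complete_point q = complete_point p" by auto
    have qR: "q \<in> R" using q config_cone_subset by auto
    have "cone_dist p q = 0"
    proof -
      have pR: "p \<in> R" using p by simp
      have "cone_dist p q = mdist Xc (complete_point q) (complete_point q)"
        using mdist_Xc[OF pR qR] p(2) by simp
      also have "\<dots> = 0" using complete_point_in[OF qR] by simp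
      finally show ?thesis .
    qed
    then have "p = q" using p qR config_cone_D[OF q] by (intro cone_dist_0_imp_eq) (auto intro: region_link_cone)
    then show False using p q by (auto simp: config_cone_def)
  qed
  have disj: "complete_point ` config_cone L \<inter> complete_point ` ?B = {}"
  proof (rule equals0I)
    fix z assume z: "z \<in> complete_point ` config_cone L \<inter> complete_point ` ?B"
    then have "z \<in> complete_point ` config_cone L" by (rule IntD1)
    then obtain q where q: "z = complete_point q" "q \<in> config_cone L" by (rule imageE)
    from z have "z \<in> complete_point ` ?B" by (rule IntD2)
    then show False unfolding q(1) using nin[OF q(2)] by (rule notE[rotated])
  qed
  have "complete_point ` R = complete_point ` (config_cone L \<union> ?B)"
    using Reg by (rule arg_cong)
  also have "\<dots> = complete_point ` config_cone L \<union> complete_point ` ?B"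
    by (rule image_Un)
  finally have eq: "mspace Xc - complete_point ` ?B = complete_point ` config_cone L"
    unfolding mspace_Xc using disj by (simp only: Un_Diff Diff_cancel Un_empty_right Diff_triv)
  have "openin (mtopology_of Xc) (topspace (mtopology_of Xc) - complete_point ` ?B)"
    using cl by (rule openin_diff[OF openin_topspace])
  then show ?thesis
    unfolding embedding_image topspace_mtopology_of eq .
qed

lemma compact_space_Xc: "compact_space (mtopology_of Xc)"
  unfolding compact_space_def topspace_mtopology_of mspace_Xc
  using continuous_complete_point compact_region by (intro image_compactin) (auto simp: compactin_subtopology)

lemma locally_compact_X: "locally_compact_space (mtopology_of X)"
proof -
  have "locally_compact_space (mtopology_of Xc)"
    using compact_space_Xc by (rule compact_imp_locally_compact_space)
  then have "locally_compact_space (subtopology (mtopology_of Xc) (completion_embedding X ` mspace X))"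
    using Hausdorff_Xc openin_embedding by (intro locally_compact_space_open_subset) auto
  moreover have "mtopology_of X homeomorphic_space subtopology (mtopology_of Xc) (completion_embedding X ` mspace X)"
    unfolding homeomorphic_space_def
  proof (intro exI, rule isometry_homeomorphic_maps)
    show "completion_embedding X f \<in> mspace Xc" if "f \<in> mspace X" for f
      using completion_embedding_in_completion that by (rule subsetD[OF _ imageI])
  qed (rule mdist_completion_embedding)
  ultimately show ?thesis using homeomorphic_locally_compact_space by blast
qed

end

section \<open>Topological and geodesic complexity\<close>

lemma compact_open_slice:
  assumes "continuous_map T (compact_open_topology Y Z) F" "x \<in> topspace T"
  shows "continuous_map Y Z (F x)"
proof -
  have "F x \<in> topspace (compact_open_topology Y Z)"
    using continuous_map_funspace[OF assms(1)] assms(2) by (rule funcset_mem)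
  then show ?thesis by (simp add: continuous_maps_def)
qed

text \<open>The paths at parameter 1 run in the image of the space, on which the isometric embedding has a
  continuous inverse.\<close>

lemma NGMPR_imp_section:
  assumes N: "NGMPR X E \<Phi>"
  shows "\<exists>s. continuous_map (subtopology (prod_topology (mtopology_of X) (mtopology_of X)) E)
      (path_space (mtopology_of X)) s \<and> (\<forall>(x0, x1)\<in>E. s (x0, x1) \<in> paths_between (mtopology_of X) x0 x1)"
proof -
  let ?T = "subtopology (prod_topology (mtopology_of X) (mtopology_of X)) E"
  let ?Xc = "mtopology_of (metric_completion X)"
  let ?e = "completion_embedding X" and ?i = "inv_into (mspace X) (completion_embedding X)"
  have E: "E \<subseteq> mspace X \<times> mspace X" and
    cont: "continuous_map ?T (compact_open_topology unit_interval (path_space ?Xc)) \<Phi>" and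
    near: "\<And>x0 x1. (x0, x1) \<in> E \<Longrightarrow> near_geodesic X x0 x1 (\<Phi> (x0, x1))"
    using N by (auto simp: NGMPR_def)
  have hom: "homeomorphic_maps (mtopology_of X) (subtopology ?Xc (?e ` mspace X)) ?e ?i"
    using completion_embedding_in_completion[of X] mdist_completion_embedding[of _ X]
    by (intro isometry_homeomorphic_maps) auto
  have T: "topspace ?T = E" using E by auto
  have "continuous_map (prod_topology ?T unit_interval) (path_space ?Xc) (\<lambda>p. \<Phi> (fst p) (snd p))"
    by (rule continuous_map_uncurry[OF cont unit_interval_base])
  then have "continuous_map ?T (path_space ?Xc) (\<lambda>x. \<Phi> x 1)"
    using continuous_map_compose[of ?T "prod_topology ?T unit_interval" "\<lambda>x. (x, 1)" "path_space ?Xc" "\<lambda>p. \<Phi> (fst p) (snd p)"]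
    by (simp add: o_def continuous_map_pairedI)
  then have h: "continuous_map (prod_topology ?T unit_interval) ?Xc (\<lambda>p. \<Phi> (fst p) 1 (snd p))"
    unfolding path_space_def by (rule continuous_map_uncurry[OF _ unit_interval_base])
  have im: "\<Phi> x 1 t \<in> ?e ` mspace X" if "x \<in> E" "t \<in> {0..1}" for x t
  proof -
    have "\<forall>s\<in>{0<..1}. \<Phi> x s ` {0..1} \<subseteq> ?e ` mspace X"
      using near[of "fst x" "snd x"] that by (simp add: near_geodesic_def Let_def)
    then have "\<Phi> x 1 ` {0..1} \<subseteq> ?e ` mspace X" by simp
    then show ?thesis using that(2) by (rule subsetD[OF _ imageI])
  qed
  have "continuous_map (prod_topology ?T unit_interval) (subtopology ?Xc (?e ` mspace X)) (\<lambda>p. \<Phi> (fst p) 1 (snd p))"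
    unfolding continuous_map_in_subtopology using h im T by auto
  then have "continuous_map (prod_topology ?T unit_interval) (mtopology_of X) (\<lambda>p. ?i (\<Phi> (fst p) 1 (snd p)))"
    using continuous_map_compose[of _ _ "\<lambda>p. \<Phi> (fst p) 1 (snd p)" "mtopology_of X" ?i] hom
    by (simp add: homeomorphic_maps_def o_def)
  from continuous_map_curry[OF this]
  have s: "continuous_map ?T (path_space (mtopology_of X)) (\<lambda>x. restrict (\<lambda>t. ?i (\<Phi> x 1 t)) {0..1})"
    by (simp add: path_space_def)
  have b: "restrict (\<lambda>t. ?i (\<Phi> (x0, x1) 1 t)) {0..1} \<in> paths_between (mtopology_of X) x0 x1" if x: "(x0, x1) \<in> E" for x0 x1
  proof -
    have "continuous_map unit_interval (subtopology (path_space ?Xc) (paths_between ?Xc (?e x0) (?e x1))) (\<Phi> (x0, x1))"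
      using near[OF x] by (simp add: near_geodesic_def Let_def)
    then have "\<Phi> (x0, x1) 1 \<in> paths_between ?Xc (?e x0) (?e x1)"
      by (auto simp: continuous_map_in_subtopology image_subset_iff)
    then have "\<Phi> (x0, x1) 1 0 = ?e x0" "\<Phi> (x0, x1) 1 1 = ?e x1" by (auto simp: paths_between_def)
    moreover have "?i (?e x) = x" if "x \<in> mspace X" for x
      using hom that by (auto simp: homeomorphic_maps_def)
    moreover have "restrict (\<lambda>t. ?i (\<Phi> (x0, x1) 1 t)) {0..1} \<in> topspace (path_space (mtopology_of X))"
      using continuous_map_funspace[OF s] x T by (metis funcset_mem)
    moreover have "x0 \<in> mspace X" "x1 \<in> mspace X" using E x by auto
    ultimately show ?thesis unfolding paths_between_def by simp
  qed
  show ?thesis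
    by (rule exI[of _ "\<lambda>x. restrict (\<lambda>t. ?i (\<Phi> x 1 t)) {0..1}"]) (use s b in \<open>simp add: case_prod_beta\<close>, force)
qed

lemma TC_le_GC: "TC (mtopology_of X) \<le> GC X"
proof (cases "geodesic_space (metric_completion X)")
  case True
  let ?T = "prod_topology (mtopology_of X) (mtopology_of X)"
  define has_section where "has_section F \<longleftrightarrow> (\<exists>s. continuous_map (subtopology ?T F) (path_space (mtopology_of X)) s \<and>
      (\<forall>(x0, x1)\<in>F. s (x0, x1) \<in> paths_between (mtopology_of X) x0 x1))" for F
  have sec: "has_section F" if "\<exists>\<Phi>. NGMPR X F \<Phi>" for F
    using that unfolding has_section_def by (elim exE) (rule NGMPR_imp_section)
  have "(INF k \<in> {k. \<exists>E. locally_compact_partition ?T k E \<and> (\<forall>i\<le>k. has_section (E i))}. enat k)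
      \<le> (INF k \<in> {k. \<exists>E. locally_compact_partition ?T k E \<and> (\<forall>i\<le>k. \<exists>\<Phi>. NGMPR X (E i) \<Phi>)}. enat k)"
    by (rule INF_superset_mono) (use sec in \<open>auto intro: exI\<close>)
  then show ?thesis
    unfolding GC_def TC_def if_P[OF True] has_section_def .
qed (simp add: GC_def)

section \<open>Two motion planning rules\<close>

context arms
begin

text \<open>The direction with the fin collapsed to its foot.\<close>

definition direction where "direction f = fst (snd (polar f))"

lemma norm_direction: "f \<in> mspace M \<Longrightarrow> norm (direction f) = 1"
  using config_cone_D(7)[OF polar_in] by (simp add: direction_def)

lemma continuous_polar: "continuous_map (mtopology_of X) (top_of_set (config_cone L)) polar"
proof -
  interpret X: Metric_space "mspace X" "mdist X" by (rule Metric_space_mspace_mdist)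
  have "\<exists>r>0. \<forall>x. x \<in> mspace M \<and> mdist X a x < r \<longrightarrow> polar x \<in> V"
    if a: "a \<in> mspace M" and V: "open V" "polar a \<in> V" for a V
  proof (rule ccontr)
    assume "\<not> ?thesis"
    then have "\<exists>x. x \<in> mspace M \<and> mdist X a x < 1 / real (Suc n) \<and> polar x \<notin> V" for n
      by (metis of_nat_0_less_iff zero_less_Suc zero_less_divide_1_iff)
    then obtain x where x: "\<And>n. x n \<in> mspace M" "\<And>n. mdist X a (x n) < 1 / real (Suc n)" "\<And>n. polar (x n) \<notin> V"
      by metis
    have le: "norm (cone_dist (polar (x n)) (polar a)) \<le> 1 / real (Suc n)" for n
      using x(2)[of n] mdist_X[OF a x(1)] cone_dist_commute[OF polar_link_cone[OF a] polar_link_cone[OF x(1)[of n]]] by simp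
    have "(\<lambda>n. cone_dist (polar (x n)) (polar a)) \<longlonglongrightarrow> 0"
      by (rule Lim_null_comparison[OF always_eventually LIMSEQ_Suc[OF lim_1_over_n]]) (use le in auto)
    then have "(\<lambda>n. polar (x n)) \<longlonglongrightarrow> polar a"
      by (rule cone_dist_0_imp_tendsto) (use x polar_link_cone config_cone_D[OF polar_in] a in auto)
    then have "\<forall>\<^sub>F n in sequentially. polar (x n) \<in> V" using V by (rule topological_tendstoD)
    then show False using x(3) by (auto simp: eventually_sequentially)
  qed
  then have "continuous_map X.mtopology euclidean polar"
    unfolding X.continuous_map_from_metric by (auto simp: mspace_X)
  then have "continuous_map (mtopology_of X) euclidean polar"
    unfolding mtopology_of_def .
  moreover have "polar f \<in> config_cone L" if "f \<in> topspace (mtopology_of X)" for f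
    using that by (intro polar_in) simp
  ultimately show ?thesis
    unfolding continuous_map_in_subtopology by blast
qed

lemma continuous_direction: "continuous_map (mtopology_of X) euclidean direction"
proof -
  have "continuous_map (mtopology_of X) euclidean polar"
    using continuous_polar by (simp add: continuous_map_in_subtopology)
  then show ?thesis
    unfolding direction_def[abs_def]
    by (intro continuous_map_compose[of _ _ polar _ "\<lambda>p. fst (snd p)", unfolded o_def])
      (auto intro!: continuous_intros)
qed

definition pair_set :: "((complex \<times> complex) \<Rightarrow> bool) \<Rightarrow> (config \<times> config) set" where
  "pair_set Q = {(f, g). f \<in> mspace M \<and> g \<in> mspace M \<and> Q (direction f, direction g)}"

text \<open>One formula serves both sets of pairs; where it is continuous depends on the displacement of the
  directions.\<close>

definition planner where
  "planner = (\<lambda>(f, g). restrict (\<lambda>s. restrict (\<lambda>t. complete_point (cone_path (polar f) (polar g) s t)) {0..1}) {0..1})"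

lemma planner_path_in_region:
  assumes "f \<in> mspace M" "g \<in> mspace M" "s \<in> {0..1}" "t \<in> {0..1}"
  shows "cone_path (polar f) (polar g) s t \<in> R"
proof -
  note F = config_cone_D[OF polar_in[OF assms(1)]] and G = config_cone_D[OF polar_in[OF assms(2)]]
  interpret cone_pair "polar f" "polar g" s using F G assms by unfold_locales auto
  show ?thesis using assms by (intro cone_path_in_region F G arm_length_ge[OF L]) auto
qed

lemma planner_length_le:
  assumes f: "f \<in> mspace M" and g: "g \<in> mspace M" and s: "s \<in> {0..1}"
    and F: "\<And>t t'. 0 \<le> t \<Longrightarrow> t \<le> t' \<Longrightarrow> t' \<le> 1 \<Longrightarrow>
      cone_dist (cone_path (polar f) (polar g) s t) (cone_path (polar f) (polar g) s t') \<le> F t' - F t"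
  shows "path_length Xc (planner (f, g) s) \<le> ennreal (F 1 - F 0)"
  by (rule path_length_le) (use s F planner_path_in_region[OF f g s] in \<open>auto simp: planner_def mdist_Xc\<close>)

lemma cone_dist_le_planner_length:
  assumes f: "f \<in> mspace M" and g: "g \<in> mspace M" and that: "s \<in> {0..1}"
  shows "ennreal (cone_dist (polar f) (polar g)) \<le> path_length Xc (planner (f, g) s)"
proof -
  note F = config_cone_D[OF polar_in[OF f]] and G = config_cone_D[OF polar_in[OF g]]
  interpret cone_pair "polar f" "polar g" s using F G that by unfold_locales auto
  have "mdist Xc (planner (f, g) s 0) (planner (f, g) s 1) = cone_dist (polar f) (polar g)"
    using that F G by (simp add: planner_def cone_path_start cone_path_end mdist_Xc)
  then show ?thesis using path_length_ge_dist by metis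
qed

text \<open>No path is shorter than the distance of its ends, and for small parameters
  \<open>near_geodesic_bound\<close> is an upper bound that tends to this distance.\<close>

lemma planner_length_limit:
  assumes f: "f \<in> mspace M" and g: "g \<in> mspace M" and s: "range s \<subseteq> {0..1}" "s \<longlonglongrightarrow> 0"
  shows "(\<lambda>n. path_length Xc (planner (f, g) (s n))) \<longlonglongrightarrow> path_length Xc (planner (f, g) 0)"
proof -
  note F = config_cone_D[OF polar_in[OF f]] and G = config_cone_D[OF polar_in[OF g]]
  define D where "D = cone_dist (polar f) (polar g)"
  define A where "A = angle (polar f) (polar g)"
  have A0: "0 \<le> A" using F G link_dist_nonneg by (auto simp: A_def)
  have zero: "path_length Xc (planner (f, g) 0) \<le> ennreal D"
  proof -
    interpret cone_pair "polar f" "polar g" 0 using F G by unfold_locales auto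
    have "path_length Xc (planner (f, g) 0) \<le> ennreal (1 * D - 0 * D)"
    proof (rule planner_length_le[OF f g])
      show "cone_dist (cone_path (polar f) (polar g) 0 t) (cone_path (polar f) (polar g) 0 t') \<le> t' * D - t * D"
        if "0 \<le> t" "t \<le> t'" "t' \<le> 1" for t t'
        using cone_dist_straight[of t t'] that by (simp add: D_def algebra_simps)
    qed auto
    then show ?thesis by simp
  qed
  then have z: "path_length Xc (planner (f, g) 0) = ennreal D"
    using cone_dist_le_planner_length[OF f g, of 0] by (simp add: D_def antisym)
  have up: "path_length Xc (planner (f, g) r) \<le> ennreal (D + r * A)"
    if r: "r \<in> {0..1}" "A \<le> pi - r \<or> pi \<le> A" for r
  proof (cases "r = 0")
    case True
    then show ?thesis using z by simp
  next
    case False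
    interpret cone_pair "polar f" "polar g" r using F G r by unfold_locales auto
    obtain H where H: "\<And>t t'. 0 \<le> t \<Longrightarrow> t \<le> t' \<Longrightarrow> t' \<le> 1 \<Longrightarrow>
        cone_dist (cone_path (polar f) (polar g) r t) (cone_path (polar f) (polar g) r t') \<le> H t' - H t"
      "H 1 - H 0 \<le> D + r * A"
      using near_geodesic_bound r False F G unfolding A_def D_def by auto
    have "path_length Xc (planner (f, g) r) \<le> ennreal (H 1 - H 0)"
      by (rule planner_length_le[OF f g r(1) H(1)])
    also have "\<dots> \<le> ennreal (D + r * A)" by (intro ennreal_leI H(2))
    finally show ?thesis .
  qed
  have small: "\<forall>\<^sub>F n in sequentially. A \<le> pi - s n \<or> pi \<le> A"
  proof (cases "A < pi")
    case True
    then have "\<forall>\<^sub>F n in sequentially. s n < pi - A" using s(2) by (intro order_tendstoD) auto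
    then show ?thesis by eventually_elim auto
  qed auto
  have sn: "s n \<in> {0..1}" for n using s(1) by (rule subsetD) simp
  show ?thesis unfolding z
  proof (rule tendsto_sandwich)
    show "\<forall>\<^sub>F n in sequentially. ennreal D \<le> path_length Xc (planner (f, g) (s n))"
      using cone_dist_le_planner_length[OF f g sn] by (simp add: D_def)
    show "\<forall>\<^sub>F n in sequentially. path_length Xc (planner (f, g) (s n)) \<le> ennreal (D + s n * A)"
      using small by eventually_elim (rule up[OF sn])
    have "(\<lambda>n. D + s n * A) \<longlonglongrightarrow> D + 0 * A" by (intro tendsto_intros s)
    then show "(\<lambda>n. ennreal (D + s n * A)) \<longlonglongrightarrow> ennreal D" by (intro tendsto_ennrealI) simp
  qed auto
qed

text \<open>By the exponential law, used for each of the two parameters, continuity of the planner is joint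
  continuity of the paths in the cone.\<close>

lemma planner_continuous:
  assumes Q: "\<And>w w'. Q (w, w') \<Longrightarrow> norm w = 1 \<Longrightarrow> norm w' = 1 \<Longrightarrow>
    continuous (at (w, w') within {z. Q z \<and> norm (fst z) = 1 \<and> norm (snd z) = 1}) (\<lambda>z. disp (fst z) (snd z))"
  shows "continuous_map (subtopology (prod_topology (mtopology_of X) (mtopology_of X)) (pair_set Q))
    (compact_open_topology unit_interval (path_space (mtopology_of Xc))) planner"
proof -
  let ?T = "subtopology (prod_topology (mtopology_of X) (mtopology_of X)) (pair_set Q)"
  define C where "C = config_cone L"
  define S where "S = {(p, q, s, t). p \<in> C \<and> q \<in> C \<and> Q (fst (snd p), fst (snd q)) \<and> s \<in> {0..1::real} \<and> t \<in> {0..1::real}}"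
  define h where "h v = (case v of (p, q, s, t) \<Rightarrow> complete_point (cone_path p q s t))" for v
  have hR: "cone_path p q s t \<in> R" if "(p, q, s, t) \<in> S" for p q s t
    using planner_path_in_region[of "cart p" "cart q" s t] that polar_cart cart_in_config by (auto simp: S_def C_def)
  have h: "continuous_map (top_of_set S) (mtopology_of Xc) h"
  proof (rule continuous_map_into_metric_tendsto)
    show "h v \<in> mspace Xc" if "v \<in> S" for v
      using hR that complete_point_in by (cases v) (auto simp: h_def)
    fix v assume v: "v \<in> S"
    obtain p q s t where v_eq: "v = (p, q, s, t)" by (cases v)
    have pq: "p \<in> config_cone L" "q \<in> config_cone L" "Q (fst (snd p), fst (snd q))" "s \<in> {0..1}" "t \<in> {0..1}"
      using v by (auto simp: v_eq S_def C_def)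
    note P = config_cone_D[OF pq(1)] and P' = config_cone_D[OF pq(2)]
    have ev: "\<forall>\<^sub>F u in at v within S. u \<in> S" by (auto simp: eventually_at_filter)
    have id: "((\<lambda>u. u) \<longlongrightarrow> v) (at v within S)" by (rule tendsto_ident_at)
    have l1: "((\<lambda>u. fst u) \<longlongrightarrow> p) (at v within S)" using tendsto_fst[OF id] by (simp add: v_eq)
    have l2: "((\<lambda>u. fst (snd u)) \<longlongrightarrow> q) (at v within S)" using tendsto_fst[OF tendsto_snd[OF id]] by (simp add: v_eq)
    have l3: "((\<lambda>u. fst (snd (snd u))) \<longlongrightarrow> s) (at v within S)"
      using tendsto_fst[OF tendsto_snd[OF tendsto_snd[OF id]]] by (simp add: v_eq)
    have l4: "((\<lambda>u. snd (snd (snd u))) \<longlongrightarrow> t) (at v within S)"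
      using tendsto_snd[OF tendsto_snd[OF tendsto_snd[OF id]]] by (simp add: v_eq)
    let ?N = "{z. Q z \<and> norm (fst z) = 1 \<and> norm (snd z) = 1}"
    have dl: "((\<lambda>u. (fst (snd (fst u)), fst (snd (fst (snd u))))) \<longlongrightarrow> (fst (snd p), fst (snd q))) (at v within S)"
      by (intro tendsto_intros l1 l2)
    have dm: "\<forall>\<^sub>F u in at v within S. (fst (snd (fst u)), fst (snd (fst (snd u)))) \<in> ?N"
      using ev by eventually_elim (use config_cone_D(7) in \<open>auto simp: S_def C_def\<close>)
    have disp: "((\<lambda>u. disp (fst (snd (fst u))) (fst (snd (fst (snd u))))) \<longlongrightarrow> disp (fst (snd p)) (fst (snd q))) (at v within S)"
      using continuous_within_tendsto_compose[OF Q[OF pq(3) P(7) P'(7)] dm dl] by simp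
    have "((\<lambda>u. cone_dist (cone_path (fst u) (fst (snd u)) (fst (snd (snd u))) (snd (snd (snd u)))) (cone_path p q s t)) \<longlongrightarrow> 0) (at v within S)"
    proof (rule tendsto_cone_path[OF l1 l2 l3 l4 _ P(1) P'(1) pq(4,5) disp])
      show "\<forall>\<^sub>F u in at v within S. fst u \<in> link_cone \<and> fst (snd u) \<in> link_cone \<and>
          fst (snd (snd u)) \<in> {0..1} \<and> snd (snd (snd u)) \<in> {0..1}"
        using ev by eventually_elim (use config_cone_D(1) in \<open>auto simp: S_def C_def\<close>)
    qed
    moreover have "\<forall>\<^sub>F u in at v within S. cone_dist (cone_path (fst u) (fst (snd u)) (fst (snd (snd u))) (snd (snd (snd u)))) (cone_path p q s t)
        = mdist Xc (h u) (h v)"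
      using ev
    proof eventually_elim
      case (elim u)
      then show ?case using hR[of "fst u" "fst (snd u)" "fst (snd (snd u))" "snd (snd (snd u))"] hR[of p q s t] v
        by (simp add: h_def v_eq case_prod_beta mdist_Xc)
    qed
    ultimately show "((\<lambda>u. mdist Xc (h u) (h v)) \<longlongrightarrow> 0) (at v within S)" by (rule Lim_transform_eventually)
  qed
  define k where "k = (\<lambda>a :: ((config \<times> config) \<times> real) \<times> real.
     (polar (fst (fst (fst a))), polar (snd (fst (fst a))), snd (fst a), snd a))"
  let ?P = "prod_topology (prod_topology ?T unit_interval) unit_interval"
  have proj: "continuous_map ?P ?T (\<lambda>a. fst (fst a))" "continuous_map ?P unit_interval (\<lambda>a. snd (fst a))"
    "continuous_map ?P unit_interval (\<lambda>a. snd a)"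
    using continuous_map_compose[OF continuous_map_fst continuous_map_fst, unfolded o_def]
      continuous_map_compose[OF continuous_map_fst continuous_map_snd, unfolded o_def] continuous_map_snd by blast+
  have pT: "continuous_map ?T (mtopology_of X) fst" "continuous_map ?T (mtopology_of X) snd"
    using continuous_map_fst continuous_map_snd continuous_map_from_subtopology by blast+
  have pol: "continuous_map (mtopology_of X) euclidean polar"
    using continuous_polar by (simp add: continuous_map_in_subtopology)
  have p1: "continuous_map ?P euclidean (\<lambda>a. polar (fst (fst (fst a))))"
    using continuous_map_compose[OF continuous_map_compose[OF proj(1) pT(1)] pol] by (simp add: o_def)
  have p2: "continuous_map ?P euclidean (\<lambda>a. polar (snd (fst (fst a))))"
    using continuous_map_compose[OF continuous_map_compose[OF proj(1) pT(2)] pol] by (simp add: o_def)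
  have p3: "continuous_map ?P euclidean (\<lambda>a. snd (fst a))" "continuous_map ?P euclidean (\<lambda>a. snd a)"
    using proj(2,3) by (auto simp: continuous_map_in_subtopology)
  have "continuous_map ?P (prod_topology euclidean (prod_topology euclidean (prod_topology euclidean euclidean))) k"
    unfolding k_def by (intro continuous_map_pairedI p1 p2 p3)
  then have "continuous_map ?P euclidean k" by (simp add: euclidean_product_topology)
  moreover have "k a \<in> S" if "a \<in> topspace ?P" for a
    using that polar_in by (auto simp: k_def S_def C_def pair_set_def direction_def)
  ultimately have "continuous_map ?P (top_of_set S) k" by (auto simp: continuous_map_in_subtopology)
  then have "continuous_map ?P (mtopology_of Xc) (h \<circ> k)" using h by (rule continuous_map_compose)
  then have "continuous_map (prod_topology ?T unit_interval) (compact_open_topology unit_interval (mtopology_of Xc))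
      (\<lambda>a. restrict (\<lambda>t. (h \<circ> k) (a, t)) (topspace unit_interval))"
    by (rule continuous_map_curry)
  then have "continuous_map ?T (compact_open_topology unit_interval (compact_open_topology unit_interval (mtopology_of Xc)))
      (\<lambda>x. restrict (\<lambda>s. restrict (\<lambda>t. (h \<circ> k) ((x, s), t)) (topspace unit_interval)) (topspace unit_interval))"
    by (rule continuous_map_curry)
  moreover have "(\<lambda>x. restrict (\<lambda>s. restrict (\<lambda>t. (h \<circ> k) ((x, s), t)) (topspace unit_interval)) (topspace unit_interval)) = planner"
    by (auto simp: planner_def h_def k_def fun_eq_iff)
  ultimately show ?thesis by (simp add: path_space_def)
qed

text \<open>The points at distance \<open>fst p\<close> from \<open>p\<close> form a circle through the
  apex, so that those in the cone other than the apex are seen at an acute angle to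
  \<open>p\<close>.\<close>

lemma through_apex:
  assumes p: "p \<in> link_cone" "0 < fst p" and m: "m \<in> link_cone" "0 < fst m" and d: "cone_dist p m = fst p"
  shows "angle p m < pi / 2"
proof -
  let ?u = "min pi (angle p m)"
  have u: "0 \<le> ?u" "?u \<le> pi" using link_dist_nonneg link_cone_D[OF p(1)] link_cone_D[OF m(1)] by auto
  have "(fst p)\<^sup>2 = (fst p)\<^sup>2 + (fst m)\<^sup>2 - 2 * fst p * fst m * cos ?u"
    using cone_dist_squared[of p m] unfolding d .
  then have "fst m * (fst m - 2 * fst p * cos ?u) = 0"
    by (simp add: power2_eq_square right_diff_distrib mult.commute mult.left_commute)
  then have "fst m = 2 * fst p * cos ?u" using m(2) by auto
  then have "0 < cos ?u" using m(2) p(2) by (simp add: zero_less_mult_iff)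
  then have "\<not> pi / 2 \<le> ?u" using u cos_monotone_0_pi_le[of "pi / 2" ?u] pi_gt_zero by auto
  then show ?thesis using pi_gt_zero by (simp add: min_def split: if_splits)
qed

text \<open>At an angle of at least \<open>pi\<close>, the distance of \<open>f\<close> and \<open>g\<close>
  is the sum of their radii. The point that divides a geodesic accordingly would be at an acute
  angle to both, by \<open>through_apex\<close>.\<close>

lemma geodesic_imp_narrow:
  assumes f: "f \<in> mspace M" and g: "g \<in> mspace M" and c: "geodesic X f g c"
  shows "angle (polar f) (polar g) < pi"
proof (rule ccontr)
  let ?x = "polar f" and ?y = "polar g"
  assume "\<not> ?thesis"
  then have A: "min pi (angle ?x ?y) = pi" by simp
  note F = config_cone_D[OF polar_in[OF f]] and G = config_cone_D[OF polar_in[OF g]]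
  define N where "N = fst ?x + fst ?y"
  have N: "0 < N" using F G by (simp add: N_def)
  have "cone_dist ?x ?y = cmod (complex_of_real N)"
    unfolding cone_dist_def A by (simp add: N_def)
  then have D: "mdist X f g = N" using N f g by (simp add: mdist_X)
  define t where "t = fst ?x / N"
  have t: "t \<in> {0..1}" "t * N = fst ?x" "(1 - t) * N = fst ?y"
    using F G N by (auto simp: t_def N_def field_simps)
  have cm: "c r \<in> mspace M" if "r \<in> {0..1}" for r
    using c that by (auto simp: geodesic_def paths_between_def path_space_topspace continuous_map_def Pi_iff)
  have ends: "c 0 = f" "c 1 = g" using c by (auto simp: geodesic_def paths_between_def)
  have "mdist X (c 0) (c t) = \<bar>0 - t\<bar> * N" "mdist X (c 1) (c t) = \<bar>1 - t\<bar> * N"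
    using c t(1) D unfolding geodesic_def by auto
  then have d: "cone_dist ?x (polar (c t)) = fst ?x" "cone_dist ?y (polar (c t)) = fst ?y"
    using t f g cm[OF t(1)] by (simp_all add: ends mdist_X)
  note H = config_cone_D[OF polar_in[OF cm[OF t(1)]]]
  have "angle ?x (polar (c t)) < pi / 2" "angle ?y (polar (c t)) < pi / 2"
    by (rule through_apex[OF F(1,3) H(1,3) d(1)], rule through_apex[OF G(1,3) H(1,3) d(2)])
  then have "angle ?x ?y < pi"
    using link_dist_triangle[OF F(5) H(5) G(5)] link_dist_commute[OF H(5) G(5)] by linarith
  then show False using A by simp
qed

text \<open>The proviso on geodesics in the space holds because they exist for angles below
  \<open>pi\<close> only, and for these the path at parameter 0 avoids the apex.\<close>

lemma planner_NGMPR: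
  assumes Q: "\<And>w w'. Q (w, w') \<Longrightarrow> norm w = 1 \<Longrightarrow> norm w' = 1 \<Longrightarrow>
    continuous (at (w, w') within {z. Q z \<and> norm (fst z) = 1 \<and> norm (snd z) = 1}) (\<lambda>z. disp (fst z) (snd z))"
  shows "NGMPR X (pair_set Q) planner"
proof -
  let ?T = "subtopology (prod_topology (mtopology_of X) (mtopology_of X)) (pair_set Q)"
  have sub: "pair_set Q \<subseteq> mspace X \<times> mspace X" by (auto simp: pair_set_def)
  note cont = planner_continuous[of Q, OF Q]
  have key: "near_geodesic X f g (planner (f, g)) \<and>
      ((\<exists>c. geodesic X f g c) \<longrightarrow> planner (f, g) 0 ` {0..1} \<subseteq> completion_embedding X ` mspace X)"
    if fg: "(f, g) \<in> pair_set Q" for f g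
  proof
    have f: "f \<in> mspace M" and g: "g \<in> mspace M" using fg by (auto simp: pair_set_def)
    note F = config_cone_D[OF polar_in[OF f]] and G = config_cone_D[OF polar_in[OF g]]
    have e: "completion_embedding X f = complete_point (polar f)" "completion_embedding X g = complete_point (polar g)"
      using completion_embedding_polar f g by auto
    have pc: "continuous_map unit_interval (path_space (mtopology_of Xc)) (planner (f, g))"
    proof (rule compact_open_slice[OF cont])
      show "(f, g) \<in> topspace ?T" using fg f g by simp
    qed
    have geo: "geodesic Xc (complete_point (polar f)) (complete_point (polar g)) (planner (f, g) 0)"
      using geodesic_complete[OF F(2) G(2)] by (simp add: planner_def)
    have ends: "planner (f, g) s 0 = complete_point (polar f)" "planner (f, g) s 1 = complete_point (polar g)"
      if "s \<in> {0..1}" for s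
    proof -
      interpret cone_pair "polar f" "polar g" s using F G that by unfold_locales auto
      show "planner (f, g) s 0 = complete_point (polar f)" "planner (f, g) s 1 = complete_point (polar g)"
        using that G by (auto simp: planner_def cone_path_start cone_path_end)
    qed
    have inX: "planner (f, g) s ` {0..1} \<subseteq> completion_embedding X ` mspace X"
      if "s \<in> {0..1}" "0 < s \<or> angle (polar f) (polar g) < pi" for s
      unfolding embedding_image using that
      by (auto simp: planner_def intro!: imageI cone_path_in_config_cone polar_in f g L)
    show "near_geodesic X f g (planner (f, g))"
      unfolding near_geodesic_def Let_def e
    proof (intro conjI allI impI ballI)
      show "continuous_map unit_interval (subtopology (path_space (mtopology_of Xc))
          (paths_between (mtopology_of Xc) (complete_point (polar f)) (complete_point (polar g)))) (planner (f, g))"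
        unfolding continuous_map_in_subtopology
        using pc ends by (auto simp: paths_between_def continuous_map_def Pi_iff)
      show "geodesic Xc (complete_point (polar f)) (complete_point (polar g)) (planner (f, g) 0)" by (rule geo)
      show "planner (f, g) s ` {0..1} \<subseteq> completion_embedding X ` mspace X" if "s \<in> {0<..1}" for s
        using inX[of s] that by auto
      show "(\<lambda>n. path_length Xc (planner (f, g) (s n))) \<longlonglongrightarrow> path_length Xc (planner (f, g) 0)"
        if "range s \<subseteq> {0..1} \<and> s \<longlonglongrightarrow> 0" for s
        using planner_length_limit[OF f g] that by blast
    qed
    show "(\<exists>c. geodesic X f g c) \<longrightarrow> planner (f, g) 0 ` {0..1} \<subseteq> completion_embedding X ` mspace X"
    proof
      assume "\<exists>c. geodesic X f g c"
      then obtain c where c: "geodesic X f g c" ..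
      have "angle (polar f) (polar g) < pi"
        by (rule geodesic_imp_narrow[OF f g c])
      then show "planner (f, g) 0 ` {0..1} \<subseteq> completion_embedding X ` mspace X" using inX by simp
    qed
  qed
  show ?thesis unfolding NGMPR_def
  proof (intro conjI sub cont ballI)
    fix a assume a: "a \<in> pair_set Q"
    show "case a of (f, g) \<Rightarrow> near_geodesic X f g (planner (f, g)) \<and>
        ((\<exists>c. geodesic X f g c) \<longrightarrow> planner (f, g) 0 ` {0..1} \<subseteq> completion_embedding X ` mspace X)"
      using key[of "fst a" "snd a"] a unfolding case_prod_beta prod.collapse by simp
  qed
qed

lemma locally_compact_pairs: "locally_compact_space (prod_topology (mtopology_of X) (mtopology_of X))"
  using locally_compact_X by (simp add: locally_compact_space_prod_topology)

lemma Hausdorff_X: "Hausdorff_space (mtopology_of X)"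
  unfolding mtopology_of_def by (rule Metric_space.Hausdorff_space_mtopology[OF Metric_space_mspace_mdist])

lemma continuous_direction_sum:
  "continuous_map (prod_topology (mtopology_of X) (mtopology_of X)) euclidean (\<lambda>a. direction (fst a) + direction (snd a))"
  by (intro continuous_map_add continuous_map_compose[OF continuous_map_fst continuous_direction, unfolded o_def]
      continuous_map_compose[OF continuous_map_snd continuous_direction, unfolded o_def])

abbreviation "not_opposite \<equiv> (\<lambda>(w :: complex, w'). w + w' \<noteq> 0)"
abbreviation "opposite \<equiv> (\<lambda>(w :: complex, w'). w + w' = 0)"

lemma closedin_opposite: "closedin (prod_topology (mtopology_of X) (mtopology_of X)) (pair_set opposite)"
proof -
  have "closedin (prod_topology (mtopology_of X) (mtopology_of X))
      {a \<in> topspace (prod_topology (mtopology_of X) (mtopology_of X)). direction (fst a) + direction (snd a) \<in> {0}}"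
    by (rule closedin_continuous_map_preimage[OF continuous_direction_sum]) simp
  moreover have "{a \<in> topspace (prod_topology (mtopology_of X) (mtopology_of X)). direction (fst a) + direction (snd a) \<in> {0}} = pair_set opposite"
    by (auto simp: pair_set_def)
  ultimately show ?thesis by simp
qed

lemma openin_not_opposite: "openin (prod_topology (mtopology_of X) (mtopology_of X)) (pair_set not_opposite)"
proof -
  have "pair_set not_opposite = topspace (prod_topology (mtopology_of X) (mtopology_of X)) - pair_set opposite"
    by (auto simp: pair_set_def)
  then show ?thesis using closedin_opposite by (metis closedin_def)
qed

lemma opposite_quotient: "w \<noteq> 0 \<Longrightarrow> (w :: complex) + w' = 0 \<Longrightarrow> w' / w = -1"
  by (metis add.commute add_eq_0_iff divide_self minus_divide_left)

text \<open>The displacement is continuous off the antipodal pairs, and constant on them.\<close>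

lemma GC_le_1: "GC X \<le> 1"
proof -
  define E where "E i = (if i = (0::nat) then pair_set not_opposite else pair_set opposite)" for i
  let ?T = "prod_topology (mtopology_of X) (mtopology_of X)"
  have "locally_compact_partition ?T 1 E"
    unfolding locally_compact_partition_def
  proof (intro conjI allI impI)
    have "{..1} = {0, 1 :: nat}" by auto
    then show "(\<Union>i\<le>1. E i) = topspace ?T" by (auto simp: E_def pair_set_def)
    show "disjoint_family_on E {..1}"
      by (auto simp: disjoint_family_on_def E_def pair_set_def)
    show "locally_compact_space (subtopology ?T (E i))" for i
    proof (cases "i = 0")
      case True
      then show ?thesis
        using locally_compact_pairs openin_not_opposite Hausdorff_X
        by (auto simp: E_def Hausdorff_space_prod_topology intro!: locally_compact_space_open_subset)
    next
      case False
      then show ?thesis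
        using locally_compact_pairs closedin_opposite by (auto simp: E_def intro!: locally_compact_space_closed_subset)
    qed
  qed
  moreover have "\<exists>\<Phi>. NGMPR X (E i) \<Phi>" for i
  proof (cases "i = 0")
    case True
    have "NGMPR X (pair_set not_opposite) planner"
    proof (rule planner_NGMPR)
      fix w w' :: complex assume w: "not_opposite (w, w')" "norm w = 1" "norm w' = 1"
      have nz: "w \<noteq> 0" using w by auto
      have "w' / w \<notin> \<real>\<^sub>\<le>\<^sub>0"
      proof
        assume "w' / w \<in> \<real>\<^sub>\<le>\<^sub>0"
        then obtain r where r: "w' / w = of_real r" "r \<le> 0" by (auto elim: nonpos_Reals_cases)
        then have "\<bar>r\<bar> = 1" using w norm_divide[of w' w] by simp
        then have "w' / w = -1" using r by (simp add: abs_if split: if_splits)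
        then have "w' = - w" using nz by (simp add: field_simps)
        then show False using w(1) by simp
      qed
      then show "continuous (at (w, w') within {z. not_opposite z \<and> norm (fst z) = 1 \<and> norm (snd z) = 1}) (\<lambda>z. disp (fst z) (snd z))"
        unfolding disp_def continuous_within using nz
        by (auto intro!: tendsto_intros tendsto_fst[OF tendsto_ident_at, of "(w, w')", simplified] tendsto_snd[OF tendsto_ident_at, of "(w, w')", simplified])
    qed
    then show ?thesis using True by (auto simp: E_def)
  next
    case False
    have "NGMPR X (pair_set opposite) planner"
    proof (rule planner_NGMPR)
      fix w w' :: complex assume w: "opposite (w, w')" "norm w = 1" "norm w' = 1"
      let ?S = "{z. opposite z \<and> norm (fst z) = 1 \<and> norm (snd z) = 1}"
      have c: "disp (fst z) (snd z) = 3 / 2 * Arg (-1)" if "z \<in> ?S" for z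
      proof -
        have "fst z \<noteq> 0" "fst z + snd z = 0" using that by auto
        then show ?thesis unfolding disp_def using opposite_quotient by metis
      qed
      have "continuous_on ?S (\<lambda>z. disp (fst z) (snd z))"
        using c by (subst continuous_on_cong[OF refl c]) auto
      then show "continuous (at (w, w') within ?S) (\<lambda>z. disp (fst z) (snd z))"
        using w by (simp add: continuous_on_eq_continuous_within)
    qed
    then show ?thesis using False by (auto simp: E_def)
  qed
  ultimately have "1 \<in> {k. \<exists>E. locally_compact_partition ?T k E \<and> (\<forall>i\<le>k. \<exists>\<Phi>. NGMPR X (E i) \<Phi>)}" by blast
  then have "(INF k \<in> {k. \<exists>E. locally_compact_partition ?T k E \<and> (\<forall>i\<le>k. \<exists>\<Phi>. NGMPR X (E i) \<Phi>)}. enat k) \<le> enat 1"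
    by (rule INF_lower)
  then show ?thesis using geodesic_space_Xc by (simp add: GC_def one_enat_def)
qed

section \<open>The configuration space is not contractible\<close>

definition loop where "loop w = cart (1, w, 0)"

lemma loop_in: assumes "norm w = 1" shows "(1, w, 0) \<in> config_cone L"
proof -
  have "(1, w, 0) \<in> R"
    using assms by (intro region_near_apex arm_length_ge[OF L]) (auto simp: link_cone_def intro: link_I)
  then show ?thesis by (simp add: config_cone_def)
qed

lemma direction_loop: "norm w = 1 \<Longrightarrow> direction (loop w) = w"
  using polar_cart[OF loop_in] by (simp add: direction_def loop_def)

lemma loop_config: "norm w = 1 \<Longrightarrow> loop w \<in> mspace M"
  using cart_in_config[OF loop_in] by (simp add: loop_def)

lemma continuous_loop: "continuous_map (top_of_set (sphere 0 1)) (mtopology_of X) loop"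
proof (rule continuous_map_into_metric_tendsto)
  show "loop w \<in> mspace X" if "w \<in> sphere 0 1" for w using that loop_config by simp
  fix v :: complex assume v: "v \<in> sphere 0 1"
  have ev: "\<forall>\<^sub>F u in at v within sphere 0 1. u \<in> sphere 0 1" by (auto simp: eventually_at_filter)
  have "((\<lambda>u. (1, u, 0)) \<longlongrightarrow> (1, v, 0)) (at v within sphere 0 1)" by (intro tendsto_intros)
  then have "((\<lambda>u. cone_dist (1, u, 0) (1, v, 0)) \<longlongrightarrow> 0) (at v within sphere 0 1)"
    by (rule tendsto_cone_dist) (use ev v config_cone_D(1)[OF loop_in] in \<open>auto elim!: eventually_mono\<close>)
  moreover have "\<forall>\<^sub>F u in at v within sphere 0 1. cone_dist (1, u, 0) (1, v, 0) = mdist X (loop u) (loop v)"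
    using ev by eventually_elim (use v in \<open>simp add: mdist_X loop_config\<close>, simp add: loop_def polar_cart loop_in)
  ultimately show "((\<lambda>u. mdist X (loop u) (loop v)) \<longlongrightarrow> 0) (at v within sphere 0 1)"
    by (rule Lim_transform_eventually)
qed

text \<open>The directions along the chosen paths from \<open>loop 1\<close> to \<open>loop w\<close> would
  form a homotopy from a constant map to the identity of the circle.\<close>

lemma no_global_section:
  assumes s: "continuous_map (prod_topology (mtopology_of X) (mtopology_of X)) (path_space (mtopology_of X)) s"
    and ends: "\<And>f g. f \<in> mspace M \<Longrightarrow> g \<in> mspace M \<Longrightarrow> s (f, g) \<in> paths_between (mtopology_of X) f g"
  shows False
proof -
  let ?S = "sphere (0::complex) 1"
  have "continuous_map (top_of_set ?S) (prod_topology (mtopology_of X) (mtopology_of X)) (\<lambda>w. (loop 1, loop w))"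
    using continuous_loop loop_config[of 1] by (intro continuous_map_pairedI) auto
  then have "continuous_map (top_of_set ?S) (path_space (mtopology_of X)) (\<lambda>w. s (loop 1, loop w))"
    using continuous_map_compose[OF _ s] by (simp add: o_def)
  then have "continuous_map (prod_topology (top_of_set ?S) unit_interval) (mtopology_of X) (\<lambda>p. s (loop 1, loop (fst p)) (snd p))"
    unfolding path_space_def by (rule continuous_map_uncurry[OF _ unit_interval_base])
  from continuous_map_compose[OF this continuous_direction]
  have "continuous_map (prod_topology (top_of_set ?S) unit_interval) euclidean (\<lambda>p. direction (s (loop 1, loop (fst p)) (snd p)))"
    by (simp only: o_def)
  moreover have "prod_topology (top_of_set ?S) unit_interval = top_of_set (?S \<times> {0..1})"
    by (simp add: prod_topology_subtopology euclidean_product_topology subtopology_subtopology Times_Int_Times)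
  ultimately have c: "continuous_on (?S \<times> {0..1}) (\<lambda>p. direction (s (loop 1, loop (fst p)) (snd p)))"
    by (simp only: continuous_map_iff_continuous)
  define h where "h p = direction (s (loop 1, loop (snd p)) (fst p))" for p :: "real \<times> complex"
  have hc: "continuous_on ({0..1} \<times> ?S) h"
    unfolding h_def[abs_def]
  proof -
    have sw: "continuous_on ({0..1} \<times> ?S) (\<lambda>p. (snd p, fst p))"
      by (intro continuous_intros)
    have "(\<lambda>p. (snd p, fst p)) ` ({0..1} \<times> ?S) \<subseteq> ?S \<times> {0..1::real}" by auto
    from continuous_on_compose2[OF c sw this]
    show "continuous_on ({0..1} \<times> ?S) (\<lambda>p. direction (s (loop 1, loop (snd p)) (fst p)))" by simp
  qed
  have hS: "h p \<in> ?S" if "p \<in> {0..1} \<times> ?S" for p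
  proof -
    have "s (loop 1, loop (snd p)) \<in> paths_between (mtopology_of X) (loop 1) (loop (snd p))"
      using that by (intro ends loop_config) auto
    then have "s (loop 1, loop (snd p)) (fst p) \<in> mspace M"
      using that by (auto simp: paths_between_def path_space_topspace continuous_map_def Pi_iff)
    then show ?thesis using norm_direction by (simp add: h_def)
  qed
  have e: "s (loop 1, loop w) 0 = loop 1" "s (loop 1, loop w) 1 = loop w" if "w \<in> ?S" for w
    using ends[of "loop 1" "loop w"] that loop_config by (auto simp: paths_between_def)
  have "homotopic_with_canon (\<lambda>x. True) ?S ?S (\<lambda>x. 1) id"
  proof (subst homotopic_with, simp, intro exI[of _ h] conjI ballI)
    have "prod_topology unit_interval (top_of_set ?S) = top_of_set ({0..1} \<times> ?S)"
      by (simp add: prod_topology_subtopology euclidean_product_topology subtopology_subtopology Times_Int_Times)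
    then show "continuous_map (prod_topology unit_interval (top_of_set ?S)) (top_of_set ?S) h"
      using hc hS by (auto simp: continuous_map_in_subtopology)
    show "h (0, w) = 1" "h (1, w) = id w" if "w \<in> topspace (top_of_set ?S)" for w
      using that e[of w] direction_loop[of 1] direction_loop[of w] by (auto simp: h_def)
  qed auto
  then have "contractible ?S"
    unfolding contractible_def using homotopic_with_symD by blast
  then show False by (simp add: contractible_sphere)
qed

lemma TC_ge_1: "1 \<le> TC (mtopology_of X)"
proof -
  let ?T = "prod_topology (mtopology_of X) (mtopology_of X)"
  have "1 \<le> enat k" if E: "locally_compact_partition ?T k E" and s: "\<forall>i\<le>k. \<exists>s. continuous_map (subtopology ?T (E i))
        (path_space (mtopology_of X)) s \<and> (\<forall>(x0, x1)\<in>E i. s (x0, x1) \<in> paths_between (mtopology_of X) x0 x1)" for k E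
  proof (cases k)
    case 0
    then have E0: "E 0 = topspace ?T" using E by (simp add: locally_compact_partition_def)
    obtain s where "continuous_map (subtopology ?T (E 0)) (path_space (mtopology_of X)) s"
      "\<forall>(x0, x1)\<in>E 0. s (x0, x1) \<in> paths_between (mtopology_of X) x0 x1" using s by blast
    then have False
      unfolding E0 subtopology_topspace by (intro no_global_section[of s]) auto
    then show ?thesis ..
  next
    case (Suc n)
    then show ?thesis by (simp add: one_enat_def)
  qed
  then show ?thesis unfolding TC_def by (intro INF_greatest) blast
qed

lemma GC_TC_eq_1: "GC X = 1 \<and> TC (mtopology_of M) = 1"
proof -
  have "1 \<le> TC (mtopology_of X)" "TC (mtopology_of X) \<le> GC X" "GC X \<le> 1"
    by (rule TC_ge_1 TC_le_GC GC_le_1)+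
  then have "GC X = 1" "TC (mtopology_of X) = 1" by auto
  then show ?thesis by (simp add: mtopology_X)
qed

end

theorem theorem4p4:
  fixes L :: "3 \<Rightarrow> real"
  assumes "\<And>i. 2 \<le> L i"
  shows "GC (intrinsic_metric (config2 (Y_graph L))) = 1 \<and>
         TC (mtopology_of (config2 (Y_graph L))) = 1"
  by (rule arms.GC_TC_eq_1[OF arms.intro[OF assms]])

end
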